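(* Let $G$ be a group (not necessarily finite) and let $K$ be a field such that: (1) $\mathrm{Soc}(G)$ is essential in $G$; (2) if $K$ has prime characteristic $p$ and $M$ is a minimal normal subgroup of $G$ that is also a non-abelian $p$-group that is not finitely generated, then $M$ admits a non-trivial irreducible representation over $K$; (3) $\mathrm{char}(K)\notin\Pi(G)$; (4) $\mathrm{T}(G)$ has a subgroup $S$ such that $\mathrm{T}(G)/S$ is locally cyclic and $\mathrm{core}_G(S)=1$. Then $G$ has a faithful irreducible representation over $K$.
   Context: Representations over $K$ are homomorphisms $G\to \mathrm{GL}(V)$ with $V$ a $K$-vector space of arbitrary (possibly infinite) dimension; irreducible means that $V\neq 0$ and $V$ has no invariant $K$-subspaces other than $0$ and $V$. $\mathrm{Soc}(G)$ is the subgroup of $G$ generated by all minimal normal subgroups of $G$ (possibly trivial). $\mathrm{T}(G)$ is the subgroup of $\mathrm{Soc}(G)$ generated by all minimal normal subgroups of $G$ that are torsion abelian. For a prime $p$, $\mathrm{T}(G)_p$ is the $p$-part of $\mathrm{T}(G)$, and $\Pi(G)$ is the set of all primes $p$ such that $\mathrm{T}(G)_p$ is non-trivial. A normal subgroup $N$ of $G$ is essential if every non-trivial normal subgroup of $G$ intersects $N$ non-trivially. $\mathrm{core}_G(S)=\bigcap_{g\in G} gSg^{-1}$ is the largest normal subgroup of $G$ contained in $S$. A group is locally cyclic if all its finitely generated subgroups are cyclic. A $p$-group is a group in which every element has order a power of $p$. *)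

theory Defs
  imports
    "HOL-Computational_Algebra.Primes"
    "HOL-Algebra.Module"
    "HOL-Algebra.Bij"
    "HOL-Algebra.Coset"
    "HOL-Algebra.Generated_Groups"
    "HOL-Algebra.Elementary_Groups"
    "HOL-Algebra.Multiplicative_Group"
begin

section \<open>Groups\<close>

text \<open>A subgroup \<open>N\<close> of \<open>G\<close>, regarded as a group, is \<open>G\<lparr>carrier := N\<rparr>\<close>.
  The library's \<open>group.ord G x\<close> is \<open>0\<close> when \<open>x\<close> has infinite order.\<close>

definition torsion_group :: "('g, 'b) monoid_scheme \<Rightarrow> bool" where
  "torsion_group G \<longleftrightarrow> group G \<and> (\<forall>x\<in>carrier G. group.ord G x \<noteq> 0)"

definition p_group :: "nat \<Rightarrow> ('g, 'b) monoid_scheme \<Rightarrow> bool" where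
  "p_group p G \<longleftrightarrow> group G \<and> (\<forall>x\<in>carrier G. \<exists>k. group.ord G x = p ^ k)"

definition finitely_generated_group :: "('g, 'b) monoid_scheme \<Rightarrow> bool" where
  "finitely_generated_group G \<longleftrightarrow>
     group G \<and> (\<exists>A. finite A \<and> A \<subseteq> carrier G \<and> generate G A = carrier G)"

definition locally_cyclic_group :: "('g, 'b) monoid_scheme \<Rightarrow> bool" where
  "locally_cyclic_group G \<longleftrightarrow>
     group G \<and> (\<forall>H. subgroup H G \<and> finitely_generated_group (G\<lparr>carrier := H\<rparr>)
                    \<longrightarrow> cyclic_group (G\<lparr>carrier := H\<rparr>))"

definition minimal_normal_subgroup :: "('g, 'b) monoid_scheme \<Rightarrow> 'g set \<Rightarrow> bool" where
  "minimal_normal_subgroup G N \<longleftrightarrow>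
     N \<lhd> G \<and> N \<noteq> {\<one>\<^bsub>G\<^esub>} \<and> (\<forall>H. H \<lhd> G \<and> H \<subseteq> N \<longrightarrow> H = {\<one>\<^bsub>G\<^esub>} \<or> H = N)"

definition Soc :: "('g, 'b) monoid_scheme \<Rightarrow> 'g set" where
  "Soc G = generate G (\<Union>{N. minimal_normal_subgroup G N})"

definition tor_Soc :: "('g, 'b) monoid_scheme \<Rightarrow> 'g set" where
  "tor_Soc G = generate G (\<Union>{N. minimal_normal_subgroup G N \<and>
     comm_group (G\<lparr>carrier := N\<rparr>) \<and> torsion_group (G\<lparr>carrier := N\<rparr>)})"

text \<open>The subgroup \<open>T(G)\<close> is \<open>tor_Soc G\<close>. It is a torsion abelian group, so its \<open>p\<close>-part is
  the set of its elements of \<open>p\<close>-power order.\<close>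

definition tor_Soc_part :: "('g, 'b) monoid_scheme \<Rightarrow> nat \<Rightarrow> 'g set" where
  "tor_Soc_part G p = {x \<in> tor_Soc G. \<exists>k. group.ord G x = p ^ k}"

definition tor_Soc_primes :: "('g, 'b) monoid_scheme \<Rightarrow> nat set" where
  "tor_Soc_primes G =
     {p. normalization_semidom_class.prime p \<and> tor_Soc_part G p \<noteq> {\<one>\<^bsub>G\<^esub>}}"

definition essential_normal_subgroup :: "('g, 'b) monoid_scheme \<Rightarrow> 'g set \<Rightarrow> bool" where
  "essential_normal_subgroup G N \<longleftrightarrow>
     N \<lhd> G \<and> (\<forall>H. H \<lhd> G \<and> H \<noteq> {\<one>\<^bsub>G\<^esub>} \<longrightarrow> H \<inter> N \<noteq> {\<one>\<^bsub>G\<^esub>})"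

definition normal_core :: "('g, 'b) monoid_scheme \<Rightarrow> 'g set \<Rightarrow> 'g set" where
  "normal_core G S = (\<Inter>g\<in>carrier G. (g <#\<^bsub>G\<^esub> S) #>\<^bsub>G\<^esub> (inv\<^bsub>G\<^esub> g))"


section \<open>Fields and representations\<close>

text \<open>The characteristic is the additive order of \<open>\<one>\<close>, which is \<open>0\<close> if that order is infinite.\<close>

definition ring_char :: "('k, 'c) ring_scheme \<Rightarrow> nat" where
  "ring_char K = group.ord (add_monoid K) \<one>\<^bsub>K\<^esub>"

text \<open>A vector space over a field \<open>K\<close> is a \<open>module K V\<close>. As in \<^const>\<open>BijGroup\<close>, the elements of
  \<open>GL K V\<close> are extensional functions on \<open>carrier V\<close>.\<close>

definition GL :: "('k, 'c) ring_scheme \<Rightarrow> ('k, 'v, 'm) module_scheme \<Rightarrow> ('v \<Rightarrow> 'v) monoid" where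
  "GL K V = (BijGroup (carrier V))\<lparr>carrier := {f \<in> Bij (carrier V).
     (\<forall>x\<in>carrier V. \<forall>y\<in>carrier V. f (x \<oplus>\<^bsub>V\<^esub> y) = f x \<oplus>\<^bsub>V\<^esub> f y) \<and>
     (\<forall>a\<in>carrier K. \<forall>x\<in>carrier V. f (a \<odot>\<^bsub>V\<^esub> x) = a \<odot>\<^bsub>V\<^esub> f x)}\<rparr>"

lemma (in module) group_GL: "group (GL R M)"
proof -
  interpret B: group "BijGroup (carrier M)" by (rule group_BijGroup)
  let ?H = "carrier (GL R M)"
  have mem: "f \<in> ?H \<longleftrightarrow> f \<in> Bij (carrier M) \<and>
      (\<forall>x\<in>carrier M. \<forall>y\<in>carrier M. f (x \<oplus>\<^bsub>M\<^esub> y) = f x \<oplus>\<^bsub>M\<^esub> f y) \<and>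
      (\<forall>a\<in>carrier R. \<forall>x\<in>carrier M. f (a \<odot>\<^bsub>M\<^esub> x) = a \<odot>\<^bsub>M\<^esub> f x)" for f
    by (simp add: GL_def)
  have "subgroup ?H (BijGroup (carrier M))"
  proof (rule B.subgroupI)
    show "?H \<subseteq> carrier (BijGroup (carrier M))"
      unfolding mem subset_iff by (simp add: BijGroup_def)
    have "(\<lambda>x\<in>carrier M. x) \<in> ?H"
      unfolding mem by (simp add: id_Bij)
    then show "?H \<noteq> {}" by blast
  next
    fix f assume f: "f \<in> ?H"
    then have fB: "f \<in> Bij (carrier M)" by (simp only: mem)
    have add: "f (x \<oplus>\<^bsub>M\<^esub> y) = f x \<oplus>\<^bsub>M\<^esub> f y" if "x \<in> carrier M" "y \<in> carrier M" for x y
      using f that unfolding mem by blast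
    have scale: "f (a \<odot>\<^bsub>M\<^esub> x) = a \<odot>\<^bsub>M\<^esub> f x" if "a \<in> carrier R" "x \<in> carrier M" for a x
      using f that unfolding mem by blast
    let ?g = "restrict (inv_into (carrier M) f) (carrier M)"
    have img: "f ` carrier M = carrier M" and inj: "inj_on f (carrier M)"
      using fB by (auto simp: Bij_def bij_betw_def)
    have cl: "f u \<in> carrier M" if "u \<in> carrier M" for u using img that by blast
    have ex: thesis if "x \<in> carrier M" "\<And>u. u \<in> carrier M \<Longrightarrow> x = f u \<Longrightarrow> thesis" for x thesis
      using that img by (metis imageE)
    have g: "?g (f u) = u" if "u \<in> carrier M" for u
      using that inj by (simp add: cl)
    have g_add: "?g (x \<oplus>\<^bsub>M\<^esub> y) = ?g x \<oplus>\<^bsub>M\<^esub> ?g y" if xy: "x \<in> carrier M" "y \<in> carrier M" for x y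
    proof -
      obtain u where ux: "u \<in> carrier M" "x = f u" by (rule ex[OF xy(1)])
      obtain v where vy: "v \<in> carrier M" "y = f v" by (rule ex[OF xy(2)])
      show ?thesis
        unfolding ux(2) vy(2) add[OF ux(1) vy(1), symmetric] g[OF ux(1)] g[OF vy(1)]
        by (rule g[OF M.a_closed[OF ux(1) vy(1)]])
    qed
    have g_scale: "?g (a \<odot>\<^bsub>M\<^esub> x) = a \<odot>\<^bsub>M\<^esub> ?g x" if ax: "a \<in> carrier R" "x \<in> carrier M" for a x
    proof -
      obtain u where u: "u \<in> carrier M" "x = f u" by (rule ex[OF ax(2)])
      show ?thesis
        unfolding u(2) scale[OF ax(1) u(1), symmetric] g[OF u(1)]
        by (rule g[OF smult_closed[OF ax(1) u(1)]])
    qed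
    have "?g \<in> ?H"
      unfolding mem using restrict_inv_into_Bij[OF fB] g_add g_scale by blast
    then show "inv\<^bsub>BijGroup (carrier M)\<^esub> f \<in> ?H"
      by (simp only: inv_BijGroup[OF fB])
  next
    fix f g assume fg: "f \<in> ?H" "g \<in> ?H"
    then have B: "f \<in> Bij (carrier M)" "g \<in> Bij (carrier M)" by (simp_all only: mem)
    have g: "g x \<in> carrier M" if "x \<in> carrier M" for x
      using Bij_imp_funcset[OF B(2)] that by (rule funcset_mem)
    have "compose (carrier M) f g \<in> ?H"
      using fg unfolding mem by (simp add: compose_Bij compose_eq g)
    then show "f \<otimes>\<^bsub>BijGroup (carrier M)\<^esub> g \<in> ?H"
      by (simp add: BijGroup_def B)
  qed
  from B.subgroup_imp_group[OF this] show ?thesis by (simp add: GL_def)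
qed

definition representation ::
  "('k, 'c) ring_scheme \<Rightarrow> ('g, 'b) monoid_scheme \<Rightarrow> ('k, 'v, 'm) module_scheme
     \<Rightarrow> ('g \<Rightarrow> 'v \<Rightarrow> 'v) \<Rightarrow> bool" where
  "representation K G V \<rho> \<longleftrightarrow> field K \<and> group G \<and> module K V \<and> \<rho> \<in> hom G (GL K V)"

definition irreducible_representation ::
  "('k, 'c) ring_scheme \<Rightarrow> ('g, 'b) monoid_scheme \<Rightarrow> ('k, 'v, 'm) module_scheme
     \<Rightarrow> ('g \<Rightarrow> 'v \<Rightarrow> 'v) \<Rightarrow> bool" where
  "irreducible_representation K G V \<rho> \<longleftrightarrow>
     representation K G V \<rho> \<and> carrier V \<noteq> {\<zero>\<^bsub>V\<^esub>} \<and>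
     (\<forall>W. submodule W K V \<and> (\<forall>g\<in>carrier G. \<rho> g ` W \<subseteq> W) \<longrightarrow> W = {\<zero>\<^bsub>V\<^esub>} \<or> W = carrier V)"

definition nontrivial_representation ::
  "('k, 'c) ring_scheme \<Rightarrow> ('g, 'b) monoid_scheme \<Rightarrow> ('k, 'v, 'm) module_scheme
     \<Rightarrow> ('g \<Rightarrow> 'v \<Rightarrow> 'v) \<Rightarrow> bool" where
  "nontrivial_representation K G V \<rho> \<longleftrightarrow>
     representation K G V \<rho> \<and> (\<exists>g\<in>carrier G. \<rho> g \<noteq> \<one>\<^bsub>GL K V\<^esub>)"

definition faithful_representation ::
  "('k, 'c) ring_scheme \<Rightarrow> ('g, 'b) monoid_scheme \<Rightarrow> ('k, 'v, 'm) module_scheme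
     \<Rightarrow> ('g \<Rightarrow> 'v \<Rightarrow> 'v) \<Rightarrow> bool" where
  "faithful_representation K G V \<rho> \<longleftrightarrow>
     representation K G V \<rho> \<and> inj_on \<rho> (carrier G)"

text \<open>HOL cannot quantify existentially over the type of the vectors of \<open>V\<close>. An irreducible
  representation of \<open>G\<close> over \<open>K\<close> is cyclic as a module over the group algebra \<open>K[G]\<close>, hence
  isomorphic to \<open>K[G]/I\<close> for a left ideal \<open>I\<close>. Elements of \<open>K[G]\<close> are functions
  \<open>'g \<Rightarrow> 'k\<close>, so every irreducible representation has an isomorphic copy with vectors in the
  type \<open>('g \<Rightarrow> 'k) set\<close> of cosets. Existence claims are therefore stated over that type,
  whereas an existence hypothesis may be stated over an arbitrary type \<open>'v\<close>, which is then
  universally quantified in the theorem.\<close>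

end

theory Submission
  imports Defs
    "HOL-Algebra.Algebraic_Closure"
    "HOL-Algebra.Free_Abelian_Groups"
begin

text \<open>Since the socle is essential, a representation of \<open>G\<close> is faithful as soon as no minimal normal
  subgroup acts trivially, because every normal subgroup that meets the socle nontrivially contains
  a minimal one (\<open>contains_min_normal\<close>). A minimal normal subgroup \<open>N\<close> acts trivially on a cyclic
  module \<open>K[G]/Q\<close> if and only if \<open>Q\<close> contains all \<open>n - 1\<close> with \<open>n \<in> N\<close>. So it suffices to find a set
  \<open>E\<close> of elements of \<open>K[G]\<close> that generates a proper left ideal, but generates \<open>K[G]\<close> together with the
  elements \<open>n - 1\<close>, for each \<open>N\<close>: then \<open>K[G]/Q\<close> is faithful and irreducible for any maximal left
  ideal \<open>Q\<close> above \<open>E\<close> (\<open>irreducible_of_solvable\<close>). Properness is a matter of finitely many elements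
  of \<open>E\<close>, and it is expressed by duality: there is a function \<open>\<phi>: G \<rightarrow> K\<close> that is annihilated by these
  elements and not zero. Such functions, unlike ideals, can be multiplied along an internal direct
  product (\<open>solvable_on_combine\<close>), and so each kind of minimal normal subgroup can be treated
  separately.

  A nonabelian \<open>M\<close> contributes one element of \<open>K[M]\<close> that has nonzero augmentation and generates a
  proper left ideal. It exists if \<open>M\<close> has an irreducible representation that is not trivial, or if \<open>M\<close>
  has an element of infinite order or of prime order different from the characteristic
  (\<open>nonabelian_min_normal_solvable\<close>).

  For torsion abelian \<open>N\<close> of exponent \<open>p\<close>, the subgroup \<open>S\<close> singles out an element \<open>n \<in> N\<close> of order \<open>p\<close>
  modulo \<open>S\<close>, and \<open>1 + n + \<dots> + n\<^sup>p\<^sup>-\<^sup>1\<close> is the element sought (\<open>solvable_torsion_socle\<close>).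

  The torsion-free abelian minimal normal subgroups are divisible, and they generate a torsion-free
  abelian group \<open>A\<close>, which contains a free abelian group \<open>F\<close> with \<open>A/F\<close> torsion. If \<open>F\<close> has finite rank,
  there are countably many \<open>N\<close>, and elements \<open>1 + n + \<dots> + n\<^sup>l\<^sup>-\<^sup>1\<close> are adjoined one after the other,
  where \<open>n \<in> N\<close> is an \<open>l\<close>-th root of an element obtained before; divisibility provides new roots
  (\<open>solvable_finite_rank\<close>). If \<open>F\<close> has infinite rank, then there are enough free generators to force
  some \<open>1 - n\<close> with \<open>n \<in> N\<close> to be invertible, by the equation \<open>(1 - n) (y + z) = 1\<close> with generators
  \<open>y\<close> and \<open>z\<close> reserved for \<open>N\<close>; finitely many such equations are solved by a generic character of \<open>F\<close>
  with values in an algebraic closure of \<open>K\<close> (\<open>generic_hom\<close>, \<open>solvable_infinite_rank\<close>).\<close>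

section \<open>Linear equations on functions on a group\<close>

locale group_field = group G + K: field K
  for G :: "('g, 'b) monoid_scheme" (structure) and K :: "('k, 'c) ring_scheme"

text \<open>An element of the group algebra \<open>K[G]\<close> is a list \<open>e\<close> of pairs of a coefficient and a group
  element. It acts on functions \<open>\<phi>: G \<rightarrow> K\<close> through right translation of the argument, so that a
  left translate of a solution of \<open>e \<phi> = 0\<close> is again a solution. Since \<open>K\<^sup>G\<close> is the dual space of
  \<open>K[G]\<close>, a set \<open>E\<close> generates a proper left ideal exactly if it has a nonzero common solution.\<close>

definition comb_eval ::
  "('k, 'c) ring_scheme \<Rightarrow> ('g, 'b) monoid_scheme \<Rightarrow> ('k \<times> 'g) list \<Rightarrow> ('g \<Rightarrow> 'k) \<Rightarrow> 'g \<Rightarrow> 'k" where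
  "comb_eval K G e \<phi> g = foldr (\<lambda>(c, x) s. c \<otimes>\<^bsub>K\<^esub> \<phi> (g \<otimes>\<^bsub>G\<^esub> x) \<oplus>\<^bsub>K\<^esub> s) e \<zero>\<^bsub>K\<^esub>"

definition aug :: "('k, 'c) ring_scheme \<Rightarrow> ('k \<times> 'g) list \<Rightarrow> 'k" where
  "aug K e = foldr (\<lambda>(c, x) s. c \<oplus>\<^bsub>K\<^esub> s) e \<zero>\<^bsub>K\<^esub>"

definition solves ::
  "('k, 'c) ring_scheme \<Rightarrow> ('g, 'b) monoid_scheme \<Rightarrow> ('k \<times> 'g) list set \<Rightarrow> ('g \<Rightarrow> 'k) \<Rightarrow> bool" where
  "solves K G E \<phi> \<longleftrightarrow> \<phi> \<in> carrier G \<rightarrow> carrier K \<and>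
     (\<forall>e\<in>E. \<forall>g\<in>carrier G. comb_eval K G e \<phi> g = \<zero>\<^bsub>K\<^esub>)"

text \<open>The solution is normalised by \<open>\<phi> 1 = 1\<close>, so that solutions on different subgroups can be
  multiplied; translation and scaling give this for every nonzero solution.\<close>

definition solvable_on ::
  "('k, 'c) ring_scheme \<Rightarrow> ('g, 'b) monoid_scheme \<Rightarrow> 'g set \<Rightarrow> ('k \<times> 'g) list set \<Rightarrow> bool" where
  "solvable_on K G H E \<longleftrightarrow> (\<exists>\<phi>. solves K G E \<phi> \<and> \<phi> \<one>\<^bsub>G\<^esub> = \<one>\<^bsub>K\<^esub> \<and>
     (\<forall>g\<in>carrier G - H. \<phi> g = \<zero>\<^bsub>K\<^esub>))"

text \<open>On a nonzero module generated by a vector that \<open>E\<close> annihilates, a normal subgroup that \<open>E\<close> detects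
  cannot act trivially: the matrix coefficients of that vector would be invariant solutions.\<close>

definition detects ::
  "('k, 'c) ring_scheme \<Rightarrow> ('g, 'b) monoid_scheme \<Rightarrow> ('k \<times> 'g) list set \<Rightarrow> 'g set \<Rightarrow> bool" where
  "detects K G E N \<longleftrightarrow> (\<forall>\<phi>. solves K G E \<phi> \<and>
     (\<forall>g\<in>carrier G. \<forall>n\<in>N. \<phi> (g \<otimes>\<^bsub>G\<^esub> n) = \<phi> g) \<longrightarrow> (\<forall>g\<in>carrier G. \<phi> g = \<zero>\<^bsub>K\<^esub>))"

text \<open>The element \<open>1 + n + \<dots> + n\<^sup>l\<^sup>-\<^sup>1\<close> of \<open>K[G]\<close>.\<close>

definition geom :: "('k, 'c) ring_scheme \<Rightarrow> ('g, 'b) monoid_scheme \<Rightarrow> 'g \<Rightarrow> nat \<Rightarrow> ('k \<times> 'g) list" where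
  "geom K G n l = map (\<lambda>i. (\<one>\<^bsub>K\<^esub>, n [^]\<^bsub>G\<^esub> i)) [0..<l]"

abbreviation combs :: "('k, 'c) ring_scheme \<Rightarrow> 'g set \<Rightarrow> ('k \<times> 'g) list set" where
  "combs K H \<equiv> lists (carrier K \<times> H)"

lemma solves_mono: "solves K G E \<phi> \<Longrightarrow> E' \<subseteq> E \<Longrightarrow> solves K G E' \<phi>"
  by (auto simp: solves_def)

lemma detects_mono: "detects K G E N \<Longrightarrow> E \<subseteq> E' \<Longrightarrow> detects K G E' N"
  unfolding detects_def by (meson solves_mono)

lemma solvable_on_mono: "solvable_on K G H E \<Longrightarrow> E' \<subseteq> E \<Longrightarrow> solvable_on K G H E'"
  unfolding solvable_on_def by (meson solves_mono)

lemma solvable_on_superset: "solvable_on K G H E \<Longrightarrow> H \<subseteq> H' \<Longrightarrow> solvable_on K G H' E"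
  unfolding solvable_on_def by blast

context group_field
begin

lemma comb_eval_Nil [simp]: "comb_eval K G [] \<phi> g = \<zero>\<^bsub>K\<^esub>"
  by (simp add: comb_eval_def)

lemma comb_eval_Cons [simp]:
  "comb_eval K G (p # e) \<phi> g = fst p \<otimes>\<^bsub>K\<^esub> \<phi> (g \<otimes> snd p) \<oplus>\<^bsub>K\<^esub> comb_eval K G e \<phi> g"
  by (simp add: comb_eval_def split: prod.splits)

lemma aug_Nil [simp]: "aug K [] = \<zero>\<^bsub>K\<^esub>"
  by (simp add: aug_def)

lemma aug_Cons [simp]: "aug K (p # e) = fst p \<oplus>\<^bsub>K\<^esub> aug K e"
  by (simp add: aug_def split: prod.splits)

lemma combs_mono: "H \<subseteq> H' \<Longrightarrow> combs K H \<subseteq> combs K H'"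
  by (meson Sigma_mono lists_mono order_refl)

lemma comb_eval_closed [simp]:
  "\<lbrakk>e \<in> combs K (carrier G); \<phi> \<in> carrier G \<rightarrow> carrier K; g \<in> carrier G\<rbrakk>
   \<Longrightarrow> comb_eval K G e \<phi> g \<in> carrier K"
  by (induction e) (auto simp: Pi_iff)

lemma aug_closed [simp]: "e \<in> combs K H \<Longrightarrow> aug K e \<in> carrier K"
  by (induction e) auto

lemma comb_eval_append:
  "\<lbrakk>e \<in> combs K (carrier G); e' \<in> combs K (carrier G); \<phi> \<in> carrier G \<rightarrow> carrier K; g \<in> carrier G\<rbrakk>
   \<Longrightarrow> comb_eval K G (e @ e') \<phi> g = comb_eval K G e \<phi> g \<oplus>\<^bsub>K\<^esub> comb_eval K G e' \<phi> g"
proof (induction e)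
  case (Cons p e)
  then have "fst p \<in> carrier K" "snd p \<in> carrier G" and e: "e \<in> combs K (carrier G)" by auto
  moreover have "\<phi> (g \<otimes> snd p) \<in> carrier K" using calculation Cons.prems by auto
  ultimately show ?case
    using Cons.IH[OF e Cons.prems(2-4)] Cons.prems comb_eval_closed[OF e Cons.prems(3,4)]
      comb_eval_closed[OF Cons.prems(2-4)] by (simp add: K.a_assoc)
qed simp

lemma comb_eval_cong:
  "\<lbrakk>e \<in> combs K H; \<And>x. x \<in> H \<Longrightarrow> \<phi> (g \<otimes> x) = \<psi> (g' \<otimes> x)\<rbrakk>
   \<Longrightarrow> comb_eval K G e \<phi> g = comb_eval K G e \<psi> g'"
  by (induction e) auto

lemma comb_eval_eq_0:
  "\<lbrakk>e \<in> combs K H; \<And>x. x \<in> H \<Longrightarrow> \<phi> (g \<otimes> x) = \<zero>\<^bsub>K\<^esub>\<rbrakk> \<Longrightarrow> comb_eval K G e \<phi> g = \<zero>\<^bsub>K\<^esub>"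
  by (induction e) auto

lemma comb_eval_scaled:
  assumes "e \<in> combs K H" "c \<in> carrier K"
    and "\<And>x. x \<in> H \<Longrightarrow> \<psi> (g' \<otimes> x) \<in> carrier K \<and> \<phi> (g \<otimes> x) = c \<otimes>\<^bsub>K\<^esub> \<psi> (g' \<otimes> x)"
  shows "comb_eval K G e \<psi> g' \<in> carrier K \<and>
         comb_eval K G e \<phi> g = c \<otimes>\<^bsub>K\<^esub> comb_eval K G e \<psi> g'"
  using assms
proof (induction e rule: list.induct)
  case (Cons p e)
  obtain a x where "p = (a, x)" by (cases p)
  moreover have "p \<in> carrier K \<times> H" using Cons.prems(1) by simp
  ultimately have p: "p = (a, x)" "a \<in> carrier K" "x \<in> H" by auto
  have e: "e \<in> combs K H" using Cons.prems(1) by simp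
  note IH = Cons.IH[OF e Cons.prems(2,3)]
  show ?case
    using IH p Cons.prems(2) Cons.prems(3)[OF p(3)]
    by (simp add: K.r_distr K.m_lcomm)
qed auto

lemma comb_eval_diff:
  assumes "e \<in> combs K H"
    and "\<And>x. x \<in> H \<Longrightarrow> \<phi> (g \<otimes> x) \<in> carrier K \<and> \<psi> (g \<otimes> x) \<in> carrier K"
  shows "comb_eval K G e \<phi> g \<in> carrier K \<and> comb_eval K G e \<psi> g \<in> carrier K \<and>
    comb_eval K G e (\<lambda>g. \<phi> g \<ominus>\<^bsub>K\<^esub> \<psi> g) g = comb_eval K G e \<phi> g \<ominus>\<^bsub>K\<^esub> comb_eval K G e \<psi> g"
  using assms
proof (induction e rule: list.induct)
  case (Cons p e)
  obtain a x where "p = (a, x)" by (cases p)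
  moreover have "p \<in> carrier K \<times> H" using Cons.prems(1) by simp
  ultimately have p: "p = (a, x)" "a \<in> carrier K" "x \<in> H" by auto
  have e: "e \<in> combs K H" using Cons.prems(1) by simp
  note IH = Cons.IH[OF e Cons.prems(2)]
  show ?case
    using IH p Cons.prems(2)[OF p(3)]
    by (simp add: K.minus_eq K.r_distr K.r_minus K.minus_add K.a_ac)
qed (auto simp: K.minus_eq)

lemma comb_eval_invariant:
  assumes "e \<in> combs K N" "\<phi> g \<in> carrier K" "\<And>n. n \<in> N \<Longrightarrow> \<phi> (g \<otimes> n) = \<phi> g"
  shows "comb_eval K G e \<phi> g = aug K e \<otimes>\<^bsub>K\<^esub> \<phi> g"
  using assms
proof (induction e rule: list.induct)
  case (Cons p e)
  then have e: "e \<in> combs K N" by simp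
  show ?case using Cons aug_closed[OF e] by (cases p) (auto simp: K.l_distr)
qed simp

text \<open>An element of \<open>K[N]\<close> acts through its augmentation on functions that are invariant under \<open>N\<close>,
  and a nonzero scalar annihilates only the zero function.\<close>

lemma detects_aug:
  assumes "e \<in> combs K N" "N \<subseteq> carrier G" "aug K e \<noteq> \<zero>\<^bsub>K\<^esub>"
  shows "detects K G {e} N"
  unfolding detects_def
proof (intro allI impI ballI)
  fix \<phi> g assume *: "solves K G {e} \<phi> \<and> (\<forall>g\<in>carrier G. \<forall>n\<in>N. \<phi> (g \<otimes> n) = \<phi> g)"
    and g: "g \<in> carrier G"
  then have \<phi>: "\<phi> g \<in> carrier K" by (auto simp: solves_def)
  have "aug K e \<otimes>\<^bsub>K\<^esub> \<phi> g = \<zero>\<^bsub>K\<^esub>"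
    using comb_eval_invariant[of e N \<phi> g, OF assms(1) \<phi>] * g by (auto simp: solves_def)
  then show "\<phi> g = \<zero>\<^bsub>K\<^esub>"
    using assms(3) aug_closed[OF assms(1)] \<phi> K.integral by blast
qed

lemma solves_translate:
  assumes "solves K G E \<phi>" "E \<subseteq> combs K (carrier G)" "a \<in> carrier G"
  shows "solves K G E (\<lambda>g. \<phi> (a \<otimes> g))"
  unfolding solves_def
proof (intro conjI ballI)
  show "(\<lambda>g. \<phi> (a \<otimes> g)) \<in> carrier G \<rightarrow> carrier K" using assms by (auto simp: solves_def)
  fix e g assume e: "e \<in> E" "g \<in> carrier G"
  have "comb_eval K G e (\<lambda>g. \<phi> (a \<otimes> g)) g = comb_eval K G e \<phi> (a \<otimes> g)"
    by (rule comb_eval_cong[of e "carrier G"]) (use assms e in \<open>auto simp: m_assoc\<close>)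
  then show "comb_eval K G e (\<lambda>g. \<phi> (a \<otimes> g)) g = \<zero>\<^bsub>K\<^esub>"
    using assms e by (auto simp: solves_def)
qed

lemma solves_scale:
  assumes "solves K G E \<phi>" "E \<subseteq> combs K (carrier G)" "c \<in> carrier K"
  shows "solves K G E (\<lambda>g. c \<otimes>\<^bsub>K\<^esub> \<phi> g)"
  unfolding solves_def
proof (intro conjI ballI)
  show "(\<lambda>g. c \<otimes>\<^bsub>K\<^esub> \<phi> g) \<in> carrier G \<rightarrow> carrier K" using assms by (auto simp: solves_def)
  fix e g assume e: "e \<in> E" "g \<in> carrier G"
  have "comb_eval K G e (\<lambda>g. c \<otimes>\<^bsub>K\<^esub> \<phi> g) g = c \<otimes>\<^bsub>K\<^esub> comb_eval K G e \<phi> g"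
    by (rule comb_eval_scaled[of e "carrier G", THEN conjunct2])
      (use assms e in \<open>auto simp: solves_def\<close>)
  then show "comb_eval K G e (\<lambda>g. c \<otimes>\<^bsub>K\<^esub> \<phi> g) g = \<zero>\<^bsub>K\<^esub>"
    using assms e by (auto simp: solves_def)
qed

lemma subgroup_mult_mem_iff:
  "\<lbrakk>subgroup H G; x \<in> H; g \<in> carrier G\<rbrakk> \<Longrightarrow> g \<otimes> x \<in> H \<longleftrightarrow> g \<in> H"
proof
  assume H: "subgroup H G" "x \<in> H" "g \<in> carrier G" "g \<otimes> x \<in> H"
  then have "(g \<otimes> x) \<otimes> inv x \<in> H" by (meson subgroup.m_closed subgroup.m_inv_closed)
  then show "g \<in> H" using H by (simp add: inv_solve_right' m_assoc subgroup.mem_carrier)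
qed (auto intro: subgroup.m_closed)

lemma solves_restrict:
  assumes "solves K G E \<phi>" "subgroup H G" "E \<subseteq> combs K H"
  shows "solves K G E (\<lambda>g. if g \<in> H then \<phi> g else \<zero>\<^bsub>K\<^esub>)"
  unfolding solves_def
proof (intro conjI ballI)
  let ?\<psi> = "\<lambda>g. if g \<in> H then \<phi> g else \<zero>\<^bsub>K\<^esub>"
  show "?\<psi> \<in> carrier G \<rightarrow> carrier K" using assms by (auto simp: solves_def)
  fix e g assume e: "e \<in> E" "g \<in> carrier G"
  then have eH: "e \<in> combs K H" using assms by auto
  show "comb_eval K G e ?\<psi> g = \<zero>\<^bsub>K\<^esub>"
  proof (cases "g \<in> H")
    case True
    then have "comb_eval K G e ?\<psi> g = comb_eval K G e \<phi> g"
      by (intro comb_eval_cong[OF eH]) (auto simp: subgroup.m_closed[OF assms(2)])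
    then show ?thesis using assms e by (auto simp: solves_def)
  next
    case False
    then show ?thesis
      by (intro comb_eval_eq_0[OF eH]) (use e in \<open>auto simp: subgroup_mult_mem_iff[OF assms(2)]\<close>)
  qed
qed

lemma solvable_onI:
  assumes "solves K G E \<phi>" "subgroup H G" "E \<subseteq> combs K H" "a \<in> carrier G" "\<phi> a \<noteq> \<zero>\<^bsub>K\<^esub>"
  shows "solvable_on K G H E"
proof -
  have E: "E \<subseteq> combs K (carrier G)"
    using assms(3) combs_mono[OF subgroup.subset[OF assms(2)]] by blast
  have \<phi>a: "\<phi> a \<in> carrier K" "\<phi> a \<in> Units K"
    using assms K.field_Units by (auto simp: solves_def)
  define \<psi> where "\<psi> = (\<lambda>g. inv\<^bsub>K\<^esub> (\<phi> a) \<otimes>\<^bsub>K\<^esub> \<phi> (a \<otimes> g))"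
  have "solves K G E \<psi>"
    unfolding \<psi>_def using solves_scale[OF solves_translate[OF assms(1) E assms(4)] E] \<phi>a by auto
  from solves_restrict[OF this assms(2,3)]
  show ?thesis
    unfolding solvable_on_def
    by (rule_tac x="\<lambda>g. if g \<in> H then \<psi> g else \<zero>\<^bsub>K\<^esub>" in exI)
      (use \<phi>a assms subgroup.one_closed[OF assms(2)] in \<open>auto simp: \<psi>_def\<close>)
qed

lemma commuting_set_mult_subgroup:
  assumes H1: "subgroup H1 G" and H2: "subgroup H2 G"
    and comm: "\<And>x y. \<lbrakk>x \<in> H1; y \<in> H2\<rbrakk> \<Longrightarrow> x \<otimes> y = y \<otimes> x"
  shows "subgroup (H1 <#> H2) G"
proof (rule subgroupI)
  have H: "x \<in> carrier G" if "x \<in> H1 \<or> x \<in> H2" for x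
    using that subgroup.mem_carrier[OF H1] subgroup.mem_carrier[OF H2] by blast
  show "H1 <#> H2 \<subseteq> carrier G" using H by (auto simp: set_mult_def)
  show "H1 <#> H2 \<noteq> {}"
    using subgroup.one_closed[OF H1] subgroup.one_closed[OF H2] by (auto simp: set_mult_def)
  fix a assume "a \<in> H1 <#> H2"
  then obtain x y where xy: "x \<in> H1" "y \<in> H2" "a = x \<otimes> y" by (auto simp: set_mult_def)
  have "inv a = inv x \<otimes> inv y" using xy H comm[of x y] by (simp add: inv_mult_group)
  then show "inv a \<in> H1 <#> H2"
    using subgroup.m_inv_closed[OF H1 xy(1)] subgroup.m_inv_closed[OF H2 xy(2)]
    by (auto simp: set_mult_def)
  fix b assume "b \<in> H1 <#> H2"
  then obtain x' y' where xy': "x' \<in> H1" "y' \<in> H2" "b = x' \<otimes> y'" by (auto simp: set_mult_def)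
  have "x' \<otimes> y = y \<otimes> x'" using comm xy xy' by blast
  then have "y \<otimes> (x' \<otimes> y') = x' \<otimes> (y \<otimes> y')" using xy xy' H by (metis m_assoc)
  then have "a \<otimes> b = (x \<otimes> x') \<otimes> (y \<otimes> y')" using xy xy' H by (simp add: m_assoc)
  then show "a \<otimes> b \<in> H1 <#> H2"
    using subgroup.m_closed[OF H1 xy(1) xy'(1)] subgroup.m_closed[OF H2 xy(2) xy'(2)]
    by (auto simp: set_mult_def)
qed

text \<open>If \<open>\<phi>\<^sub>1\<close> and \<open>\<phi>\<^sub>2\<close> are solutions, then so is \<open>\<phi> (x y) = \<phi>\<^sub>1 x \<cdot> \<phi>\<^sub>2 y\<close> on the internal direct
  product: since the factors commute, right translation by an element of one of them changes only
  the corresponding argument. This is the tensor product of the two cyclic modules, expressed by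
  matrix coefficients.\<close>

lemma solvable_on_combine:
  assumes H1: "subgroup H1 G" and H2: "subgroup H2 G"
    and comm: "\<And>x y. \<lbrakk>x \<in> H1; y \<in> H2\<rbrakk> \<Longrightarrow> x \<otimes> y = y \<otimes> x"
    and triv: "H1 \<inter> H2 = {\<one>}"
    and E1: "solvable_on K G H1 E1" "E1 \<subseteq> combs K H1"
    and E2: "solvable_on K G H2 E2" "E2 \<subseteq> combs K H2"
  shows "solvable_on K G (H1 <#> H2) (E1 \<union> E2)"
proof -
  obtain \<phi>1 where \<phi>1: "solves K G E1 \<phi>1" "\<phi>1 \<one> = \<one>\<^bsub>K\<^esub>" using E1 by (auto simp: solvable_on_def)
  obtain \<phi>2 where \<phi>2: "solves K G E2 \<phi>2" "\<phi>2 \<one> = \<one>\<^bsub>K\<^esub>" using E2 by (auto simp: solvable_on_def)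
  have H: "x \<in> carrier G" if "x \<in> H1 \<or> x \<in> H2" for x
    using that subgroup.mem_carrier[OF H1] subgroup.mem_carrier[OF H2] by blast
  have \<phi>: "\<phi>1 x \<in> carrier K" "\<phi>2 x \<in> carrier K" if "x \<in> carrier G" for x
    using \<phi>1 \<phi>2 that by (auto simp: solves_def)
  have uniq: "x = x' \<and> y = y'" if "x \<in> H1" "x' \<in> H1" "y \<in> H2" "y' \<in> H2" "x \<otimes> y = x' \<otimes> y'"
    for x x' y y'
  proof -
    have c: "x \<in> carrier G" "x' \<in> carrier G" "y \<in> carrier G" "y' \<in> carrier G" using that H by auto
    have eq: "inv x' \<otimes> x = y' \<otimes> inv y"
    proof -
      have "inv x' \<otimes> x \<otimes> y = inv x' \<otimes> (x' \<otimes> y')" using c that(5) by (simp add: m_assoc)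
      also have "\<dots> = y'" using c by (simp add: m_assoc[symmetric])
      finally show ?thesis using c by (simp add: inv_solve_right)
    qed
    have "inv x' \<otimes> x \<in> H1" "y' \<otimes> inv y \<in> H2"
      using that by (auto intro: subgroup.m_closed[OF H1] subgroup.m_inv_closed[OF H1]
          subgroup.m_closed[OF H2] subgroup.m_inv_closed[OF H2])
    then have "inv x' \<otimes> x = \<one>" "y' \<otimes> inv y = \<one>" using eq triv by auto
    then show ?thesis using c by (metis inv_closed inv_equality inv_inv)
  qed
  define \<phi> where "\<phi> g = (if g \<in> H1 <#> H2 then
     (THE v. \<exists>x\<in>H1. \<exists>y\<in>H2. g = x \<otimes> y \<and> v = \<phi>1 x \<otimes>\<^bsub>K\<^esub> \<phi>2 y) else \<zero>\<^bsub>K\<^esub>)" for g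
  have eval: "\<phi> (x \<otimes> y) = \<phi>1 x \<otimes>\<^bsub>K\<^esub> \<phi>2 y" if "x \<in> H1" "y \<in> H2" for x y
  proof -
    have "x \<otimes> y \<in> H1 <#> H2" using that by (auto simp: set_mult_def)
    moreover have "(THE v. \<exists>x'\<in>H1. \<exists>y'\<in>H2. x \<otimes> y = x' \<otimes> y' \<and> v = \<phi>1 x' \<otimes>\<^bsub>K\<^esub> \<phi>2 y') = \<phi>1 x \<otimes>\<^bsub>K\<^esub> \<phi>2 y"
      by (rule the_equality) (use that uniq in \<open>blast+\<close>)
    ultimately show ?thesis by (simp add: \<phi>_def)
  qed
  have sg: "subgroup (H1 <#> H2) G"
    by (rule commuting_set_mult_subgroup[OF H1 H2 comm])
  have closed: "\<phi> g \<in> carrier K" for g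
  proof (cases "g \<in> H1 <#> H2")
    case True
    then obtain x y where "x \<in> H1" "y \<in> H2" "g = x \<otimes> y" by (auto simp: set_mult_def)
    then show ?thesis using eval \<phi> H by auto
  qed (simp add: \<phi>_def)
  have H1sub: "H1 \<subseteq> H1 <#> H2" and H2sub: "H2 \<subseteq> H1 <#> H2"
    using subgroup.one_closed[OF H1] subgroup.one_closed[OF H2] H
    by (auto simp: set_mult_def)
  have "solves K G (E1 \<union> E2) \<phi>"
    unfolding solves_def
  proof (intro conjI ballI)
    show "\<phi> \<in> carrier G \<rightarrow> carrier K" using closed by auto
    fix e g assume e: "e \<in> E1 \<union> E2" and g: "g \<in> carrier G"
    show "comb_eval K G e \<phi> g = \<zero>\<^bsub>K\<^esub>"
    proof (cases "g \<in> H1 <#> H2")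
      case False
      have "e \<in> combs K (H1 <#> H2)" using e E1 E2 combs_mono[OF H1sub] combs_mono[OF H2sub] by blast
      then show ?thesis
        by (rule comb_eval_eq_0) (use False in \<open>auto simp: \<phi>_def subgroup_mult_mem_iff[OF sg _ g]\<close>)
    next
      case True
      then obtain x y where xy: "x \<in> H1" "y \<in> H2" "g = x \<otimes> y" by (auto simp: set_mult_def)
      from e consider "e \<in> E1" | "e \<in> E2" by blast
      then show ?thesis
      proof cases
        case 1
        have "comb_eval K G e \<phi> g = \<phi>2 y \<otimes>\<^bsub>K\<^esub> comb_eval K G e \<phi>1 x"
        proof (rule comb_eval_scaled[THEN conjunct2, of e H1])
          fix h assume h: "h \<in> H1"
          have "g \<otimes> h = (x \<otimes> h) \<otimes> y" using xy h H comm[OF h xy(2)] by (simp add: m_assoc)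
          then show "\<phi>1 (x \<otimes> h) \<in> carrier K \<and> \<phi> (g \<otimes> h) = \<phi>2 y \<otimes>\<^bsub>K\<^esub> \<phi>1 (x \<otimes> h)"
            using eval[of "x \<otimes> h" y] xy h subgroup.m_closed[OF H1] \<phi> H by (simp add: K.m_comm)
        qed (use 1 E1 \<phi> xy H in auto)
        then show ?thesis using 1 \<phi>1 \<phi> xy H by (auto simp: solves_def)
      next
        case 2
        have "comb_eval K G e \<phi> g = \<phi>1 x \<otimes>\<^bsub>K\<^esub> comb_eval K G e \<phi>2 y"
        proof (rule comb_eval_scaled[THEN conjunct2, of e H2])
          fix h assume h: "h \<in> H2"
          have "g \<otimes> h = x \<otimes> (y \<otimes> h)" using xy h H by (simp add: m_assoc)
          then show "\<phi>2 (y \<otimes> h) \<in> carrier K \<and> \<phi> (g \<otimes> h) = \<phi>1 x \<otimes>\<^bsub>K\<^esub> \<phi>2 (y \<otimes> h)"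
            using eval[of x "y \<otimes> h"] xy h subgroup.m_closed[OF H2] \<phi> H by simp
        qed (use 2 E2 \<phi> xy H in auto)
        then show ?thesis using 2 \<phi>2 \<phi> xy H by (auto simp: solves_def)
      qed
    qed
  qed
  moreover have "\<phi> \<one> = \<one>\<^bsub>K\<^esub>"
    using eval[of \<one> \<one>] \<phi>1 \<phi>2 subgroup.one_closed[OF H1] subgroup.one_closed[OF H2] by simp
  moreover have "\<forall>g\<in>carrier G - (H1 <#> H2). \<phi> g = \<zero>\<^bsub>K\<^esub>" by (simp add: \<phi>_def)
  ultimately show ?thesis unfolding solvable_on_def by blast
qed

lemma solvable_on_empty:
  assumes "subgroup H G"
  shows "solvable_on K G H {}"
  unfolding solvable_on_def solves_def
  by (rule exI[of _ "\<lambda>g. if g \<in> H then \<one>\<^bsub>K\<^esub> else \<zero>\<^bsub>K\<^esub>"]) (use subgroup.one_closed[OF assms] in auto)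

lemma geom_in_combs: "subgroup H G \<Longrightarrow> n \<in> H \<Longrightarrow> geom K G n l \<in> combs K H"
proof -
  assume H: "subgroup H G" "n \<in> H"
  have "n [^] (i::nat) \<in> H" for i
    by (induction i) (auto simp: H subgroup.one_closed subgroup.m_closed)
  then show ?thesis by (auto simp: geom_def)
qed

lemma comb_eval_geom_Suc:
  assumes "\<phi> \<in> carrier G \<rightarrow> carrier K" "n \<in> carrier G" "g \<in> carrier G"
  shows "comb_eval K G (geom K G n (Suc l)) \<phi> g =
     comb_eval K G (geom K G n l) \<phi> g \<oplus>\<^bsub>K\<^esub> \<phi> (g \<otimes> n [^] l)"
proof -
  have "geom K G n (Suc l) = geom K G n l @ [(\<one>\<^bsub>K\<^esub>, n [^] l)]" by (simp add: geom_def)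
  moreover have "\<phi> (g \<otimes> n [^] l) \<in> carrier K" using assms by auto
  ultimately show ?thesis
    using assms comb_eval_append[of "geom K G n l" "[(\<one>\<^bsub>K\<^esub>, n [^] l)]" \<phi> g]
      geom_in_combs[OF subgroup_self, of n l] by simp
qed

lemma aug_geom: "aug K (geom K G n l) = [l] \<cdot>\<^bsub>K\<^esub> \<one>\<^bsub>K\<^esub>"
proof -
  have "aug K (map (\<lambda>i. (\<one>\<^bsub>K\<^esub>, n [^] i)) xs) = [length xs] \<cdot>\<^bsub>K\<^esub> \<one>\<^bsub>K\<^esub>" for xs :: "nat list"
    by (induction xs) (auto simp: K.a_comm)
  then show ?thesis by (simp add: geom_def)
qed

text \<open>The product of \<open>1 - n\<inverse>\<close> and \<open>1 + n + \<dots> + n\<^sup>l\<^sup>-\<^sup>1\<close> telescopes to \<open>n\<^sup>l\<^sup>-\<^sup>1 - n\<inverse>\<close>, which annihilates every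
  function of period \<open>n\<^sup>l\<close>. Equations that involve only elements commuting with \<open>n\<close> survive the
  application of \<open>1 - n\<inverse>\<close>.\<close>

lemma solves_add_geom:
  assumes \<phi>: "solves K G E \<phi>" and E: "E \<subseteq> combs K H" and H: "H \<subseteq> carrier G"
    and n: "n \<in> carrier G" and comm: "\<And>x. x \<in> H \<Longrightarrow> x \<otimes> n = n \<otimes> x"
    and per: "\<And>g. g \<in> carrier G \<Longrightarrow> \<phi> (g \<otimes> n [^] l) = \<phi> g"
  shows "solves K G (insert (geom K G n l) E) (\<lambda>g. \<phi> g \<ominus>\<^bsub>K\<^esub> \<phi> (g \<otimes> inv n))"
proof -
  let ?\<psi> = "\<lambda>g. \<phi> g \<ominus>\<^bsub>K\<^esub> \<phi> (g \<otimes> inv n)"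
  have \<phi>c: "\<phi> g \<in> carrier K" if "g \<in> carrier G" for g using \<phi> that by (auto simp: solves_def)
  have tele: "comb_eval K G (geom K G n m) ?\<psi> g = \<phi> (g \<otimes> n [^] m \<otimes> inv n) \<ominus>\<^bsub>K\<^esub> \<phi> (g \<otimes> inv n)"
    if g: "g \<in> carrier G" for g and m :: nat
  proof (induction m)
    case 0
    show ?case using g n \<phi>c by (simp add: geom_def K.minus_eq K.r_neg)
  next
    case (Suc m)
    have "comb_eval K G (geom K G n (Suc m)) ?\<psi> g =
       comb_eval K G (geom K G n m) ?\<psi> g \<oplus>\<^bsub>K\<^esub> ?\<psi> (g \<otimes> n [^] m)"
      by (rule comb_eval_geom_Suc) (use n g \<phi>c in auto)
    moreover have "g \<otimes> n [^] Suc m \<otimes> inv n = g \<otimes> n [^] m" using g n by (simp add: m_assoc)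
    moreover have "\<phi> (g \<otimes> n [^] m) \<in> carrier K" "\<phi> (g \<otimes> n [^] m \<otimes> inv n) \<in> carrier K"
      "\<phi> (g \<otimes> inv n) \<in> carrier K" using g n \<phi>c by auto
    ultimately show ?case unfolding Suc.IH
      by (simp add: K.minus_eq K.a_ac K.r_neg1 K.r_neg2 K.r_neg K.l_neg)
  qed
  show ?thesis
    unfolding solves_def
  proof (intro conjI ballI)
    show "?\<psi> \<in> carrier G \<rightarrow> carrier K" using n \<phi>c by auto
    fix e g assume e: "e \<in> insert (geom K G n l) E" and g: "g \<in> carrier G"
    show "comb_eval K G e ?\<psi> g = \<zero>\<^bsub>K\<^esub>"
    proof (cases "e = geom K G n l")
      case True
      have "g \<otimes> n [^] l \<otimes> inv n = g \<otimes> inv n \<otimes> n [^] l"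
        using g n by (metis inv_closed m_assoc nat_pow_closed int_pow_int group_commutes_pow l_inv r_inv)
      then show ?thesis using True tele[OF g, of l] per[of "g \<otimes> inv n"] g n \<phi>c
        by (simp add: K.minus_eq K.r_neg)
    next
      case False
      then have e: "e \<in> E" "e \<in> combs K H" using e E by auto
      have xn: "x \<otimes> inv n = inv n \<otimes> x" if "x \<in> H" for x
      proof -
        have c: "x \<in> carrier G" using that H by auto
        have "inv n \<otimes> x = inv n \<otimes> (x \<otimes> n) \<otimes> inv n" using c n by (simp add: m_assoc)
        also have "\<dots> = x \<otimes> inv n" using c n comm[OF that] by (simp add: m_assoc[symmetric])
        finally show ?thesis by simp
      qed
      have "comb_eval K G e ?\<psi> g = comb_eval K G e \<phi> g \<ominus>\<^bsub>K\<^esub> comb_eval K G e (\<lambda>g. \<phi> (g \<otimes> inv n)) g"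
        by (rule comb_eval_diff[THEN conjunct2, THEN conjunct2, of e H]) (use e H g n \<phi>c in auto)
      also have "comb_eval K G e (\<lambda>g. \<phi> (g \<otimes> inv n)) g = comb_eval K G e \<phi> (g \<otimes> inv n)"
        by (rule comb_eval_cong[of e H]) (use e H g n xn in \<open>auto simp: m_assoc subset_iff\<close>)
      finally show ?thesis using \<phi> e g n by (auto simp: solves_def K.minus_eq)
    qed
  qed
qed

end

section \<open>Modules, linear functionals and irreducible quotients\<close>

definition lin_action ::
  "('k, 'c) ring_scheme \<Rightarrow> ('g, 'b) monoid_scheme \<Rightarrow> ('k, 'v, 'm) module_scheme
     \<Rightarrow> ('g \<Rightarrow> 'v \<Rightarrow> 'v) \<Rightarrow> bool" where
  "lin_action K G V \<rho> \<longleftrightarrow>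
     (\<forall>g\<in>carrier G. \<forall>v\<in>carrier V. \<rho> g v \<in> carrier V) \<and>
     (\<forall>g\<in>carrier G. \<forall>v\<in>carrier V. \<forall>w\<in>carrier V. \<rho> g (v \<oplus>\<^bsub>V\<^esub> w) = \<rho> g v \<oplus>\<^bsub>V\<^esub> \<rho> g w) \<and>
     (\<forall>g\<in>carrier G. \<forall>a\<in>carrier K. \<forall>v\<in>carrier V. \<rho> g (a \<odot>\<^bsub>V\<^esub> v) = a \<odot>\<^bsub>V\<^esub> \<rho> g v) \<and>
     (\<forall>g\<in>carrier G. \<forall>h\<in>carrier G. \<forall>v\<in>carrier V. \<rho> (g \<otimes>\<^bsub>G\<^esub> h) v = \<rho> g (\<rho> h v)) \<and>
     (\<forall>v\<in>carrier V. \<rho> \<one>\<^bsub>G\<^esub> v = v)"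

definition invariant_submodule ::
  "('k, 'c) ring_scheme \<Rightarrow> ('g, 'b) monoid_scheme \<Rightarrow> ('k, 'v, 'm) module_scheme
     \<Rightarrow> ('g \<Rightarrow> 'v \<Rightarrow> 'v) \<Rightarrow> 'v set \<Rightarrow> bool" where
  "invariant_submodule K G V \<rho> W \<longleftrightarrow> submodule W K V \<and> (\<forall>g\<in>carrier G. \<rho> g ` W \<subseteq> W)"

definition linear_functional ::
  "('k, 'c) ring_scheme \<Rightarrow> ('k, 'v, 'm) module_scheme \<Rightarrow> ('v \<Rightarrow> 'k) \<Rightarrow> bool" where
  "linear_functional K V \<Lambda> \<longleftrightarrow> \<Lambda> \<in> carrier V \<rightarrow> carrier K \<and>
     (\<forall>v\<in>carrier V. \<forall>w\<in>carrier V. \<Lambda> (v \<oplus>\<^bsub>V\<^esub> w) = \<Lambda> v \<oplus>\<^bsub>K\<^esub> \<Lambda> w) \<and>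
     (\<forall>a\<in>carrier K. \<forall>v\<in>carrier V. \<Lambda> (a \<odot>\<^bsub>V\<^esub> v) = a \<otimes>\<^bsub>K\<^esub> \<Lambda> v)"

locale vector_space_on = K: field K + module K V for K (structure) and V (structure)

sublocale vector_space_on \<subseteq> M: abelian_group V ..

context vector_space_on
begin

lemma minus_zero_vec [simp]: "\<ominus>\<^bsub>V\<^esub> \<zero>\<^bsub>V\<^esub> = \<zero>\<^bsub>V\<^esub>"
  using M.r_neg[of "\<zero>\<^bsub>V\<^esub>"] by simp

lemma submodule_mem:
  assumes "submodule W K V"
  shows "W \<subseteq> carrier V" "\<zero>\<^bsub>V\<^esub> \<in> W"
    "\<And>x y. \<lbrakk>x \<in> W; y \<in> W\<rbrakk> \<Longrightarrow> x \<oplus>\<^bsub>V\<^esub> y \<in> W"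
    "\<And>x. x \<in> W \<Longrightarrow> \<ominus>\<^bsub>V\<^esub> x \<in> W"
    "\<And>x y. \<lbrakk>x \<in> W; y \<in> W\<rbrakk> \<Longrightarrow> x \<ominus>\<^bsub>V\<^esub> y \<in> W"
    "\<And>a x. \<lbrakk>a \<in> carrier K; x \<in> W\<rbrakk> \<Longrightarrow> a \<odot>\<^bsub>V\<^esub> x \<in> W"
proof -
  note E = submoduleE[OF assms]
  show "W \<subseteq> carrier V" by (rule E(1))
  show "\<zero>\<^bsub>V\<^esub> \<in> W" using subgroup.one_closed[OF submodule.axioms(1)[OF assms]] by simp
  show "\<And>x y. \<lbrakk>x \<in> W; y \<in> W\<rbrakk> \<Longrightarrow> x \<ominus>\<^bsub>V\<^esub> y \<in> W" using E by (simp add: a_minus_def)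
qed (use submoduleE[OF assms] in auto)

lemma submodule_chain_Union:
  assumes C: "C \<noteq> {}" "\<And>W. W \<in> C \<Longrightarrow> submodule W K V"
    and chain: "\<And>W W'. \<lbrakk>W \<in> C; W' \<in> C\<rbrakk> \<Longrightarrow> W \<subseteq> W' \<or> W' \<subseteq> W"
  shows "submodule (\<Union>C) K V"
proof (rule submoduleI)
  show "\<Union>C \<subseteq> carrier V" using submodule_mem(1)[OF C(2)] by blast
  show "\<zero>\<^bsub>V\<^esub> \<in> \<Union>C" using submodule_mem(2)[OF C(2)] C(1) by blast
  show "\<ominus>\<^bsub>V\<^esub> a \<in> \<Union>C" if "a \<in> \<Union>C" for a using submodule_mem(4)[OF C(2)] that by blast
  show "a \<odot>\<^bsub>V\<^esub> x \<in> \<Union>C" if "a \<in> carrier K" "x \<in> \<Union>C" for a x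
    using submodule_mem(6)[OF C(2)] that by blast
  fix a b assume "a \<in> \<Union>C" "b \<in> \<Union>C"
  then obtain A B where "A \<in> C" "B \<in> C" "a \<in> A" "b \<in> B" by blast
  then show "a \<oplus>\<^bsub>V\<^esub> b \<in> \<Union>C"
    using chain[of A B] submodule_mem(3)[OF C(2)] by blast
qed

text \<open>A subspace that is maximal among those containing \<open>Z\<close> and avoiding \<open>u\<close> is a hyperplane
  complementary to \<open>u\<close>.\<close>

lemma exists_linear_functional:
  assumes Z: "submodule Z K V" and u: "u \<in> carrier V" "u \<notin> Z"
  obtains \<Lambda> where "linear_functional K V \<Lambda>" "\<And>z. z \<in> Z \<Longrightarrow> \<Lambda> z = \<zero>" "\<Lambda> u = \<one>"
proof -
  let ?S = "{W. submodule W K V \<and> Z \<subseteq> W \<and> u \<notin> W}"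
  have "\<exists>W\<in>?S. \<forall>U\<in>?S. W \<subseteq> U \<longrightarrow> U = W"
  proof (rule subset_Zorn_nonempty)
    show "?S \<noteq> {}" using Z u by blast
    fix C assume C: "C \<noteq> {}" "subset.chain ?S C"
    have "submodule (\<Union>C) K V"
      by (rule submodule_chain_Union[OF C(1)]) (use C(2) in \<open>auto simp: subset_chain_def\<close>)
    then show "\<Union>C \<in> ?S" using C by (auto simp: subset_chain_def)
  qed
  then obtain W where W: "submodule W K V" "Z \<subseteq> W" "u \<notin> W"
    and max: "\<And>U. \<lbrakk>submodule U K V; W \<subseteq> U; u \<notin> U\<rbrakk> \<Longrightarrow> U = W"
    by auto
  note Wm = submodule_mem[OF W(1)]
  \<comment> \<open>By maximality, adjoining \<open>v\<close> to \<open>W\<close> yields \<open>u\<close>, so \<open>v\<close> is a multiple of \<open>u\<close> modulo \<open>W\<close>.\<close>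
  have ex: "\<exists>a\<in>carrier K. v \<ominus>\<^bsub>V\<^esub> a \<odot>\<^bsub>V\<^esub> u \<in> W" if v: "v \<in> carrier V" for v
  proof (cases "v \<in> W")
    case True
    then have "v \<ominus>\<^bsub>V\<^esub> \<zero> \<odot>\<^bsub>V\<^esub> u \<in> W" using u v Wm(2,5) by simp
    then show ?thesis by blast
  next
    case False
    let ?U = "{w \<oplus>\<^bsub>V\<^esub> b \<odot>\<^bsub>V\<^esub> v | w b. w \<in> W \<and> b \<in> carrier K}"
    have "submodule ?U K V"
    proof (rule submoduleI)
      show "?U \<subseteq> carrier V" using Wm(1) v by auto
      show "\<zero>\<^bsub>V\<^esub> \<in> ?U"
        using Wm(2) v by (intro CollectI exI[of _ "\<zero>\<^bsub>V\<^esub>"] exI[of _ "\<zero>"]) simp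
      show "\<ominus>\<^bsub>V\<^esub> a \<in> ?U" if "a \<in> ?U" for a
      proof -
        obtain w b where a: "a = w \<oplus>\<^bsub>V\<^esub> b \<odot>\<^bsub>V\<^esub> v" "w \<in> W" "b \<in> carrier K" using \<open>a \<in> ?U\<close> by blast
        then have "\<ominus>\<^bsub>V\<^esub> a = \<ominus>\<^bsub>V\<^esub> w \<oplus>\<^bsub>V\<^esub> (\<ominus> b) \<odot>\<^bsub>V\<^esub> v"
          using v Wm(1) by (auto simp: M.minus_add smult_l_minus)
        then show ?thesis using a Wm(4) by blast
      qed
      show "a \<oplus>\<^bsub>V\<^esub> a' \<in> ?U" if aa: "a \<in> ?U" "a' \<in> ?U" for a a'
      proof -
        obtain w b where a: "a = w \<oplus>\<^bsub>V\<^esub> b \<odot>\<^bsub>V\<^esub> v" "w \<in> W" "b \<in> carrier K" using \<open>a \<in> ?U\<close> by blast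
        obtain w' b' where a': "a' = w' \<oplus>\<^bsub>V\<^esub> b' \<odot>\<^bsub>V\<^esub> v" "w' \<in> W" "b' \<in> carrier K"
          using \<open>a' \<in> ?U\<close> by blast
        have "w \<in> carrier V" "w' \<in> carrier V" using a a' Wm(1) by auto
        then have "a \<oplus>\<^bsub>V\<^esub> a' = (w \<oplus>\<^bsub>V\<^esub> w') \<oplus>\<^bsub>V\<^esub> (b \<oplus> b') \<odot>\<^bsub>V\<^esub> v"
          using a a' v by (simp add: smult_l_distr M.a_ac)
        then show ?thesis using a a' Wm(3) by blast
      qed
      show "c \<odot>\<^bsub>V\<^esub> a \<in> ?U" if "c \<in> carrier K" "a \<in> ?U" for c a
      proof -
        obtain w b where a: "a = w \<oplus>\<^bsub>V\<^esub> b \<odot>\<^bsub>V\<^esub> v" "w \<in> W" "b \<in> carrier K" using \<open>a \<in> ?U\<close> by blast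
        have "w \<in> carrier V" using a Wm(1) by auto
        then have "c \<odot>\<^bsub>V\<^esub> a = c \<odot>\<^bsub>V\<^esub> w \<oplus>\<^bsub>V\<^esub> (c \<otimes> b) \<odot>\<^bsub>V\<^esub> v"
          using v a that by (simp add: smult_r_distr smult_assoc1)
        then show ?thesis using a that Wm(6) by blast
      qed
    qed
    moreover have "W \<subseteq> ?U"
    proof
      fix w assume "w \<in> W"
      then have "w = w \<oplus>\<^bsub>V\<^esub> \<zero> \<odot>\<^bsub>V\<^esub> v" using v Wm(1) by (auto simp: subset_iff)
      then show "w \<in> ?U" using \<open>w \<in> W\<close> by blast
    qed
    moreover have "v \<in> ?U"
      using v Wm(2) by (intro CollectI exI[of _ "\<zero>\<^bsub>V\<^esub>"] exI[of _ "\<one>"]) simp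
    ultimately have "u \<in> ?U" using max[of ?U] False by blast
    then obtain w b where wb: "u = w \<oplus>\<^bsub>V\<^esub> b \<odot>\<^bsub>V\<^esub> v" "w \<in> W" "b \<in> carrier K" by blast
    have wV: "w \<in> carrier V" using wb Wm(1) by auto
    have "b \<noteq> \<zero>" using wb wV W(3) v by auto
    then have b: "inv b \<in> carrier K" "inv b \<otimes> b = \<one>" using wb K.field_Units by auto
    have "inv b \<odot>\<^bsub>V\<^esub> u = inv b \<odot>\<^bsub>V\<^esub> w \<oplus>\<^bsub>V\<^esub> v"
      using wb(1,3) wV v b by (simp add: smult_r_distr smult_assoc1[symmetric])
    then have "v \<ominus>\<^bsub>V\<^esub> inv b \<odot>\<^bsub>V\<^esub> u = \<ominus>\<^bsub>V\<^esub> (inv b \<odot>\<^bsub>V\<^esub> w)"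
      using v b wV by (simp add: a_minus_def M.minus_add M.a_ac M.r_neg1 M.r_neg2)
    then show ?thesis using b(1) Wm(4,6) wb by metis
  qed
  have uniq: "a = a'" if "v \<in> carrier V" "a \<in> carrier K" "a' \<in> carrier K"
    "v \<ominus>\<^bsub>V\<^esub> a \<odot>\<^bsub>V\<^esub> u \<in> W" "v \<ominus>\<^bsub>V\<^esub> a' \<odot>\<^bsub>V\<^esub> u \<in> W" for v a a'
  proof (rule ccontr)
    assume "a \<noteq> a'"
    then have "a \<ominus> a' \<noteq> \<zero>" using that K.r_right_minus_eq by simp
    then have b: "inv (a \<ominus> a') \<in> carrier K" "inv (a \<ominus> a') \<otimes> (a \<ominus> a') = \<one>"
      using that K.field_Units by auto
    have "(v \<ominus>\<^bsub>V\<^esub> a' \<odot>\<^bsub>V\<^esub> u) \<ominus>\<^bsub>V\<^esub> (v \<ominus>\<^bsub>V\<^esub> a \<odot>\<^bsub>V\<^esub> u) = (a \<ominus> a') \<odot>\<^bsub>V\<^esub> u"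
      using that u by (simp add: a_minus_def K.minus_eq smult_l_distr smult_l_minus
          M.minus_add M.a_ac M.r_neg1 M.r_neg2)
    then have "(a \<ominus> a') \<odot>\<^bsub>V\<^esub> u \<in> W" using Wm(5)[OF that(5,4)] by simp
    then have "inv (a \<ominus> a') \<odot>\<^bsub>V\<^esub> ((a \<ominus> a') \<odot>\<^bsub>V\<^esub> u) \<in> W" using b Wm(6) by blast
    then show False using W(3) b u that by (simp add: smult_assoc1[symmetric])
  qed
  define \<Lambda> where "\<Lambda> v = (THE a. a \<in> carrier K \<and> v \<ominus>\<^bsub>V\<^esub> a \<odot>\<^bsub>V\<^esub> u \<in> W)" for v
  have \<Lambda>: "\<Lambda> v = a" if "v \<in> carrier V" "a \<in> carrier K" "v \<ominus>\<^bsub>V\<^esub> a \<odot>\<^bsub>V\<^esub> u \<in> W" for v a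
    unfolding \<Lambda>_def by (rule the_equality) (use that uniq in blast)+
  have \<Lambda>m: "\<Lambda> v \<in> carrier K" "v \<ominus>\<^bsub>V\<^esub> \<Lambda> v \<odot>\<^bsub>V\<^esub> u \<in> W" if "v \<in> carrier V" for v
    using ex[OF that] \<Lambda>[OF that] by auto
  have "linear_functional K V \<Lambda>"
    unfolding linear_functional_def
  proof (intro conjI ballI)
    show "\<Lambda> \<in> carrier V \<rightarrow> carrier K" using \<Lambda>m by auto
    fix v assume v: "v \<in> carrier V"
    show "\<Lambda> (v \<oplus>\<^bsub>V\<^esub> w) = \<Lambda> v \<oplus> \<Lambda> w" if w: "w \<in> carrier V" for w
    proof (rule \<Lambda>)
      have "(v \<oplus>\<^bsub>V\<^esub> w) \<ominus>\<^bsub>V\<^esub> (\<Lambda> v \<oplus> \<Lambda> w) \<odot>\<^bsub>V\<^esub> u = (v \<ominus>\<^bsub>V\<^esub> \<Lambda> v \<odot>\<^bsub>V\<^esub> u) \<oplus>\<^bsub>V\<^esub> (w \<ominus>\<^bsub>V\<^esub> \<Lambda> w \<odot>\<^bsub>V\<^esub> u)"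
        using v w u \<Lambda>m by (simp add: a_minus_def smult_l_distr M.minus_add M.a_ac)
      then show "(v \<oplus>\<^bsub>V\<^esub> w) \<ominus>\<^bsub>V\<^esub> (\<Lambda> v \<oplus> \<Lambda> w) \<odot>\<^bsub>V\<^esub> u \<in> W" using \<Lambda>m v w Wm(3) by simp
    qed (use v w \<Lambda>m in auto)
    fix a assume a: "a \<in> carrier K"
    show "\<Lambda> (a \<odot>\<^bsub>V\<^esub> v) = a \<otimes> \<Lambda> v"
    proof (rule \<Lambda>)
      have "a \<odot>\<^bsub>V\<^esub> v \<ominus>\<^bsub>V\<^esub> (a \<otimes> \<Lambda> v) \<odot>\<^bsub>V\<^esub> u = a \<odot>\<^bsub>V\<^esub> (v \<ominus>\<^bsub>V\<^esub> \<Lambda> v \<odot>\<^bsub>V\<^esub> u)"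
        using v u a \<Lambda>m by (simp add: a_minus_def smult_r_distr smult_r_minus smult_assoc1)
      then show "a \<odot>\<^bsub>V\<^esub> v \<ominus>\<^bsub>V\<^esub> (a \<otimes> \<Lambda> v) \<odot>\<^bsub>V\<^esub> u \<in> W" using \<Lambda>m v a Wm(6) by simp
    qed (use v a \<Lambda>m in auto)
  qed
  moreover have "\<Lambda> z = \<zero>" if "z \<in> Z" for z
    by (rule \<Lambda>) (use that W Wm(1) u in \<open>auto simp: a_minus_def subset_iff\<close>)
  moreover have "\<Lambda> u = \<one>"
    by (rule \<Lambda>) (use u Wm(2) in \<open>auto simp: a_minus_def M.r_neg\<close>)
  ultimately show thesis by (rule that)
qed

end

definition coset_of :: "('k, 'v, 'm) module_scheme \<Rightarrow> 'v set \<Rightarrow> 'v \<Rightarrow> 'v set" where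
  "coset_of V Q x = {y \<in> carrier V. y \<ominus>\<^bsub>V\<^esub> x \<in> Q}"

text \<open>The operations choose representatives of the cosets; they do not depend on the choice if \<open>Q\<close> is
  a submodule.\<close>

definition quotient_module :: "('k, 'v, 'm) module_scheme \<Rightarrow> 'v set \<Rightarrow> ('k, 'v set) module" where
  "quotient_module V Q = \<lparr>carrier = coset_of V Q ` carrier V,
     mult = undefined, one = undefined,
     ring.zero = coset_of V Q \<zero>\<^bsub>V\<^esub>,
     add = (\<lambda>C D. coset_of V Q ((SOME x. x \<in> C) \<oplus>\<^bsub>V\<^esub> (SOME y. y \<in> D))),
     smult = (\<lambda>a C. coset_of V Q (a \<odot>\<^bsub>V\<^esub> (SOME x. x \<in> C)))\<rparr>"

definition quotient_action ::
  "('k, 'v, 'm) module_scheme \<Rightarrow> 'v set \<Rightarrow> ('g \<Rightarrow> 'v \<Rightarrow> 'v) \<Rightarrow> 'g \<Rightarrow> 'v set \<Rightarrow> 'v set" where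
  "quotient_action V Q \<rho> g =
     (\<lambda>C\<in>carrier (quotient_module V Q). coset_of V Q (\<rho> g (SOME x. x \<in> C)))"

locale quotient_space = vector_space_on K V for K (structure) and V (structure) +
  fixes Q
  assumes Q: "submodule Q K V"
begin

abbreviation cl where "cl \<equiv> coset_of V Q"

lemmas Qm = submodule_mem[OF Q]

lemma cl_eq_iff:
  assumes "x \<in> carrier V" "y \<in> carrier V"
  shows "cl x = cl y \<longleftrightarrow> x \<ominus>\<^bsub>V\<^esub> y \<in> Q"
proof
  have x: "x \<in> cl x" using assms Qm(2) by (simp add: coset_of_def a_minus_def M.r_neg)
  show "x \<ominus>\<^bsub>V\<^esub> y \<in> Q" if "cl x = cl y"
    using x unfolding that by (simp add: coset_of_def)
  assume xy: "x \<ominus>\<^bsub>V\<^esub> y \<in> Q"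
  have "z \<ominus>\<^bsub>V\<^esub> x \<in> Q \<longleftrightarrow> z \<ominus>\<^bsub>V\<^esub> y \<in> Q" if z: "z \<in> carrier V" for z
  proof -
    have 1: "z \<ominus>\<^bsub>V\<^esub> y = (z \<ominus>\<^bsub>V\<^esub> x) \<oplus>\<^bsub>V\<^esub> (x \<ominus>\<^bsub>V\<^esub> y)"
      using assms z by (simp add: a_minus_def M.minus_add M.a_ac M.r_neg1 M.r_neg2)
    have "z \<ominus>\<^bsub>V\<^esub> x = (z \<ominus>\<^bsub>V\<^esub> y) \<ominus>\<^bsub>V\<^esub> (x \<ominus>\<^bsub>V\<^esub> y)"
      unfolding 1 using assms z by (simp add: a_minus_def M.a_assoc M.r_neg)
    note 1 this
    then show ?thesis using Qm(3,5) xy by metis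
  qed
  then show "cl x = cl y" by (auto simp: coset_of_def)
qed

lemma some_cl:
  assumes "x \<in> carrier V"
  shows "(SOME y. y \<in> cl x) \<in> carrier V" "(SOME y. y \<in> cl x) \<ominus>\<^bsub>V\<^esub> x \<in> Q"
proof -
  have "x \<in> cl x" using assms Qm(2) by (simp add: coset_of_def a_minus_def M.r_neg)
  then have "(SOME y. y \<in> cl x) \<in> cl x" by (rule someI)
  then show "(SOME y. y \<in> cl x) \<in> carrier V" "(SOME y. y \<in> cl x) \<ominus>\<^bsub>V\<^esub> x \<in> Q"
    by (auto simp: coset_of_def)
qed

lemma carrier_quotient [simp]: "carrier (quotient_module V Q) = cl ` carrier V"
  by (simp add: quotient_module_def)

lemma zero_quotient [simp]: "\<zero>\<^bsub>quotient_module V Q\<^esub> = cl \<zero>\<^bsub>V\<^esub>"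
  by (simp add: quotient_module_def)

lemma add_quotient [simp]:
  assumes "x \<in> carrier V" "y \<in> carrier V"
  shows "cl x \<oplus>\<^bsub>quotient_module V Q\<^esub> cl y = cl (x \<oplus>\<^bsub>V\<^esub> y)"
proof -
  let ?x = "SOME z. z \<in> cl x" and ?y = "SOME z. z \<in> cl y"
  have "?x \<oplus>\<^bsub>V\<^esub> ?y \<ominus>\<^bsub>V\<^esub> (x \<oplus>\<^bsub>V\<^esub> y) = (?x \<ominus>\<^bsub>V\<^esub> x) \<oplus>\<^bsub>V\<^esub> (?y \<ominus>\<^bsub>V\<^esub> y)"
    using assms some_cl by (simp add: a_minus_def M.minus_add M.a_ac)
  then have "cl (?x \<oplus>\<^bsub>V\<^esub> ?y) = cl (x \<oplus>\<^bsub>V\<^esub> y)"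
    using assms some_cl Qm(3) by (subst cl_eq_iff) auto
  then show ?thesis by (simp add: quotient_module_def)
qed

lemma smult_quotient [simp]:
  assumes "a \<in> carrier K" "x \<in> carrier V"
  shows "a \<odot>\<^bsub>quotient_module V Q\<^esub> cl x = cl (a \<odot>\<^bsub>V\<^esub> x)"
proof -
  let ?x = "SOME z. z \<in> cl x"
  have "a \<odot>\<^bsub>V\<^esub> ?x \<ominus>\<^bsub>V\<^esub> a \<odot>\<^bsub>V\<^esub> x = a \<odot>\<^bsub>V\<^esub> (?x \<ominus>\<^bsub>V\<^esub> x)"
    using assms some_cl by (simp add: a_minus_def smult_r_distr smult_r_minus)
  then have "cl (a \<odot>\<^bsub>V\<^esub> ?x) = cl (a \<odot>\<^bsub>V\<^esub> x)"
    using assms some_cl Qm(6) by (subst cl_eq_iff) auto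
  then show ?thesis by (simp add: quotient_module_def)
qed

lemma quotient_is_module: "module K (quotient_module V Q)"
proof (rule moduleI)
  show "cring K" ..
  show "abelian_group (quotient_module V Q)"
  proof (rule abelian_groupI)
    fix U assume "U \<in> carrier (quotient_module V Q)"
    then obtain x where x: "x \<in> carrier V" "U = cl x" by auto
    then have "cl (\<ominus>\<^bsub>V\<^esub> x) \<oplus>\<^bsub>quotient_module V Q\<^esub> U = \<zero>\<^bsub>quotient_module V Q\<^esub>"
      by (simp add: M.l_neg)
    then show "\<exists>Y\<in>carrier (quotient_module V Q). Y \<oplus>\<^bsub>quotient_module V Q\<^esub> U = \<zero>\<^bsub>quotient_module V Q\<^esub>"
      using x by auto
  qed (auto simp: M.a_ac)
qed (auto simp: smult_l_distr smult_r_distr smult_assoc1)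

lemma quotient_action_cl:
  assumes \<rho>: "lin_action K G V \<rho>" and inv: "invariant_submodule K G V \<rho> Q"
    and g: "g \<in> carrier G" and x: "x \<in> carrier V"
  shows "quotient_action V Q \<rho> g (cl x) = cl (\<rho> g x)"
proof -
  let ?x = "SOME z. z \<in> cl x"
  have neg: "\<rho> g (\<ominus>\<^bsub>V\<^esub> x) = \<ominus>\<^bsub>V\<^esub> \<rho> g x"
  proof -
    have "\<rho> g ((\<ominus> \<one>) \<odot>\<^bsub>V\<^esub> x) = (\<ominus> \<one>) \<odot>\<^bsub>V\<^esub> \<rho> g x" and "\<rho> g x \<in> carrier V"
      using \<rho> g x by (simp_all add: lin_action_def)
    then show ?thesis using x by (simp add: smult_l_minus)
  qed
  have "\<rho> g ?x \<ominus>\<^bsub>V\<^esub> \<rho> g x = \<rho> g (?x \<ominus>\<^bsub>V\<^esub> x)"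
    using some_cl[OF x] x g \<rho> neg by (simp add: lin_action_def a_minus_def)
  moreover have "\<rho> g (?x \<ominus>\<^bsub>V\<^esub> x) \<in> Q"
    using inv g some_cl(2)[OF x] by (auto simp: invariant_submodule_def)
  ultimately have "cl (\<rho> g ?x) = cl (\<rho> g x)"
    using some_cl[OF x] x g \<rho> by (subst cl_eq_iff) (auto simp: lin_action_def)
  then show ?thesis using x by (simp add: quotient_action_def)
qed

end

lemma lin_action_imp_representation:
  assumes K: "field K" and G: "group G" and V: "module K V" and \<rho>: "lin_action K G V \<rho>"
    and ext: "\<And>g. g \<in> carrier G \<Longrightarrow> \<rho> g \<in> extensional (carrier V)"
  shows "representation K G V \<rho>"
proof -
  interpret G: group G by fact
  have inv: "\<rho> (inv\<^bsub>G\<^esub> g) (\<rho> g v) = v" "\<rho> g (\<rho> (inv\<^bsub>G\<^esub> g) v) = v"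
    if "g \<in> carrier G" "v \<in> carrier V" for g v
    using \<rho> that unfolding lin_action_def by (metis G.inv_closed G.l_inv, metis G.inv_closed G.r_inv)
  have cl: "\<rho> g v \<in> carrier V" if "g \<in> carrier G" "v \<in> carrier V" for g v
    using \<rho> that unfolding lin_action_def by blast
  have bij: "\<rho> g \<in> Bij (carrier V)" if g: "g \<in> carrier G" for g
    unfolding Bij_def
  proof (intro IntI CollectI ext[OF g] bij_betwI[where g = "\<rho> (inv\<^bsub>G\<^esub> g)"])
    show "\<rho> g \<in> carrier V \<rightarrow> carrier V" "\<rho> (inv\<^bsub>G\<^esub> g) \<in> carrier V \<rightarrow> carrier V" using cl g by auto
  qed (use inv g in auto)
  have GL: "\<rho> g \<in> carrier (GL K V)" if g: "g \<in> carrier G" for g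
    using \<rho> g bij[OF g] by (simp add: GL_def lin_action_def)
  have "\<rho> \<in> hom G (GL K V)"
  proof (rule homI)
    fix g h assume gh: "g \<in> carrier G" "h \<in> carrier G"
    have "\<rho> (g \<otimes>\<^bsub>G\<^esub> h) = compose (carrier V) (\<rho> g) (\<rho> h)"
    proof (rule extensionalityI[OF ext compose_extensional])
      show "g \<otimes>\<^bsub>G\<^esub> h \<in> carrier G" using gh by simp
      show "\<rho> (g \<otimes>\<^bsub>G\<^esub> h) v = compose (carrier V) (\<rho> g) (\<rho> h) v" if "v \<in> carrier V" for v
        using \<rho> gh that by (simp add: lin_action_def compose_eq)
    qed
    then show "\<rho> (g \<otimes>\<^bsub>G\<^esub> h) = \<rho> g \<otimes>\<^bsub>GL K V\<^esub> \<rho> h"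
      using bij gh by (simp add: GL_def BijGroup_def)
  qed (use GL in auto)
  then show ?thesis using K G V by (simp add: representation_def)
qed

lemma representation_imp_lin_action:
  assumes "representation K G V \<rho>"
  shows "lin_action K G V \<rho>"
proof -
  have K: "field K" and G: "group G" and V: "module K V" and hom: "\<rho> \<in> hom G (GL K V)"
    using assms by (auto simp: representation_def)
  interpret G: group G by fact
  have GL: "\<rho> g \<in> carrier (GL K V)" if "g \<in> carrier G" for g using hom that by (rule hom_in_carrier)
  then have bij: "\<rho> g \<in> Bij (carrier V)" if "g \<in> carrier G" for g using that by (simp add: GL_def)
  have one: "\<rho> \<one>\<^bsub>G\<^esub> = \<one>\<^bsub>GL K V\<^esub>"
    by (rule hom_one[OF hom G module.group_GL[OF V]])
  have mult: "\<rho> (g \<otimes>\<^bsub>G\<^esub> h) = compose (carrier V) (\<rho> g) (\<rho> h)"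
    if "g \<in> carrier G" "h \<in> carrier G" for g h
    using hom_mult[OF hom that] bij that by (simp add: GL_def BijGroup_def)
  show ?thesis
    unfolding lin_action_def
  proof (intro conjI ballI)
    fix g v assume "g \<in> carrier G" "v \<in> carrier V"
    then show "\<rho> g v \<in> carrier V" using Bij_imp_funcset[OF bij] by blast
  next
    fix v assume "v \<in> carrier V"
    then show "\<rho> \<one>\<^bsub>G\<^esub> v = v" using one by (simp add: GL_def BijGroup_def)
  qed (use GL mult in \<open>auto simp: GL_def compose_eq\<close>)
qed

text \<open>Zorn's lemma yields maximal invariant subspaces, because a finite generating set cannot be
  exhausted along a chain of proper ones.\<close>

lemma exists_maximal_invariant:
  assumes K: "field K" and V: "module K V"
    and J: "invariant_submodule K G V \<rho> J" "J \<noteq> carrier V"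
    and F: "finite F" "F \<subseteq> carrier V"
      "\<And>W. \<lbrakk>invariant_submodule K G V \<rho> W; J \<subseteq> W; F \<subseteq> W\<rbrakk> \<Longrightarrow> W = carrier V"
  obtains Q where "invariant_submodule K G V \<rho> Q" "J \<subseteq> Q" "Q \<noteq> carrier V"
    "\<And>W. \<lbrakk>invariant_submodule K G V \<rho> W; Q \<subseteq> W\<rbrakk> \<Longrightarrow> W = Q \<or> W = carrier V"
proof -
  interpret vector_space_on K V using K V by (simp add: vector_space_on_def)
  let ?S = "{W. invariant_submodule K G V \<rho> W \<and> J \<subseteq> W \<and> \<not> F \<subseteq> W}"
  have proper: "\<not> F \<subseteq> W \<longleftrightarrow> W \<noteq> carrier V" if "invariant_submodule K G V \<rho> W" "J \<subseteq> W" for W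
    using that F by blast
  have "\<exists>W\<in>?S. \<forall>U\<in>?S. W \<subseteq> U \<longrightarrow> U = W"
  proof (rule subset_Zorn_nonempty)
    show "?S \<noteq> {}" using J proper by blast
    fix C assume C: "C \<noteq> {}" "subset.chain ?S C"
    have "submodule (\<Union>C) K V"
      by (rule submodule_chain_Union[OF C(1)])
        (use C(2) in \<open>auto simp: subset_chain_def invariant_submodule_def\<close>)
    moreover have "\<not> F \<subseteq> \<Union>C"
    proof
      assume "F \<subseteq> \<Union>C"
      then obtain W where "W \<in> C" "F \<subseteq> W"
        by (rule finite_subset_Union_chain[OF F(1) _ C])
      then show False using C by (auto simp: subset_chain_def)
    qed
    moreover have "\<rho> g ` \<Union>C \<subseteq> \<Union>C" if "g \<in> carrier G" for g
    proof -
      have "\<rho> g ` W \<subseteq> W" if "W \<in> C" for W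
        using C(2) that \<open>g \<in> carrier G\<close> unfolding subset_chain_def invariant_submodule_def by blast
      then show ?thesis by blast
    qed
    moreover have "J \<subseteq> \<Union>C" using C unfolding subset_chain_def by blast
    ultimately show "\<Union>C \<in> ?S" by (simp add: invariant_submodule_def)
  qed
  then obtain Q where Q: "invariant_submodule K G V \<rho> Q" "J \<subseteq> Q" "\<not> F \<subseteq> Q"
    and max: "\<forall>U\<in>?S. Q \<subseteq> U \<longrightarrow> U = Q" by blast
  show thesis
  proof (rule that[OF Q(1,2)])
    show "Q \<noteq> carrier V" using Q F by blast
    fix W assume "invariant_submodule K G V \<rho> W" "Q \<subseteq> W"
    then show "W = Q \<or> W = carrier V" using max Q(2) proper[of W] by blast
  qed
qed

text \<open>Invariant subspaces of the quotient correspond to invariant subspaces that contain \<open>Q\<close>.\<close>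

lemma irreducible_quotient:
  assumes K: "field K" and G: "group G" and V: "module K V" and \<rho>: "lin_action K G V \<rho>"
    and inv: "invariant_submodule K G V \<rho> Q" "Q \<noteq> carrier V"
    and max: "\<And>W. \<lbrakk>invariant_submodule K G V \<rho> W; Q \<subseteq> W\<rbrakk> \<Longrightarrow> W = Q \<or> W = carrier V"
  shows "irreducible_representation K G (quotient_module V Q) (quotient_action V Q \<rho>)"
proof -
  interpret quotient_space K V Q
    using K V inv(1) by (simp add: quotient_space_def vector_space_on_def quotient_space_axioms_def
        invariant_submodule_def)
  let ?V = "quotient_module V Q" and ?\<rho> = "quotient_action V Q \<rho>"
  interpret Vq: module K ?V by (rule quotient_is_module)
  note act = quotient_action_cl[OF \<rho> inv(1)]
  have \<rho>c: "\<rho> g v \<in> carrier V" if "g \<in> carrier G" "v \<in> carrier V" for g v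
    using \<rho> that by (simp add: lin_action_def)
  have one: "\<one>\<^bsub>G\<^esub> \<in> carrier G" and m: "\<And>g h. \<lbrakk>g \<in> carrier G; h \<in> carrier G\<rbrakk> \<Longrightarrow> g \<otimes>\<^bsub>G\<^esub> h \<in> carrier G"
    using G by (simp_all add: group.is_monoid monoid.one_closed monoid.m_closed)
  have "lin_action K G ?V ?\<rho>"
    unfolding lin_action_def
    using \<rho>c \<rho> one m by (auto simp: act) (simp_all add: lin_action_def)
  then have rep: "representation K G ?V ?\<rho>"
    by (rule lin_action_imp_representation[OF K G quotient_is_module])
      (simp add: quotient_action_def)
  have zero_iff: "cl x = cl \<zero>\<^bsub>V\<^esub> \<longleftrightarrow> x \<in> Q" if "x \<in> carrier V" for x
    using cl_eq_iff[of x "\<zero>\<^bsub>V\<^esub>"] that by (simp add: a_minus_def)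
  show ?thesis
    unfolding irreducible_representation_def
  proof (intro conjI allI impI rep)
    obtain x where "x \<in> carrier V" "x \<notin> Q" using inv(2) Qm(1) by blast
    then show "carrier ?V \<noteq> {\<zero>\<^bsub>?V\<^esub>}" using zero_iff by auto
    fix W assume W: "submodule W K ?V \<and> (\<forall>g\<in>carrier G. ?\<rho> g ` W \<subseteq> W)"
    then have Wsub: "W \<subseteq> cl ` carrier V" and Wz: "cl \<zero>\<^bsub>V\<^esub> \<in> W"
      using Vq.submoduleE(1)[of W] subgroup.one_closed[OF submodule.axioms(1), of W K ?V] by auto
    define U where "U = {x \<in> carrier V. cl x \<in> W}"
    have "submodule U K V"
    proof (rule submoduleI)
      show "\<ominus>\<^bsub>V\<^esub> a \<in> U" if "a \<in> U" for a
      proof -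
        have "(\<ominus>\<^bsub>K\<^esub> \<one>\<^bsub>K\<^esub>) \<odot>\<^bsub>?V\<^esub> cl a \<in> W" by (rule Vq.submoduleE(4)[OF conjunct1[OF W]]) (use that in \<open>auto simp: U_def\<close>)
        then show ?thesis using that by (simp add: U_def smult_l_minus)
      qed
      show "a \<oplus>\<^bsub>V\<^esub> b \<in> U" if "a \<in> U" "b \<in> U" for a b
        using that W Vq.submoduleE(5)[of W "cl a" "cl b"] by (auto simp: U_def)
      show "a \<odot>\<^bsub>V\<^esub> b \<in> U" if "a \<in> carrier K" "b \<in> U" for a b
        using that W Vq.submoduleE(4)[of W a "cl b"] by (auto simp: U_def)
    qed (auto simp: U_def Wz)
    moreover have "\<forall>g\<in>carrier G. \<rho> g ` U \<subseteq> U"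
    proof (intro ballI subsetI)
      fix g y assume g: "g \<in> carrier G" and "y \<in> \<rho> g ` U"
      then obtain x where x: "x \<in> carrier V" "cl x \<in> W" "y = \<rho> g x" by (auto simp: U_def)
      have "?\<rho> g (cl x) \<in> W" using W g x(2) by blast
      then show "y \<in> U" using x g \<rho>c act[OF g x(1)] by (simp add: U_def)
    qed
    moreover have clQ: "cl x = cl \<zero>\<^bsub>V\<^esub>" if "x \<in> Q" for x using that Qm(1) zero_iff by blast
    moreover have "Q \<subseteq> U" using Qm(1) clQ Wz by (auto simp: U_def)
    ultimately have "U = Q \<or> U = carrier V" using max[of U] by (simp add: invariant_submodule_def)
    moreover have "W = cl ` U" using Wsub by (auto simp: U_def)
    moreover have "cl ` Q = {cl \<zero>\<^bsub>V\<^esub>}" using Qm(2) clQ by blast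
    ultimately show "W = {\<zero>\<^bsub>?V\<^esub>} \<or> W = carrier ?V" by auto
  qed
qed

section \<open>Representations and the group algebra\<close>

definition comb_act ::
  "('k, 'v, 'm) module_scheme \<Rightarrow> ('g \<Rightarrow> 'v \<Rightarrow> 'v) \<Rightarrow> ('k \<times> 'g) list \<Rightarrow> 'v \<Rightarrow> 'v" where
  "comb_act V \<rho> e u = foldr (\<lambda>(c, x) s. c \<odot>\<^bsub>V\<^esub> \<rho> x u \<oplus>\<^bsub>V\<^esub> s) e \<zero>\<^bsub>V\<^esub>"

lemma comb_act_Nil [simp]: "comb_act V \<rho> [] u = \<zero>\<^bsub>V\<^esub>"
  by (simp add: comb_act_def)

lemma comb_act_Cons [simp]:
  "comb_act V \<rho> (p # e) u = fst p \<odot>\<^bsub>V\<^esub> \<rho> (snd p) u \<oplus>\<^bsub>V\<^esub> comb_act V \<rho> e u"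
  by (simp add: comb_act_def split: prod.splits)

locale linear_rep = G: group G + vector_space_on K V for G and K (structure) and V (structure) +
  fixes \<rho>
  assumes \<rho>: "lin_action K G V \<rho>"
begin

sublocale gf: group_field G K ..

lemma act_closed [simp]: "\<lbrakk>g \<in> carrier G; v \<in> carrier V\<rbrakk> \<Longrightarrow> \<rho> g v \<in> carrier V"
  using \<rho> by (simp add: lin_action_def)

lemma act_add: "\<lbrakk>g \<in> carrier G; v \<in> carrier V; w \<in> carrier V\<rbrakk> \<Longrightarrow> \<rho> g (v \<oplus>\<^bsub>V\<^esub> w) = \<rho> g v \<oplus>\<^bsub>V\<^esub> \<rho> g w"
  using \<rho> by (simp add: lin_action_def)

lemma act_smult: "\<lbrakk>g \<in> carrier G; a \<in> carrier K; v \<in> carrier V\<rbrakk> \<Longrightarrow> \<rho> g (a \<odot>\<^bsub>V\<^esub> v) = a \<odot>\<^bsub>V\<^esub> \<rho> g v"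
  using \<rho> by (simp add: lin_action_def)

lemma act_mult:
  "\<lbrakk>g \<in> carrier G; h \<in> carrier G; v \<in> carrier V\<rbrakk> \<Longrightarrow> \<rho> (g \<otimes>\<^bsub>G\<^esub> h) v = \<rho> g (\<rho> h v)"
  using \<rho> by (simp add: lin_action_def)

lemma act_one: "v \<in> carrier V \<Longrightarrow> \<rho> \<one>\<^bsub>G\<^esub> v = v"
  using \<rho> by (simp add: lin_action_def)

lemma act_zero: "g \<in> carrier G \<Longrightarrow> \<rho> g \<zero>\<^bsub>V\<^esub> = \<zero>\<^bsub>V\<^esub>"
  using act_smult[of g "\<zero>" "\<zero>\<^bsub>V\<^esub>"] by simp

lemma act_minus: "\<lbrakk>g \<in> carrier G; v \<in> carrier V\<rbrakk> \<Longrightarrow> \<rho> g (\<ominus>\<^bsub>V\<^esub> v) = \<ominus>\<^bsub>V\<^esub> \<rho> g v"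
  using act_smult[of g "\<ominus> \<one>" v] by (simp add: smult_l_minus)

lemma act_diff:
  "\<lbrakk>g \<in> carrier G; v \<in> carrier V; w \<in> carrier V\<rbrakk> \<Longrightarrow> \<rho> g (v \<ominus>\<^bsub>V\<^esub> w) = \<rho> g v \<ominus>\<^bsub>V\<^esub> \<rho> g w"
  by (simp add: a_minus_def act_add act_minus)

lemma comb_act_closed [simp]:
  "\<lbrakk>e \<in> combs K (carrier G); u \<in> carrier V\<rbrakk> \<Longrightarrow> comb_act V \<rho> e u \<in> carrier V"
  by (induction e) auto

lemma comb_act_append:
  assumes "e \<in> combs K (carrier G)" "e' \<in> combs K (carrier G)" "u \<in> carrier V"
  shows "comb_act V \<rho> (e @ e') u = comb_act V \<rho> e u \<oplus>\<^bsub>V\<^esub> comb_act V \<rho> e' u"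
  using assms
proof (induction e rule: list.induct)
  case (Cons p e)
  then have p: "fst p \<in> carrier K" "snd p \<in> carrier G" and e: "e \<in> combs K (carrier G)" by auto
  show ?case
    using Cons.IH[OF e Cons.prems(2,3)] p comb_act_closed[OF e] comb_act_closed[OF Cons.prems(2)]
      Cons.prems(3) by (simp add: M.a_assoc)
qed simp

lemma aug_append:
  "\<lbrakk>e \<in> combs K H; e' \<in> combs K H\<rbrakk> \<Longrightarrow> aug K (e @ e') = aug K e \<oplus> aug K e'"
proof (induction e rule: list.induct)
  case (Cons p e)
  then have p: "fst p \<in> carrier K" and e: "e \<in> combs K H" by auto
  show ?case
    using Cons.IH[OF e Cons.prems(2)] p gf.aug_closed[OF e] gf.aug_closed[OF Cons.prems(2)]
    by (simp add: K.a_assoc)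
qed simp

definition scale where "scale a g e = map (\<lambda>(c, x). (a \<otimes> c, g \<otimes>\<^bsub>G\<^esub> x)) e"

lemma scale:
  assumes "e \<in> combs K (carrier G)" "a \<in> carrier K" "g \<in> carrier G" "u \<in> carrier V"
  shows "scale a g e \<in> combs K (carrier G) \<and> aug K (scale a g e) = a \<otimes> aug K e \<and>
    comb_act V \<rho> (scale a g e) u = a \<odot>\<^bsub>V\<^esub> \<rho> g (comb_act V \<rho> e u)"
  using assms
proof (induction e rule: list.induct)
  case Nil
  then show ?case by (simp add: scale_def act_zero)
next
  case (Cons p e)
  then have p: "fst p \<in> carrier K" "snd p \<in> carrier G" and e: "e \<in> combs K (carrier G)" by auto
  show ?case
    using Cons.IH[OF e Cons.prems(2-4)] p gf.aug_closed[OF e] comb_act_closed[OF e Cons.prems(4)]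
      Cons.prems(2-4)
    by (simp add: scale_def case_prod_unfold K.r_distr act_add act_smult act_mult smult_r_distr
        smult_assoc1)
qed

lemma comb_eval_functional:
  assumes "linear_functional K V \<Lambda>" "e \<in> combs K (carrier G)" "g \<in> carrier G" "u \<in> carrier V"
  shows "comb_eval K G e (\<lambda>x. \<Lambda> (\<rho> x u)) g = \<Lambda> (\<rho> g (comb_act V \<rho> e u))"
  using assms(2,1,3,4)
proof (induction e rule: list.induct)
  case Nil
  have "\<Lambda> (\<zero> \<odot>\<^bsub>V\<^esub> \<zero>\<^bsub>V\<^esub>) = \<zero> \<otimes> \<Lambda> \<zero>\<^bsub>V\<^esub>" "\<Lambda> \<zero>\<^bsub>V\<^esub> \<in> carrier K"
    using Nil(2) unfolding linear_functional_def by blast+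
  then show ?case using Nil by (simp add: act_zero)
next
  case (Cons p e)
  then have p: "fst p \<in> carrier K" "snd p \<in> carrier G" and e: "e \<in> combs K (carrier G)" by auto
  show ?case
    using Cons.IH[OF e Cons.prems(2-4)] p comb_act_closed[OF e Cons.prems(4)] Cons.prems(2-4)
    by (simp add: act_add act_smult act_mult linear_functional_def)
qed

lemma solves_functional:
  assumes "linear_functional K V \<Lambda>" "E \<subseteq> combs K (carrier G)" "u \<in> carrier V"
    and "\<And>e g. \<lbrakk>e \<in> E; g \<in> carrier G\<rbrakk> \<Longrightarrow> \<Lambda> (\<rho> g (comb_act V \<rho> e u)) = \<zero>"
  shows "solves K G E (\<lambda>x. \<Lambda> (\<rho> x u))"
  unfolding solves_def
proof (intro conjI ballI)
  show "(\<lambda>x. \<Lambda> (\<rho> x u)) \<in> carrier G \<rightarrow> carrier K"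
    using assms(1,3) by (auto simp: linear_functional_def)
  fix e g assume e: "e \<in> E" "g \<in> carrier G"
  show "comb_eval K G e (\<lambda>x. \<Lambda> (\<rho> x u)) g = \<zero>"
    using comb_eval_functional[OF assms(1) subsetD[OF assms(2) e(1)] e(2) assms(3)] assms(4)[OF e]
    by simp
qed

text \<open>The matrix coefficient \<open>x \<mapsto> \<Lambda> (\<rho> x u)\<close> is a solution, for any linear functional \<open>\<Lambda>\<close> with
  \<open>\<Lambda> u = 1\<close>.\<close>

lemma solvable_of_annihilated_vector:
  assumes u: "u \<in> carrier V" "u \<noteq> \<zero>\<^bsub>V\<^esub>" and E: "E \<subseteq> combs K (carrier G)"
    and ann: "\<And>e. e \<in> E \<Longrightarrow> comb_act V \<rho> e u = \<zero>\<^bsub>V\<^esub>"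
  shows "solvable_on K G (carrier G) E"
proof -
  have "submodule {\<zero>\<^bsub>V\<^esub>} K V" by (rule submoduleI) auto
  then obtain \<Lambda> where \<Lambda>: "linear_functional K V \<Lambda>" "\<Lambda> \<zero>\<^bsub>V\<^esub> = \<zero>" "\<Lambda> u = \<one>"
    using exists_linear_functional[of "{\<zero>\<^bsub>V\<^esub>}" u] u by auto
  have "solves K G E (\<lambda>x. \<Lambda> (\<rho> x u))"
    by (rule solves_functional) (use \<Lambda> u E ann act_zero in auto)
  then show ?thesis
    unfolding solvable_on_def using \<Lambda> u act_one by (intro exI[of _ "\<lambda>x. \<Lambda> (\<rho> x u)"]) auto
qed

text \<open>Let \<open>\<omega>\<close> be the augmentation ideal of \<open>K[G]\<close>. Then \<open>\<omega> u\<close> is invariant, and it is not zero since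
  \<open>\<rho> g u \<noteq> u\<close>. By irreducibility it contains \<open>u\<close>, say \<open>u = w u\<close> with \<open>w \<in> \<omega>\<close>, and \<open>1 - w\<close> annihilates
  \<open>u\<close> and has augmentation \<open>1\<close>.\<close>

lemma annihilator_of_augmentation_one:
  assumes irr: "\<And>W. invariant_submodule K G V \<rho> W \<Longrightarrow> W = {\<zero>\<^bsub>V\<^esub>} \<or> W = carrier V"
    and nt: "g \<in> carrier G" "u \<in> carrier V" "\<rho> g u \<noteq> u"
  shows "\<exists>e \<in> combs K (carrier G). aug K e = \<one> \<and> solvable_on K G (carrier G) {e}"
proof -
  define W where "W = {comb_act V \<rho> e u | e. e \<in> combs K (carrier G) \<and> aug K e = \<zero>}"
  have smul: "a \<odot>\<^bsub>V\<^esub> \<rho> h w \<in> W" if w: "w \<in> W" and ah: "a \<in> carrier K" "h \<in> carrier G" for a h w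
  proof -
    obtain e where e: "w = comb_act V \<rho> e u" "e \<in> combs K (carrier G)" "aug K e = \<zero>"
      using w by (auto simp: W_def)
    show ?thesis
      unfolding W_def using scale[OF e(2) ah nt(2)] e ah by (intro CollectI exI[of _ "scale a h e"]) simp
  qed
  have Wsub: "W \<subseteq> carrier V" using nt comb_act_closed unfolding W_def by blast
  have smul1: "a \<odot>\<^bsub>V\<^esub> w \<in> W" if "w \<in> W" "a \<in> carrier K" for a w
    using smul[OF that G.one_closed] Wsub that act_one by auto
  have "submodule W K V"
  proof (rule submoduleI[OF Wsub])
    show "\<zero>\<^bsub>V\<^esub> \<in> W" unfolding W_def by (intro CollectI exI[of _ "[]"]) simp
    show "\<ominus>\<^bsub>V\<^esub> a \<in> W" if "a \<in> W" for a
      using smul1[OF that, of "\<ominus> \<one>"] that Wsub by (auto simp: smult_l_minus)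
    show "a \<oplus>\<^bsub>V\<^esub> b \<in> W" if ab: "a \<in> W" "b \<in> W" for a b
    proof -
      obtain e e' where e: "a = comb_act V \<rho> e u" "e \<in> combs K (carrier G)" "aug K e = \<zero>"
        and e': "b = comb_act V \<rho> e' u" "e' \<in> combs K (carrier G)" "aug K e' = \<zero>"
        using ab by (auto simp: W_def)
      then show ?thesis
        unfolding W_def using comb_act_append[OF e(2) e'(2) nt(2)] aug_append[OF e(2) e'(2)]
          append_in_lists_conv by (intro CollectI exI[of _ "e @ e'"]) auto
    qed
  qed (use smul1 in auto)
  moreover have "\<rho> h w \<in> W" if "h \<in> carrier G" "w \<in> W" for h w
    using smul[OF that(2) K.one_closed that(1)] Wsub that by auto
  ultimately have W: "W = {\<zero>\<^bsub>V\<^esub>} \<or> W = carrier V"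
    by (intro irr) (auto simp: invariant_submodule_def)
  have "\<rho> g u \<ominus>\<^bsub>V\<^esub> u \<in> W"
    unfolding W_def
    by (intro CollectI exI[of _ "[(\<one>, g), (\<ominus> \<one>, \<one>\<^bsub>G\<^esub>)]"])
      (use nt in \<open>simp add: act_one smult_l_minus a_minus_def K.r_neg\<close>)
  moreover have "\<rho> g u \<ominus>\<^bsub>V\<^esub> u \<noteq> \<zero>\<^bsub>V\<^esub>"
  proof
    assume "\<rho> g u \<ominus>\<^bsub>V\<^esub> u = \<zero>\<^bsub>V\<^esub>"
    moreover have "\<rho> g u = (\<rho> g u \<ominus>\<^bsub>V\<^esub> u) \<oplus>\<^bsub>V\<^esub> u"
      using nt by (simp add: a_minus_def M.a_assoc M.l_neg)
    ultimately show False using nt by simp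
  qed
  ultimately have "u \<in> W" using W nt by auto
  then obtain e0 where e0: "u = comb_act V \<rho> e0 u" "e0 \<in> combs K (carrier G)" "aug K e0 = \<zero>"
    by (auto simp: W_def)
  let ?s = "scale (\<ominus> \<one>) \<one>\<^bsub>G\<^esub> e0"
  define e where "e = (\<one>, \<one>\<^bsub>G\<^esub>) # ?s"
  have s: "?s \<in> combs K (carrier G)" "aug K ?s = \<zero>" "comb_act V \<rho> ?s u = \<ominus>\<^bsub>V\<^esub> u"
    using scale[OF e0(2), of "\<ominus> \<one>" "\<one>\<^bsub>G\<^esub>" u] nt e0 act_one by (auto simp: smult_l_minus)
  have e: "e \<in> combs K (carrier G)" "aug K e = \<one>" "comb_act V \<rho> e u = \<zero>\<^bsub>V\<^esub>"
    using s nt by (auto simp: e_def act_one M.r_neg)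
  have "u \<noteq> \<zero>\<^bsub>V\<^esub>" using nt act_zero by auto
  then have "solvable_on K G (carrier G) {e}"
    by (intro solvable_of_annihilated_vector[OF nt(2)]) (use e in auto)
  then show ?thesis using e by blast
qed

end

lemma (in group_field) nontrivial_irreducible_imp_solvable:
  assumes irr: "irreducible_representation K G V \<rho>" and nt: "nontrivial_representation K G V \<rho>"
  shows "\<exists>e \<in> combs K (carrier G). aug K e = \<one>\<^bsub>K\<^esub> \<and> solvable_on K G (carrier G) {e}"
proof -
  have rep: "representation K G V \<rho>" using irr by (simp add: irreducible_representation_def)
  then have V: "module K V" by (simp add: representation_def)
  interpret linear_rep G K V \<rho>
    using V representation_imp_lin_action[OF rep]
    by (simp add: linear_rep_def linear_rep_axioms_def vector_space_on_def group_axioms K.field_axioms)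
  obtain g where g: "g \<in> carrier G" "\<rho> g \<noteq> \<one>\<^bsub>GL K V\<^esub>"
    using nt by (auto simp: nontrivial_representation_def)
  have "\<rho> g \<in> carrier (GL K V)" using rep g(1) by (auto simp: representation_def intro: hom_in_carrier)
  then have "\<rho> g \<in> extensional (carrier V)" by (simp add: GL_def Bij_def)
  then have "\<rho> g = \<one>\<^bsub>GL K V\<^esub>" if "\<And>u. u \<in> carrier V \<Longrightarrow> \<rho> g u = u"
    using that by (auto simp: GL_def BijGroup_def intro!: extensionalityI)
  then obtain u where "u \<in> carrier V" "\<rho> g u \<noteq> u" using g(2) by blast
  then show ?thesis
    using annihilator_of_augmentation_one[OF _ g(1)] irr
    by (auto simp: irreducible_representation_def invariant_submodule_def)
qed

text \<open>Only the module structure over \<open>K\<close> is recorded. The left ideals of \<open>K[G]\<close> are the subspaces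
  that are invariant under left translation.\<close>

definition group_algebra ::
  "('k, 'c) ring_scheme \<Rightarrow> ('g, 'b) monoid_scheme \<Rightarrow> ('k, 'g \<Rightarrow> 'k) module" where
  "group_algebra K G = \<lparr>carrier = {f. (\<forall>x. f x \<in> carrier K) \<and> finite {x. f x \<noteq> \<zero>\<^bsub>K\<^esub>} \<and>
       (\<forall>x. x \<notin> carrier G \<longrightarrow> f x = \<zero>\<^bsub>K\<^esub>)},
     mult = undefined, one = undefined, ring.zero = (\<lambda>_. \<zero>\<^bsub>K\<^esub>),
     add = (\<lambda>f h x. f x \<oplus>\<^bsub>K\<^esub> h x), smult = (\<lambda>a f x. a \<otimes>\<^bsub>K\<^esub> f x)\<rparr>"

definition translate ::
  "('k, 'c) ring_scheme \<Rightarrow> ('g, 'b) monoid_scheme \<Rightarrow> 'g \<Rightarrow> ('g \<Rightarrow> 'k) \<Rightarrow> 'g \<Rightarrow> 'k" where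
  "translate K G g f x = (if x \<in> carrier G then f (inv\<^bsub>G\<^esub> g \<otimes>\<^bsub>G\<^esub> x) else \<zero>\<^bsub>K\<^esub>)"

definition point :: "('k, 'c) ring_scheme \<Rightarrow> 'g \<Rightarrow> 'g \<Rightarrow> 'k" where
  "point K y x = (if x = y then \<one>\<^bsub>K\<^esub> else \<zero>\<^bsub>K\<^esub>)"

text \<open>The pairing of \<open>K[G]\<close> with its dual space \<open>K\<^sup>G\<close>.\<close>

definition pairing :: "('k, 'c) ring_scheme \<Rightarrow> ('g \<Rightarrow> 'k) \<Rightarrow> ('g \<Rightarrow> 'k) \<Rightarrow> 'k" where
  "pairing K \<phi> f = (\<Oplus>\<^bsub>K\<^esub>x\<in>{x. f x \<noteq> \<zero>\<^bsub>K\<^esub>}. f x \<otimes>\<^bsub>K\<^esub> \<phi> x)"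

context group_field
begin

lemma mem_group_algebra:
  "f \<in> carrier (group_algebra K G) \<longleftrightarrow> (\<forall>x. f x \<in> carrier K) \<and> finite {x. f x \<noteq> \<zero>\<^bsub>K\<^esub>} \<and>
     (\<forall>x. x \<notin> carrier G \<longrightarrow> f x = \<zero>\<^bsub>K\<^esub>)"
  by (simp add: group_algebra_def)

lemma group_algebra_simps [simp]:
  "\<zero>\<^bsub>group_algebra K G\<^esub> = (\<lambda>_. \<zero>\<^bsub>K\<^esub>)"
  "f \<oplus>\<^bsub>group_algebra K G\<^esub> h = (\<lambda>x. f x \<oplus>\<^bsub>K\<^esub> h x)"
  "a \<odot>\<^bsub>group_algebra K G\<^esub> f = (\<lambda>x. a \<otimes>\<^bsub>K\<^esub> f x)"
  by (simp_all add: group_algebra_def)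

lemma group_algebra_add_closed:
  assumes "f \<in> carrier (group_algebra K G)" "h \<in> carrier (group_algebra K G)"
  shows "(\<lambda>x. f x \<oplus>\<^bsub>K\<^esub> h x) \<in> carrier (group_algebra K G)"
proof -
  have "finite {x. f x \<oplus>\<^bsub>K\<^esub> h x \<noteq> \<zero>\<^bsub>K\<^esub>}"
    by (rule finite_subset[of _ "{x. f x \<noteq> \<zero>\<^bsub>K\<^esub>} \<union> {x. h x \<noteq> \<zero>\<^bsub>K\<^esub>}"])
      (use assms in \<open>auto simp: mem_group_algebra\<close>)
  then show ?thesis using assms by (auto simp: mem_group_algebra)
qed

lemma group_algebra_smult_closed:
  assumes "f \<in> carrier (group_algebra K G)" "a \<in> carrier K"
  shows "(\<lambda>x. a \<otimes>\<^bsub>K\<^esub> f x) \<in> carrier (group_algebra K G)"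
proof -
  have "finite {x. a \<otimes>\<^bsub>K\<^esub> f x \<noteq> \<zero>\<^bsub>K\<^esub>}"
    by (rule finite_subset[of _ "{x. f x \<noteq> \<zero>\<^bsub>K\<^esub>}"]) (use assms in \<open>auto simp: mem_group_algebra\<close>)
  then show ?thesis using assms by (auto simp: mem_group_algebra)
qed

lemma group_algebra_module: "module K (group_algebra K G)"
proof (rule moduleI)
  show "cring K" ..
  show "abelian_group (group_algebra K G)"
  proof (rule abelian_groupI)
    fix f assume f: "f \<in> carrier (group_algebra K G)"
    have "(\<lambda>x. \<ominus>\<^bsub>K\<^esub> \<one>\<^bsub>K\<^esub> \<otimes>\<^bsub>K\<^esub> f x) \<in> carrier (group_algebra K G)"
      by (rule group_algebra_smult_closed[OF f]) simp
    moreover have "(\<lambda>x. \<ominus>\<^bsub>K\<^esub> \<one>\<^bsub>K\<^esub> \<otimes>\<^bsub>K\<^esub> f x) \<oplus>\<^bsub>group_algebra K G\<^esub> f = \<zero>\<^bsub>group_algebra K G\<^esub>"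
      using f by (auto simp: mem_group_algebra K.l_minus K.l_neg)
    ultimately show "\<exists>h\<in>carrier (group_algebra K G). h \<oplus>\<^bsub>group_algebra K G\<^esub> f = \<zero>\<^bsub>group_algebra K G\<^esub>"
      by blast
    fix h assume h: "h \<in> carrier (group_algebra K G)"
    show "f \<oplus>\<^bsub>group_algebra K G\<^esub> h \<in> carrier (group_algebra K G)"
      using group_algebra_add_closed[OF f h] by simp
  qed (auto simp: mem_group_algebra K.a_ac)
  fix a f assume "a \<in> carrier K" "f \<in> carrier (group_algebra K G)"
  then show "a \<odot>\<^bsub>group_algebra K G\<^esub> f \<in> carrier (group_algebra K G)"
    using group_algebra_smult_closed by simp
qed (auto simp: mem_group_algebra K.l_distr K.r_distr K.m_assoc)

sublocale alg: vector_space_on K "group_algebra K G"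
  by (simp add: vector_space_on_def K.field_axioms group_algebra_module)

lemma point_closed [simp]: "y \<in> carrier G \<Longrightarrow> point K y \<in> carrier (group_algebra K G)"
  by (auto simp: mem_group_algebra point_def)

lemma group_algebra_induct:
  assumes W: "submodule W K (group_algebra K G)" and pt: "\<And>y. y \<in> carrier G \<Longrightarrow> point K y \<in> W"
    and f: "f \<in> carrier (group_algebra K G)"
  shows "f \<in> W"
proof -
  have "finite S \<Longrightarrow> f \<in> carrier (group_algebra K G) \<Longrightarrow> {x. f x \<noteq> \<zero>\<^bsub>K\<^esub>} \<subseteq> S \<Longrightarrow> f \<in> W" for S f
  proof (induction S arbitrary: f rule: finite_induct)
    case empty
    then have "f = \<zero>\<^bsub>group_algebra K G\<^esub>" by auto
    then show ?case using alg.submodule_mem(2)[OF W] by simp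
  next
    case (insert y S)
    show ?case
    proof (cases "f y = \<zero>\<^bsub>K\<^esub>")
      case True
      then show ?thesis using insert by (intro insert.IH) auto
    next
      case False
      then have y: "y \<in> carrier G" and fK: "\<And>x. f x \<in> carrier K"
        using insert.prems by (auto simp: mem_group_algebra)
      let ?h = "\<lambda>x. if x = y then \<zero>\<^bsub>K\<^esub> else f x"
      have "finite {x. ?h x \<noteq> \<zero>\<^bsub>K\<^esub>}"
        by (rule finite_subset[of _ "{x. f x \<noteq> \<zero>\<^bsub>K\<^esub>}"])
          (use insert.prems in \<open>auto simp: mem_group_algebra\<close>)
      then have "?h \<in> carrier (group_algebra K G)"
        using insert.prems by (auto simp: mem_group_algebra)
      then have "?h \<in> W" using insert by (intro insert.IH) auto
      moreover have "f y \<odot>\<^bsub>group_algebra K G\<^esub> point K y \<in> W"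
        using alg.submodule_mem(6)[OF W fK pt[OF y]] .
      ultimately have "?h \<oplus>\<^bsub>group_algebra K G\<^esub> (f y \<odot>\<^bsub>group_algebra K G\<^esub> point K y) \<in> W"
        by (rule alg.submodule_mem(3)[OF W])
      moreover have "?h \<oplus>\<^bsub>group_algebra K G\<^esub> (f y \<odot>\<^bsub>group_algebra K G\<^esub> point K y) = f"
        using fK by (auto simp: point_def)
      ultimately show ?thesis by simp
    qed
  qed
  then show ?thesis using f by (auto simp: mem_group_algebra)
qed

lemma pairing_superset:
  assumes "finite S" "{x. f x \<noteq> \<zero>\<^bsub>K\<^esub>} \<subseteq> S" "S \<subseteq> carrier G"
    "f \<in> carrier (group_algebra K G)" "\<phi> \<in> carrier G \<rightarrow> carrier K"
  shows "pairing K \<phi> f = (\<Oplus>\<^bsub>K\<^esub>x\<in>S. f x \<otimes>\<^bsub>K\<^esub> \<phi> x)"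
  unfolding pairing_def
proof (rule K.add.finprod_mono_neutral_cong_left[OF assms(1,2)])
  show "f i \<otimes>\<^bsub>K\<^esub> \<phi> i = \<zero>\<^bsub>K\<^esub>" if "i \<in> S - {x. f x \<noteq> \<zero>\<^bsub>K\<^esub>}" for i
  proof -
    have "\<phi> i \<in> carrier K" using that assms by auto
    then show ?thesis using that by auto
  qed
  show "(\<lambda>x. f x \<otimes>\<^bsub>K\<^esub> \<phi> x) \<in> S \<rightarrow> carrier K"
  proof
    fix x assume "x \<in> S"
    then have "\<phi> x \<in> carrier K" using assms(3,5) by auto
    then show "f x \<otimes>\<^bsub>K\<^esub> \<phi> x \<in> carrier K" using assms(4) by (simp add: mem_group_algebra)
  qed
qed simp

lemma pairing_point: "\<lbrakk>y \<in> carrier G; \<phi> \<in> carrier G \<rightarrow> carrier K\<rbrakk> \<Longrightarrow> pairing K \<phi> (point K y) = \<phi> y"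
proof -
  assume y: "y \<in> carrier G" and \<phi>: "\<phi> \<in> carrier G \<rightarrow> carrier K"
  then have "\<phi> y \<in> carrier K" by auto
  moreover have "pairing K \<phi> (point K y) = (\<Oplus>\<^bsub>K\<^esub>x\<in>{y}. point K y x \<otimes>\<^bsub>K\<^esub> \<phi> x)"
    by (rule pairing_superset) (use y \<phi> in \<open>auto simp: point_def split: if_splits\<close>)
  ultimately show "pairing K \<phi> (point K y) = \<phi> y"
    by (simp add: point_def)
qed

lemma pairing_linear:
  assumes \<phi>: "\<phi> \<in> carrier G \<rightarrow> carrier K"
  shows "linear_functional K (group_algebra K G) (pairing K \<phi>)"
  unfolding linear_functional_def
proof (intro conjI ballI)
  have c: "(\<lambda>x. f x \<otimes>\<^bsub>K\<^esub> \<phi> x) \<in> S \<rightarrow> carrier K"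
    if "f \<in> carrier (group_algebra K G)" "S \<subseteq> carrier G" for f S
    using that \<phi> by (auto simp: mem_group_algebra)
  have supp: "{x. f x \<noteq> \<zero>\<^bsub>K\<^esub>} \<subseteq> carrier G" "finite {x. f x \<noteq> \<zero>\<^bsub>K\<^esub>}"
    if "f \<in> carrier (group_algebra K G)" for f
    using that by (auto simp: mem_group_algebra)
  show "pairing K \<phi> \<in> carrier (group_algebra K G) \<rightarrow> carrier K"
    unfolding pairing_def using c supp by (auto intro!: K.add.finprod_closed simp: mem_group_algebra)
  fix f assume f: "f \<in> carrier (group_algebra K G)"
  show "pairing K \<phi> (f \<oplus>\<^bsub>group_algebra K G\<^esub> h) = pairing K \<phi> f \<oplus>\<^bsub>K\<^esub> pairing K \<phi> h"
    if h: "h \<in> carrier (group_algebra K G)" for h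
  proof -
    let ?S = "{x. f x \<noteq> \<zero>\<^bsub>K\<^esub>} \<union> {x. h x \<noteq> \<zero>\<^bsub>K\<^esub>}"
    have S: "finite ?S" "?S \<subseteq> carrier G" using f h by (auto simp: mem_group_algebra)
    have "f x \<in> carrier K" "h x \<in> carrier K" for x using f h by (auto simp: mem_group_algebra)
    note fh = this
    have "pairing K \<phi> (f \<oplus>\<^bsub>group_algebra K G\<^esub> h) = (\<Oplus>\<^bsub>K\<^esub>x\<in>?S. (f x \<oplus>\<^bsub>K\<^esub> h x) \<otimes>\<^bsub>K\<^esub> \<phi> x)"
      by (subst pairing_superset[OF S(1) _ S(2)])
        (use f h \<phi> group_algebra_add_closed in auto)
    also have "\<dots> = (\<Oplus>\<^bsub>K\<^esub>x\<in>?S. f x \<otimes>\<^bsub>K\<^esub> \<phi> x \<oplus>\<^bsub>K\<^esub> h x \<otimes>\<^bsub>K\<^esub> \<phi> x)"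
    proof (rule K.add.finprod_cong')
      show "(\<lambda>x. f x \<otimes>\<^bsub>K\<^esub> \<phi> x \<oplus>\<^bsub>K\<^esub> h x \<otimes>\<^bsub>K\<^esub> \<phi> x) \<in> ?S \<rightarrow> carrier K"
        using c[OF f S(2)] c[OF h S(2)] by auto
      fix x assume "x \<in> ?S"
      then have "\<phi> x \<in> carrier K" using S(2) \<phi> by auto
      then show "(f x \<oplus>\<^bsub>K\<^esub> h x) \<otimes>\<^bsub>K\<^esub> \<phi> x = f x \<otimes>\<^bsub>K\<^esub> \<phi> x \<oplus>\<^bsub>K\<^esub> h x \<otimes>\<^bsub>K\<^esub> \<phi> x"
        using fh by (simp add: K.l_distr)
    qed simp
    also have "\<dots> = (\<Oplus>\<^bsub>K\<^esub>x\<in>?S. f x \<otimes>\<^bsub>K\<^esub> \<phi> x) \<oplus>\<^bsub>K\<^esub> (\<Oplus>\<^bsub>K\<^esub>x\<in>?S. h x \<otimes>\<^bsub>K\<^esub> \<phi> x)"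
      by (rule K.add.finprod_multf) (use c f h S(2) in auto)
    also have "\<dots> = pairing K \<phi> f \<oplus>\<^bsub>K\<^esub> pairing K \<phi> h"
      using pairing_superset[OF S(1) _ S(2) f \<phi>] pairing_superset[OF S(1) _ S(2) h \<phi>] by auto
    finally show ?thesis .
  qed
  fix a assume a: "a \<in> carrier K"
  let ?S = "{x. f x \<noteq> \<zero>\<^bsub>K\<^esub>}"
  have "pairing K \<phi> (a \<odot>\<^bsub>group_algebra K G\<^esub> f) = (\<Oplus>\<^bsub>K\<^esub>x\<in>?S. (a \<otimes>\<^bsub>K\<^esub> f x) \<otimes>\<^bsub>K\<^esub> \<phi> x)"
    by (subst pairing_superset[OF supp(2)[OF f] _ supp(1)[OF f]])
      (use f a \<phi> group_algebra_smult_closed in auto)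
  also have "\<dots> = (\<Oplus>\<^bsub>K\<^esub>x\<in>?S. a \<otimes>\<^bsub>K\<^esub> (f x \<otimes>\<^bsub>K\<^esub> \<phi> x))"
  proof (rule K.add.finprod_cong')
    show "(\<lambda>x. a \<otimes>\<^bsub>K\<^esub> (f x \<otimes>\<^bsub>K\<^esub> \<phi> x)) \<in> ?S \<rightarrow> carrier K"
      using c[OF f supp(1)[OF f]] a by auto
    fix x assume "x \<in> ?S"
    then have "\<phi> x \<in> carrier K" "f x \<in> carrier K" using supp(1)[OF f] \<phi> f by (auto simp: mem_group_algebra)
    then show "(a \<otimes>\<^bsub>K\<^esub> f x) \<otimes>\<^bsub>K\<^esub> \<phi> x = a \<otimes>\<^bsub>K\<^esub> (f x \<otimes>\<^bsub>K\<^esub> \<phi> x)" using a by (simp add: K.m_assoc)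
  qed simp
  also have "\<dots> = a \<otimes>\<^bsub>K\<^esub> pairing K \<phi> f"
    unfolding pairing_def
    by (rule K.finsum_rdistr[symmetric, OF supp(2)[OF f] a c[OF f supp(1)[OF f]]])
  finally show "pairing K \<phi> (a \<odot>\<^bsub>group_algebra K G\<^esub> f) = a \<otimes>\<^bsub>K\<^esub> pairing K \<phi> f" .
qed

lemma translate_point:
  "\<lbrakk>g \<in> carrier G; y \<in> carrier G\<rbrakk> \<Longrightarrow> translate K G g (point K y) = point K (g \<otimes> y)"
  by (rule ext) (auto simp: translate_def point_def m_assoc[symmetric] inv_solve_left')

lemma translate_lin_action: "lin_action K G (group_algebra K G) (translate K G)"
  unfolding lin_action_def
proof (intro conjI ballI)
  fix g f assume g: "g \<in> carrier G" and f: "f \<in> carrier (group_algebra K G)"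
  have "{x. translate K G g f x \<noteq> \<zero>\<^bsub>K\<^esub>} \<subseteq> (\<lambda>y. g \<otimes> y) ` {y. f y \<noteq> \<zero>\<^bsub>K\<^esub>}"
  proof
    fix x assume "x \<in> {x. translate K G g f x \<noteq> \<zero>\<^bsub>K\<^esub>}"
    then have x: "x \<in> carrier G" "f (inv g \<otimes> x) \<noteq> \<zero>\<^bsub>K\<^esub>"
      by (auto simp: translate_def split: if_splits)
    then have "x = g \<otimes> (inv g \<otimes> x)" using g by (simp add: m_assoc[symmetric])
    then show "x \<in> (\<lambda>y. g \<otimes> y) ` {y. f y \<noteq> \<zero>\<^bsub>K\<^esub>}" using x by blast
  qed
  then have "finite {x. translate K G g f x \<noteq> \<zero>\<^bsub>K\<^esub>}"
    by (rule finite_subset) (use f in \<open>auto simp: mem_group_algebra\<close>)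
  then show "translate K G g f \<in> carrier (group_algebra K G)"
    using f by (auto simp: mem_group_algebra translate_def)
next
  fix g h f assume "g \<in> carrier G" "h \<in> carrier G" "f \<in> carrier (group_algebra K G)"
  then show "translate K G (g \<otimes> h) f = translate K G g (translate K G h f)"
    by (auto simp: translate_def inv_mult_group m_assoc)
qed (auto simp: translate_def mem_group_algebra)

sublocale reg: linear_rep G K "group_algebra K G" "translate K G"
  by unfold_locales (rule translate_lin_action)

end

section \<open>Irreducible modules from solvable equations\<close>

context group_field
begin

lemma comb_act_point_in:
  assumes "e \<in> combs K (carrier G)"
  shows "comb_act (group_algebra K G) (translate K G) e (point K \<one>) \<in> carrier (group_algebra K G)"
    and "\<phi> \<in> carrier G \<rightarrow> carrier K \<Longrightarrow>
      pairing K \<phi> (comb_act (group_algebra K G) (translate K G) e (point K \<one>)) = comb_eval K G e \<phi> \<one>"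
proof -
  show "comb_act (group_algebra K G) (translate K G) e (point K \<one>) \<in> carrier (group_algebra K G)"
    using assms by (intro reg.comb_act_closed) auto
  assume \<phi>: "\<phi> \<in> carrier G \<rightarrow> carrier K"
  have "comb_eval K G e (\<lambda>x. pairing K \<phi> (translate K G x (point K \<one>))) \<one> =
      pairing K \<phi> (translate K G \<one> (comb_act (group_algebra K G) (translate K G) e (point K \<one>)))"
    by (rule reg.comb_eval_functional[OF pairing_linear[OF \<phi>] assms]) auto
  moreover have "comb_eval K G e (\<lambda>x. pairing K \<phi> (translate K G x (point K \<one>))) \<one> = comb_eval K G e \<phi> \<one>"
    by (rule comb_eval_cong[OF assms]) (simp add: translate_point pairing_point \<phi>)
  ultimately show "pairing K \<phi> (comb_act (group_algebra K G) (translate K G) e (point K \<one>)) = comb_eval K G e \<phi> \<one>"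
    using reg.act_one reg.comb_act_closed[OF assms] by simp
qed

lemma linear_functional_ext:
  assumes L: "linear_functional K (group_algebra K G) \<Lambda>"
    and L': "linear_functional K (group_algebra K G) \<Lambda>'"
    and eq: "\<And>y. y \<in> carrier G \<Longrightarrow> \<Lambda> (point K y) = \<Lambda>' (point K y)"
    and f: "f \<in> carrier (group_algebra K G)"
  shows "\<Lambda> f = \<Lambda>' f"
proof -
  let ?A = "group_algebra K G"
  let ?W = "{f \<in> carrier ?A. \<Lambda> f = \<Lambda>' f}"
  have smult: "a \<odot>\<^bsub>?A\<^esub> f \<in> ?W" if "a \<in> carrier K" "f \<in> ?W" for a f
    using that L L' alg.smult_closed[of a f]
    unfolding linear_functional_def by (auto simp del: group_algebra_simps)
  have "submodule ?W K ?A"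
  proof (rule alg.submoduleI)
    show "\<zero>\<^bsub>?A\<^esub> \<in> ?W"
      using smult[of "\<zero>\<^bsub>K\<^esub>" "point K \<one>"] eq alg.smult_l_null[OF point_closed[OF one_closed]] by simp
    show "\<ominus>\<^bsub>?A\<^esub> a \<in> ?W" if "a \<in> ?W" for a
      using smult[OF _ that, of "\<ominus>\<^bsub>K\<^esub> \<one>\<^bsub>K\<^esub>"] that
      by (auto simp: alg.smult_l_minus simp del: group_algebra_simps)
    show "f \<oplus>\<^bsub>?A\<^esub> h \<in> ?W" if "f \<in> ?W" "h \<in> ?W" for f h
      using that L L' alg.M.a_closed[of f h]
      unfolding linear_functional_def by (auto simp del: group_algebra_simps)
  qed (use smult in blast)+
  then have "f \<in> ?W" by (rule group_algebra_induct) (use eq f in auto)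
  then show ?thesis by simp
qed

lemma pairing_translate:
  assumes \<phi>: "\<phi> \<in> carrier G \<rightarrow> carrier K" and g: "g \<in> carrier G"
    and f: "f \<in> carrier (group_algebra K G)"
  shows "pairing K \<phi> (translate K G g f) = pairing K (\<lambda>x. \<phi> (g \<otimes> x)) f"
proof (rule linear_functional_ext[OF _ pairing_linear _ f])
  show "linear_functional K (group_algebra K G) (\<lambda>f. pairing K \<phi> (translate K G g f))"
    using pairing_linear[OF \<phi>] reg.act_add[OF g] reg.act_smult[OF g] reg.act_closed[OF g]
    unfolding linear_functional_def by (auto simp del: group_algebra_simps)
  show \<psi>: "(\<lambda>x. \<phi> (g \<otimes> x)) \<in> carrier G \<rightarrow> carrier K" using \<phi> g by auto
  show "pairing K \<phi> (translate K G g (point K y)) = pairing K (\<lambda>x. \<phi> (g \<otimes> x)) (point K y)"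
    if "y \<in> carrier G" for y
    using that g \<phi> pairing_point[OF that \<psi>] by (simp add: translate_point pairing_point)
qed

lemma invariant_submodule_mem:
  "\<lbrakk>invariant_submodule K G (group_algebra K G) (translate K G) W; g \<in> carrier G; f \<in> W\<rbrakk>
   \<Longrightarrow> translate K G g f \<in> W"
  by (auto simp: invariant_submodule_def)

lemma invariant_submodule_eq_carrier:
  assumes W: "invariant_submodule K G (group_algebra K G) (translate K G) W"
    and "point K \<one> \<in> W"
  shows "W = carrier (group_algebra K G)"
proof -
  have sub: "submodule W K (group_algebra K G)" using W by (simp add: invariant_submodule_def)
  have "point K y \<in> W" if y: "y \<in> carrier G" for y
    using invariant_submodule_mem[OF W y assms(2)] y by (simp add: translate_point)
  then show ?thesis
    using alg.submodule_mem(1)[OF sub] group_algebra_induct[OF sub] by blast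
qed

text \<open>The elements of \<open>K[G]\<close> that vanish on all solutions of some finite part of \<open>E\<close> form a left
  ideal \<open>J\<close>, which contains \<open>E\<close> and is proper because every finite part of \<open>E\<close> has a solution that is
  not \<open>0\<close> at \<open>1\<close>. For a maximal left ideal \<open>Q\<close> above \<open>J\<close>, the module \<open>K[G]/Q\<close> is irreducible. If a
  subset \<open>N\<close> acts trivially on it, then a functional that vanishes on \<open>Q\<close> but not at \<open>1\<close> restricts
  to a function on \<open>G\<close> that solves \<open>E\<close>, is invariant under \<open>N\<close> and is not zero.\<close>

theorem irreducible_of_solvable:
  assumes E: "E \<subseteq> combs K (carrier G)"
    and solv: "\<And>E0. \<lbrakk>finite E0; E0 \<subseteq> E\<rbrakk> \<Longrightarrow> solvable_on K G (carrier G) E0"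
  obtains V :: "('k, ('g \<Rightarrow> 'k) set) module" and \<rho> where
    "irreducible_representation K G V \<rho>"
    "\<And>N. \<lbrakk>N \<subseteq> carrier G; \<And>n. n \<in> N \<Longrightarrow> \<rho> n = \<one>\<^bsub>GL K V\<^esub>\<rbrakk> \<Longrightarrow> \<not> detects K G E N"
proof -
  let ?A = "group_algebra K G" and ?t = "translate K G"
  define J where "J = {f \<in> carrier ?A. \<exists>E0. finite E0 \<and> E0 \<subseteq> E \<and>
     (\<forall>\<phi>. solves K G E0 \<phi> \<longrightarrow> pairing K \<phi> f = \<zero>\<^bsub>K\<^esub>)}"
  have lin: "linear_functional K ?A (pairing K \<phi>)" if "solves K G E0 \<phi>" for E0 \<phi>
    using that by (intro pairing_linear) (simp add: solves_def)
  have Jadd: "f \<oplus>\<^bsub>?A\<^esub> h \<in> J" if fh: "f \<in> J" "h \<in> J" for f h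
  proof -
    obtain E1 E2 where E1: "finite E1" "E1 \<subseteq> E" "\<forall>\<phi>. solves K G E1 \<phi> \<longrightarrow> pairing K \<phi> f = \<zero>\<^bsub>K\<^esub>"
      and E2: "finite E2" "E2 \<subseteq> E" "\<forall>\<phi>. solves K G E2 \<phi> \<longrightarrow> pairing K \<phi> h = \<zero>\<^bsub>K\<^esub>"
      using fh by (auto simp: J_def)
    have c: "f \<in> carrier ?A" "h \<in> carrier ?A" using fh by (auto simp: J_def)
    have "pairing K \<phi> (f \<oplus>\<^bsub>?A\<^esub> h) = \<zero>\<^bsub>K\<^esub>" if s: "solves K G (E1 \<union> E2) \<phi>" for \<phi>
    proof -
      have "pairing K \<phi> f = \<zero>\<^bsub>K\<^esub>" "pairing K \<phi> h = \<zero>\<^bsub>K\<^esub>"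
        using E1 E2 solves_mono[OF s] by auto
      then show ?thesis using lin[OF s] c by (simp add: linear_functional_def del: group_algebra_simps)
    qed
    then show ?thesis
      unfolding J_def using E1 E2 alg.M.a_closed[OF c]
      by (intro CollectI conjI exI[of _ "E1 \<union> E2"]) auto
  qed
  have Jsmult: "a \<odot>\<^bsub>?A\<^esub> f \<in> J" if af: "a \<in> carrier K" "f \<in> J" for a f
  proof -
    obtain E1 where E1: "finite E1" "E1 \<subseteq> E" "\<forall>\<phi>. solves K G E1 \<phi> \<longrightarrow> pairing K \<phi> f = \<zero>\<^bsub>K\<^esub>"
      using af by (auto simp: J_def)
    have c: "f \<in> carrier ?A" using af by (auto simp: J_def)
    have "pairing K \<phi> (a \<odot>\<^bsub>?A\<^esub> f) = \<zero>\<^bsub>K\<^esub>" if s: "solves K G E1 \<phi>" for \<phi>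
      using E1(3) lin[OF s] c s \<open>a \<in> carrier K\<close>
      by (simp add: linear_functional_def del: group_algebra_simps)
    then show ?thesis
      unfolding J_def using E1 alg.smult_closed[OF af(1) c]
      by (intro CollectI conjI exI[of _ E1]) auto
  qed
  have Jsub: "J \<subseteq> carrier ?A" by (auto simp: J_def)
  have Je: "comb_act ?A ?t e (point K \<one>) \<in> J" if "e \<in> E" for e
  proof -
    have e: "e \<in> combs K (carrier G)" using that E by blast
    have "pairing K \<phi> (comb_act ?A ?t e (point K \<one>)) = \<zero>\<^bsub>K\<^esub>" if "solves K G {e} \<phi>" for \<phi>
      using that comb_act_point_in(2)[OF e, of \<phi>] by (simp add: solves_def)
    then show ?thesis
      unfolding J_def using that comb_act_point_in(1)[OF e]
      by (intro CollectI conjI exI[of _ "{e}"]) auto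
  qed
  have Jsubm: "submodule J K ?A"
  proof (rule alg.submoduleI[OF Jsub])
    have "pairing K \<phi> \<zero>\<^bsub>?A\<^esub> = \<zero>\<^bsub>K\<^esub>" for \<phi> by (simp add: pairing_def)
    then show "\<zero>\<^bsub>?A\<^esub> \<in> J"
      unfolding J_def using alg.M.zero_closed by (intro CollectI conjI exI[of _ "{}"]) auto
    show "\<ominus>\<^bsub>?A\<^esub> a \<in> J" if "a \<in> J" for a
      using Jsmult[OF _ that, of "\<ominus>\<^bsub>K\<^esub> \<one>\<^bsub>K\<^esub>"] that Jsub
      by (auto simp: alg.smult_l_minus simp del: group_algebra_simps)
  qed (use Jadd Jsmult in auto)
  have "?t g f \<in> J" if g: "g \<in> carrier G" and f: "f \<in> J" for g f
  proof -
    obtain E1 where E1: "finite E1" "E1 \<subseteq> E" "\<forall>\<phi>. solves K G E1 \<phi> \<longrightarrow> pairing K \<phi> f = \<zero>\<^bsub>K\<^esub>"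
      using f by (auto simp: J_def)
    have c: "f \<in> carrier ?A" using f by (auto simp: J_def)
    have "pairing K \<phi> (?t g f) = \<zero>\<^bsub>K\<^esub>" if s: "solves K G E1 \<phi>" for \<phi>
      using E1(3) solves_translate[OF s _ g] E1(2) E pairing_translate[OF _ g c, of \<phi>] s
      by (auto simp: solves_def)
    then show ?thesis
      unfolding J_def using E1 reg.act_closed[OF g c]
      by (intro CollectI conjI exI[of _ E1]) auto
  qed
  then have Jinv: "invariant_submodule K G ?A ?t J"
    using Jsubm by (auto simp: invariant_submodule_def)
  have "point K \<one> \<notin> J"
  proof
    assume "point K \<one> \<in> J"
    then obtain E1 where E1: "finite E1" "E1 \<subseteq> E"
      "\<forall>\<phi>. solves K G E1 \<phi> \<longrightarrow> pairing K \<phi> (point K \<one>) = \<zero>\<^bsub>K\<^esub>" by (auto simp: J_def)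
    obtain \<phi> where "solves K G E1 \<phi>" "\<phi> \<one> = \<one>\<^bsub>K\<^esub>"
      using solv[OF E1(1,2)] by (auto simp: solvable_on_def)
    then show False using E1(3) pairing_point[OF one_closed, of \<phi>] by (auto simp: solves_def)
  qed
  then have "J \<noteq> carrier ?A" by auto
  then obtain Q where Q: "invariant_submodule K G ?A ?t Q" "J \<subseteq> Q" "Q \<noteq> carrier ?A"
    "\<And>W. \<lbrakk>invariant_submodule K G ?A ?t W; Q \<subseteq> W\<rbrakk> \<Longrightarrow> W = Q \<or> W = carrier ?A"
    by (rule exists_maximal_invariant[OF K.field_axioms group_algebra_module Jinv _, of "{point K \<one>}"])
      (use invariant_submodule_eq_carrier in auto)
  have Qsub: "submodule Q K ?A" using Q(1) by (simp add: invariant_submodule_def)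
  interpret q: quotient_space K ?A Q
    by (simp add: quotient_space_def quotient_space_axioms_def alg.vector_space_on_axioms Qsub)
  let ?V = "quotient_module ?A Q" and ?\<rho> = "quotient_action ?A Q ?t"
  have irr: "irreducible_representation K G ?V ?\<rho>"
    by (rule irreducible_quotient[OF K.field_axioms is_group group_algebra_module
          translate_lin_action Q(1,3,4)])
  have "\<not> detects K G E N" if N: "N \<subseteq> carrier G" and triv: "\<And>n. n \<in> N \<Longrightarrow> ?\<rho> n = \<one>\<^bsub>GL K ?V\<^esub>" for N
  proof
    assume det: "detects K G E N"
    have "point K \<one> \<notin> Q" using Q(1,3) invariant_submodule_eq_carrier by blast
    then obtain \<Lambda> where \<Lambda>: "linear_functional K ?A \<Lambda>" "\<And>z. z \<in> Q \<Longrightarrow> \<Lambda> z = \<zero>\<^bsub>K\<^esub>"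
      "\<Lambda> (point K \<one>) = \<one>\<^bsub>K\<^esub>"
      using alg.exists_linear_functional[OF Qsub point_closed[OF one_closed]] by blast
    let ?\<phi> = "\<lambda>x. \<Lambda> (?t x (point K \<one>))"
    have "solves K G E ?\<phi>"
    proof (rule reg.solves_functional[OF \<Lambda>(1) E])
      fix e g assume "e \<in> E" "g \<in> carrier G"
      then have "?t g (comb_act ?A ?t e (point K \<one>)) \<in> Q"
        using Je Q(2) invariant_submodule_mem[OF Q(1)] by blast
      then show "\<Lambda> (?t g (comb_act ?A ?t e (point K \<one>))) = \<zero>\<^bsub>K\<^esub>" by (rule \<Lambda>(2))
    qed simp
    moreover have "?\<phi> (g \<otimes> n) = ?\<phi> g" if g: "g \<in> carrier G" and n: "n \<in> N" for g n
    proof -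
      let ?d = "point K \<one>"
      have nG: "n \<in> carrier G" using n N by blast
      have d: "?d \<in> carrier ?A" "?t n ?d \<in> carrier ?A" using nG by auto
      have "?\<rho> n (q.cl ?d) = q.cl ?d"
        using triv[OF n] d by (simp add: GL_def BijGroup_def)
      then have "q.cl (?t n ?d) = q.cl ?d"
        using q.quotient_action_cl[OF translate_lin_action Q(1) nG d(1)] by simp
      then have "?t n ?d \<ominus>\<^bsub>?A\<^esub> ?d \<in> Q" using q.cl_eq_iff[OF d(2,1)] by blast
      then have "?t g (?t n ?d \<ominus>\<^bsub>?A\<^esub> ?d) \<in> Q" using invariant_submodule_mem[OF Q(1) g] by blast
      then have z: "\<Lambda> (?t g (?t n ?d) \<ominus>\<^bsub>?A\<^esub> ?t g ?d) = \<zero>\<^bsub>K\<^esub>"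
        using \<Lambda>(2) reg.act_diff[OF g d(2,1)] by simp
      have c: "?t g (?t n ?d) \<in> carrier ?A" "?t g ?d \<in> carrier ?A" using d g by auto
      have "?t g (?t n ?d) = (?t g (?t n ?d) \<ominus>\<^bsub>?A\<^esub> ?t g ?d) \<oplus>\<^bsub>?A\<^esub> ?t g ?d"
        using c by (simp add: a_minus_def alg.M.a_assoc alg.M.l_neg del: group_algebra_simps)
      then have "\<Lambda> (?t g (?t n ?d)) = \<Lambda> (?t g (?t n ?d) \<ominus>\<^bsub>?A\<^esub> ?t g ?d) \<oplus>\<^bsub>K\<^esub> \<Lambda> (?t g ?d)"
        using \<Lambda>(1) c alg.M.minus_closed[OF c] unfolding linear_functional_def by metis
      moreover have "\<Lambda> (?t g ?d) \<in> carrier K"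
        using \<Lambda>(1) c unfolding linear_functional_def by blast
      ultimately show ?thesis using z reg.act_mult[OF g nG d(1)] by simp
    qed
    ultimately have "?\<phi> \<one> = \<zero>\<^bsub>K\<^esub>" using det by (auto simp: detects_def)
    then show False using \<Lambda>(3) reg.act_one[OF point_closed[OF one_closed]] by simp
  qed
  then show thesis by (rule that[OF irr])
qed

end

section \<open>Finitely generated perfect groups\<close>

context vector_space_on
begin

lemma submodule_kernel:
  assumes L: "linear_functional K V \<Lambda>"
  shows "submodule {v \<in> carrier V. \<Lambda> v = \<zero>} K V"
proof -
  have smult: "a \<odot>\<^bsub>V\<^esub> v \<in> {v \<in> carrier V. \<Lambda> v = \<zero>}" if "a \<in> carrier K" "v \<in> {v \<in> carrier V. \<Lambda> v = \<zero>}" for a v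
    using L that by (simp add: linear_functional_def)
  have "\<Lambda> (\<zero> \<odot>\<^bsub>V\<^esub> \<zero>\<^bsub>V\<^esub>) = \<zero> \<otimes> \<Lambda> \<zero>\<^bsub>V\<^esub>" "\<Lambda> \<zero>\<^bsub>V\<^esub> \<in> carrier K"
    using L unfolding linear_functional_def by blast+
  then have z: "\<Lambda> \<zero>\<^bsub>V\<^esub> = \<zero>" by simp
  show ?thesis
  proof (rule submoduleI)
    show "\<ominus>\<^bsub>V\<^esub> a \<in> {v \<in> carrier V. \<Lambda> v = \<zero>}" if "a \<in> {v \<in> carrier V. \<Lambda> v = \<zero>}" for a
      using smult[OF _ that, of "\<ominus> \<one>"] that by (simp add: smult_l_minus)
    show "a \<oplus>\<^bsub>V\<^esub> b \<in> {v \<in> carrier V. \<Lambda> v = \<zero>}"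
      if "a \<in> {v \<in> carrier V. \<Lambda> v = \<zero>}" "b \<in> {v \<in> carrier V. \<Lambda> v = \<zero>}" for a b
      using L that by (simp add: linear_functional_def)
  qed (use smult z in auto)
qed

lemma functional_diff:
  assumes "linear_functional K V \<Lambda>" "v \<in> carrier V" "w \<in> carrier V"
  shows "\<Lambda> (v \<ominus>\<^bsub>V\<^esub> w) = \<Lambda> v \<ominus> \<Lambda> w"
proof -
  have "\<Lambda> (\<ominus>\<^bsub>V\<^esub> w) = \<ominus> \<Lambda> w"
  proof -
    have "\<ominus>\<^bsub>V\<^esub> w = (\<ominus> \<one>) \<odot>\<^bsub>V\<^esub> w" using assms by (simp add: smult_l_minus)
    moreover have "\<Lambda> w \<in> carrier K" using assms by (auto simp: linear_functional_def)
    moreover have "\<Lambda> ((\<ominus> \<one>) \<odot>\<^bsub>V\<^esub> w) = (\<ominus> \<one>) \<otimes> \<Lambda> w"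
      using assms unfolding linear_functional_def by simp
    ultimately show ?thesis by (simp add: K.l_minus)
  qed
  then show ?thesis using assms by (simp add: linear_functional_def a_minus_def)
qed

lemma submodule_of_submodule:
  assumes Z: "submodule Z K V" and W: "submodule W K (V\<lparr>carrier := Z\<rparr>)"
  shows "submodule W K V" "W \<subseteq> Z"
proof -
  have W': "subgroup W ((add_monoid V)\<lparr>carrier := Z\<rparr>)" using submodule.axioms(1)[OF W] by simp
  then have "subgroup W (add_monoid V)"
    using group.incl_subgroup[OF M.a_group submodule.axioms(1)[OF Z]] by blast
  then show "submodule W K V"
    using submodule.smult_closed[OF W] by (intro submodule.intro) (auto simp: submodule_axioms_def)
  show "W \<subseteq> Z" using subgroup.subset[OF W'] by simp
qed

end

context group_field
begin

text \<open>The element \<open>m - 1\<close> of the augmentation ideal.\<close>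

definition dpoint where "dpoint m = point K m \<ominus>\<^bsub>group_algebra K G\<^esub> point K \<one>"

abbreviation augmentation where "augmentation \<equiv> pairing K (\<lambda>_. \<one>\<^bsub>K\<^esub>)"

lemma augmentation_linear: "linear_functional K (group_algebra K G) augmentation"
  by (rule pairing_linear) simp

definition aug_ideal where "aug_ideal = {f \<in> carrier (group_algebra K G). augmentation f = \<zero>\<^bsub>K\<^esub>}"

lemma dpoint_closed: "m \<in> carrier G \<Longrightarrow> dpoint m \<in> carrier (group_algebra K G)"
  unfolding dpoint_def by (intro alg.M.minus_closed) auto

lemma dpoint_aug_ideal: "m \<in> carrier G \<Longrightarrow> dpoint m \<in> aug_ideal"
  using dpoint_closed[of m] alg.functional_diff[OF augmentation_linear, of "point K m" "point K \<one>"]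
  by (simp add: aug_ideal_def dpoint_def pairing_point K.minus_eq K.r_neg)

lemma aug_ideal_submodule: "submodule aug_ideal K (group_algebra K G)"
  unfolding aug_ideal_def by (rule alg.submodule_kernel[OF augmentation_linear])

lemma translate_aug_ideal: "\<lbrakk>g \<in> carrier G; f \<in> aug_ideal\<rbrakk> \<Longrightarrow> translate K G g f \<in> aug_ideal"
  using pairing_translate[of "\<lambda>_. \<one>\<^bsub>K\<^esub>" g f] reg.act_closed[of g f] by (simp add: aug_ideal_def)

lemma dpoint_one: "dpoint \<one> = \<zero>\<^bsub>group_algebra K G\<^esub>"
  unfolding dpoint_def using alg.M.r_neg[OF point_closed[OF one_closed]]
  by (simp add: a_minus_def del: group_algebra_simps)

lemma dpoint_mult:
  assumes "g \<in> carrier G" "h \<in> carrier G"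
  shows "dpoint (g \<otimes> h) = translate K G g (dpoint h) \<oplus>\<^bsub>group_algebra K G\<^esub> dpoint g"
proof -
  have c: "point K x \<in> carrier (group_algebra K G)" if "x \<in> carrier G" for x using that by simp
  have "translate K G g (dpoint h) = point K (g \<otimes> h) \<ominus>\<^bsub>group_algebra K G\<^esub> point K g"
    unfolding dpoint_def using assms reg.act_diff[of g "point K h" "point K \<one>"]
    by (simp add: translate_point del: group_algebra_simps)
  then show ?thesis
    unfolding dpoint_def using c assms
    by (simp add: a_minus_def alg.M.a_assoc alg.M.r_neg1 alg.M.r_neg2 del: group_algebra_simps)
qed

text \<open>Such a functional is constant on \<open>G\<close>, hence a multiple of the augmentation.\<close>

lemma functional_vanishes_on_aug_ideal:
  assumes L: "linear_functional K (group_algebra K G) \<Lambda>"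
    and d: "\<And>m. m \<in> carrier G \<Longrightarrow> \<Lambda> (dpoint m) = \<zero>\<^bsub>K\<^esub>" and f: "f \<in> aug_ideal"
  shows "\<Lambda> f = \<zero>\<^bsub>K\<^esub>"
proof -
  let ?A = "group_algebra K G"
  have c: "\<Lambda> (point K x) \<in> carrier K" if "x \<in> carrier G" for x
    using L that unfolding linear_functional_def by auto
  let ?c = "\<Lambda> (point K \<one>)"
  have "\<Lambda> f = ?c \<otimes>\<^bsub>K\<^esub> augmentation f"
  proof (rule linear_functional_ext[OF L])
    show "linear_functional K ?A (\<lambda>f. ?c \<otimes>\<^bsub>K\<^esub> augmentation f)"
      using augmentation_linear c[OF one_closed] unfolding linear_functional_def
      by (auto simp: K.r_distr K.m_lcomm Pi_iff simp del: group_algebra_simps)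
    fix y assume y: "y \<in> carrier G"
    have "\<Lambda> (point K y) \<ominus>\<^bsub>K\<^esub> ?c = \<zero>\<^bsub>K\<^esub>"
      using d[OF y] alg.functional_diff[OF L, of "point K y" "point K \<one>"] y by (simp add: dpoint_def)
    then have "\<Lambda> (point K y) = ?c" using c y by simp
    then show "\<Lambda> (point K y) = ?c \<otimes>\<^bsub>K\<^esub> augmentation (point K y)"
      using c y by (simp add: pairing_point)
  qed (use f in \<open>simp add: aug_ideal_def\<close>)
  then show ?thesis using f c by (simp add: aug_ideal_def)
qed

text \<open>The augmentation ideal \<open>\<omega>\<close> of a finitely generated group is a finitely generated left ideal, so
  it has a maximal invariant proper subspace \<open>Q\<close>. If \<open>G\<close> acted trivially on the irreducible quotient
  \<open>\<omega>/Q\<close>, then \<open>m \<mapsto> \<Lambda> (m - 1)\<close> would be a homomorphism to the additive group of \<open>K\<close> for every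
  functional \<open>\<Lambda>\<close> that vanishes on \<open>Q\<close>. As \<open>G\<close> is perfect, such a homomorphism is trivial, whence
  \<open>\<Lambda> = 0\<close> on \<open>\<omega>\<close> and \<open>Q = \<omega>\<close>.\<close>

lemma perfect_finitely_generated_imp_solvable:
  assumes fg: "finitely_generated_group G" and perfect: "derived G (carrier G) = carrier G"
    and nt: "carrier G \<noteq> {\<one>}"
  shows "\<exists>e \<in> combs K (carrier G). aug K e = \<one>\<^bsub>K\<^esub> \<and> solvable_on K G (carrier G) {e}"
proof -
  let ?A = "group_algebra K G" and ?t = "translate K G"
  let ?O = "?A\<lparr>carrier := aug_ideal\<rparr>"
  have O: "module K ?O"
    by (rule submodule.submodule_is_module[OF aug_ideal_submodule group_algebra_module])
  have act: "lin_action K G ?O ?t"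
    using translate_lin_action translate_aug_ideal by (auto simp: lin_action_def aug_ideal_def)
  interpret om: vector_space_on K ?O using O by (simp add: vector_space_on_def K.field_axioms)
  obtain S where S: "finite S" "S \<subseteq> carrier G" "generate G S = carrier G"
    using fg by (auto simp: finitely_generated_group_def)
  have invA: "submodule W K ?A" "W \<subseteq> aug_ideal" "\<And>g f. \<lbrakk>g \<in> carrier G; f \<in> W\<rbrakk> \<Longrightarrow> ?t g f \<in> W"
    if "invariant_submodule K G ?O ?t W" for W
    using that alg.submodule_of_submodule[OF aug_ideal_submodule, of W]
    by (auto simp: invariant_submodule_def)
  have sub: "aug_ideal \<subseteq> W"
    if W: "submodule W K ?A" and d: "\<And>m. m \<in> carrier G \<Longrightarrow> dpoint m \<in> W" for W
  proof
    fix f assume f: "f \<in> aug_ideal"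
    show "f \<in> W"
    proof (rule ccontr)
      assume "f \<notin> W"
      moreover have "f \<in> carrier ?A" using f by (simp add: aug_ideal_def)
      ultimately obtain \<Lambda> where "linear_functional K ?A \<Lambda>" "\<And>z. z \<in> W \<Longrightarrow> \<Lambda> z = \<zero>\<^bsub>K\<^esub>" "\<Lambda> f = \<one>\<^bsub>K\<^esub>"
        using alg.exists_linear_functional[OF W] by blast
      then show False using functional_vanishes_on_aug_ideal[of \<Lambda> f] d f by simp
    qed
  qed
  have gen: "W = carrier ?O" if W: "invariant_submodule K G ?O ?t W" and F: "dpoint ` S \<subseteq> W" for W
  proof -
    note Wm = alg.submodule_mem[OF invA(1)[OF W]]
    have "dpoint h \<in> W" if "h \<in> generate G S" for h
      using that
    proof (induction h rule: generate.induct)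
      case one
      show ?case using Wm(2) by (simp add: dpoint_one)
    next
      case (incl h)
      then show ?case using F by blast
    next
      case (inv h)
      then have h: "h \<in> carrier G" "dpoint h \<in> W" using F S by auto
      let ?x = "?t (inv h) (dpoint h)"
      have x: "?x \<in> W" using invA(3)[OF W] h by simp
      have eq: "\<zero>\<^bsub>?A\<^esub> = ?x \<oplus>\<^bsub>?A\<^esub> dpoint (inv h)"
        using dpoint_mult[of "inv h" h] h dpoint_one by (simp del: group_algebra_simps)
      have c: "?x \<in> carrier ?A" "dpoint (inv h) \<in> carrier ?A" using x Wm(1) h dpoint_closed by auto
      have "dpoint (inv h) = \<ominus>\<^bsub>?A\<^esub> ?x \<oplus>\<^bsub>?A\<^esub> (?x \<oplus>\<^bsub>?A\<^esub> dpoint (inv h))"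
        using c alg.M.r_neg1 by simp
      also have "\<dots> = \<ominus>\<^bsub>?A\<^esub> ?x" unfolding eq[symmetric] using c alg.M.r_zero alg.M.a_inv_closed by simp
      finally show ?case using Wm(4)[OF x] by simp
    next
      case (eng h1 h2)
      then have "h1 \<in> carrier G" "h2 \<in> carrier G" using S by auto
      then show ?case using dpoint_mult[of h1 h2] invA(3)[OF W] eng Wm(3) by simp
    qed
    then have "aug_ideal \<subseteq> W" using sub[OF invA(1)[OF W]] S(3) by simp
    then show ?thesis using invA(2)[OF W] by simp
  qed
  have zero: "invariant_submodule K G ?O ?t {\<zero>\<^bsub>?O\<^esub>}"
  proof -
    have "submodule {\<zero>\<^bsub>?O\<^esub>} K ?O"
      by (rule om.submoduleI) (use om.minus_zero_vec om.M.zero_closed om.M.r_zero in auto)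
    then show ?thesis
      using reg.act_zero by (auto simp: invariant_submodule_def)
  qed
  obtain m where m: "m \<in> carrier G" "m \<noteq> \<one>" using nt by blast
  have "dpoint m m = \<one>\<^bsub>K\<^esub>"
  proof -
    have "dpoint m \<oplus>\<^bsub>?A\<^esub> point K \<one> = point K m"
      unfolding dpoint_def using m point_closed
      by (simp add: a_minus_def alg.M.a_assoc alg.M.l_neg del: group_algebra_simps)
    then have "dpoint m m \<oplus>\<^bsub>K\<^esub> point K \<one> m = point K m m" by (simp add: fun_eq_iff)
    moreover have "dpoint m m \<in> carrier K" using dpoint_closed[OF m(1)] by (simp add: mem_group_algebra)
    ultimately show ?thesis using m by (simp add: point_def)
  qed
  then have "dpoint m \<noteq> \<zero>\<^bsub>?O\<^esub>" by (auto simp: group_algebra_def)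
  then have "{\<zero>\<^bsub>?O\<^esub>} \<noteq> carrier ?O" using dpoint_aug_ideal[OF m(1)] by auto
  then obtain Q where Q: "invariant_submodule K G ?O ?t Q" "Q \<noteq> carrier ?O"
    "\<And>W. \<lbrakk>invariant_submodule K G ?O ?t W; Q \<subseteq> W\<rbrakk> \<Longrightarrow> W = Q \<or> W = carrier ?O"
    by (rule exists_maximal_invariant[OF K.field_axioms O zero _, of "dpoint ` S"])
      (use S dpoint_aug_ideal gen in auto)
  interpret q: quotient_space K ?O Q
    using Q(1) by (simp add: quotient_space_def quotient_space_axioms_def om.vector_space_on_axioms
        invariant_submodule_def)
  let ?V = "quotient_module ?O Q" and ?\<rho> = "quotient_action ?O Q ?t"
  have irr: "irreducible_representation K G ?V ?\<rho>"
    by (rule irreducible_quotient[OF K.field_axioms is_group O act Q])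
  have "\<exists>g\<in>carrier G. ?\<rho> g \<noteq> \<one>\<^bsub>GL K ?V\<^esub>"
  proof (rule ccontr)
    assume triv: "\<not> (\<exists>g\<in>carrier G. ?\<rho> g \<noteq> \<one>\<^bsub>GL K ?V\<^esub>)"
    have QA: "submodule Q K ?A" "Q \<subseteq> aug_ideal" using invA[OF Q(1)] by blast+
    obtain w where w: "w \<in> aug_ideal" "w \<notin> Q" using Q(2) QA(2) by auto
    then obtain \<Lambda> where L: "linear_functional K ?A \<Lambda>" "\<And>z. z \<in> Q \<Longrightarrow> \<Lambda> z = \<zero>\<^bsub>K\<^esub>" "\<Lambda> w = \<one>\<^bsub>K\<^esub>"
      using alg.exists_linear_functional[OF QA(1)] by (auto simp: aug_ideal_def)
    have Lc: "\<Lambda> f \<in> carrier K" if "f \<in> carrier ?A" for f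
      using L(1) that by (auto simp: linear_functional_def)
    have inv: "\<Lambda> (?t g f) = \<Lambda> f" if g: "g \<in> carrier G" and f: "f \<in> aug_ideal" for g f
    proof -
      have tf: "?t g f \<in> aug_ideal" by (rule translate_aug_ideal[OF g f])
      have c: "f \<in> carrier ?A" "?t g f \<in> carrier ?A" using f tf by (auto simp: aug_ideal_def)
      have "?\<rho> g (q.cl f) = q.cl f" using triv g f by (simp add: GL_def BijGroup_def)
      then have "q.cl (?t g f) = q.cl f" using q.quotient_action_cl[OF act Q(1) g] f by simp
      then have d: "?t g f \<ominus>\<^bsub>?O\<^esub> f \<in> Q" using q.cl_eq_iff f tf by simp
      have "\<Lambda> ((?t g f \<ominus>\<^bsub>?O\<^esub> f) \<oplus>\<^bsub>?A\<^esub> f) = \<zero>\<^bsub>K\<^esub> \<oplus>\<^bsub>K\<^esub> \<Lambda> f"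
        using L(1) L(2)[OF d] subsetD[OF alg.submodule_mem(1)[OF QA(1)] d] c(1)
        unfolding linear_functional_def by simp
      moreover have "(?t g f \<ominus>\<^bsub>?O\<^esub> f) \<oplus>\<^bsub>?A\<^esub> f = ?t g f"
      proof -
        have "(?t g f \<ominus>\<^bsub>?O\<^esub> f) \<oplus>\<^bsub>?O\<^esub> f = ?t g f"
          using f tf om.M.l_neg[of f] om.M.a_assoc om.M.a_inv_closed[of f] om.M.r_zero[of "?t g f"]
          by (simp add: a_minus_def del: group_algebra_simps)
        then show ?thesis by simp
      qed
      ultimately show ?thesis using Lc[OF c(1)] by simp
    qed
    have mult: "\<Lambda> (dpoint (g \<otimes> h)) = \<Lambda> (dpoint h) \<oplus>\<^bsub>K\<^esub> \<Lambda> (dpoint g)"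
      if "g \<in> carrier G" "h \<in> carrier G" for g h
      using L(1) inv[OF that(1) dpoint_aug_ideal[OF that(2)]] dpoint_mult[OF that]
        dpoint_closed that reg.act_closed
      by (simp add: linear_functional_def del: group_algebra_simps)
    have one: "\<Lambda> (dpoint \<one>) = \<zero>\<^bsub>K\<^esub>"
      using L(2) alg.submodule_mem(2)[OF QA(1)] by (simp add: dpoint_one)
    have inv': "\<Lambda> (dpoint (inv g)) = \<ominus>\<^bsub>K\<^esub> \<Lambda> (dpoint g)" if g: "g \<in> carrier G" for g
    proof -
      have "\<zero>\<^bsub>K\<^esub> = \<Lambda> (dpoint (inv g)) \<oplus>\<^bsub>K\<^esub> \<Lambda> (dpoint g)"
        using mult[of g "inv g"] g one by simp
      then show ?thesis
        using K.minus_equality[of "\<Lambda> (dpoint (inv g))" "\<Lambda> (dpoint g)"] g Lc dpoint_closed by simp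
    qed
    have "subgroup {g \<in> carrier G. \<Lambda> (dpoint g) = \<zero>\<^bsub>K\<^esub>} G"
      by (rule subgroupI) (use mult one inv' in auto)
    moreover have "derived_set G (carrier G) \<subseteq> {g \<in> carrier G. \<Lambda> (dpoint g) = \<zero>\<^bsub>K\<^esub>}"
    proof
      fix x assume "x \<in> derived_set G (carrier G)"
      then obtain g h where gh: "g \<in> carrier G" "h \<in> carrier G" "x = g \<otimes> h \<otimes> inv g \<otimes> inv h" by auto
      have c: "\<Lambda> (dpoint g) \<in> carrier K" "\<Lambda> (dpoint h) \<in> carrier K" using gh Lc dpoint_closed by auto
      have "\<Lambda> (dpoint x) = \<ominus>\<^bsub>K\<^esub> \<Lambda> (dpoint h) \<oplus>\<^bsub>K\<^esub> (\<ominus>\<^bsub>K\<^esub> \<Lambda> (dpoint g) \<oplus>\<^bsub>K\<^esub> (\<Lambda> (dpoint h) \<oplus>\<^bsub>K\<^esub> \<Lambda> (dpoint g)))"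
        using gh mult inv' by simp
      also have "\<dots> = \<zero>\<^bsub>K\<^esub>" using c by (simp add: K.a_comm[of "\<Lambda> (dpoint h)"] K.r_neg1 K.l_neg)
      finally show "x \<in> {g \<in> carrier G. \<Lambda> (dpoint g) = \<zero>\<^bsub>K\<^esub>}" using gh by simp
    qed
    ultimately have "derived G (carrier G) \<subseteq> {g \<in> carrier G. \<Lambda> (dpoint g) = \<zero>\<^bsub>K\<^esub>}"
      unfolding derived_def by (intro generate_subgroup_incl)
    then have "\<Lambda> (dpoint g) = \<zero>\<^bsub>K\<^esub>" if "g \<in> carrier G" for g using perfect that by auto
    then have "\<Lambda> w = \<zero>\<^bsub>K\<^esub>" using functional_vanishes_on_aug_ideal[OF L(1)] w by blast
    then show False using L(3) by simp
  qed
  then have "nontrivial_representation K G ?V ?\<rho>"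
    using irr by (simp add: nontrivial_representation_def irreducible_representation_def)
  with irr show ?thesis by (rule nontrivial_irreducible_imp_solvable)
qed

end

section \<open>Minimal normal subgroups\<close>

context group
begin

lemma nat_pow_conj:
  "\<lbrakk>g \<in> carrier G; x \<in> carrier G\<rbrakk> \<Longrightarrow> (g \<otimes> x \<otimes> inv g) [^] (k::nat) = g \<otimes> x [^] k \<otimes> inv g"
proof (induction k)
  case (Suc k)
  have "(g \<otimes> x [^] k \<otimes> inv g) \<otimes> (g \<otimes> x \<otimes> inv g) = g \<otimes> (x [^] k \<otimes> (inv g \<otimes> g) \<otimes> x) \<otimes> inv g"
    using Suc.prems by (simp only: m_assoc m_closed inv_closed nat_pow_closed)
  then show ?case using Suc by simp
qed simp

lemma generate_finite_support:
  assumes "x \<in> generate G B"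
  shows "\<exists>F. finite F \<and> F \<subseteq> B \<and> x \<in> generate G F"
  using assms
proof (induction x rule: generate.induct)
  case one
  show ?case by (rule exI[of _ "{}"]) (auto intro: generate.one)
next
  case (incl h)
  then show ?case by (intro exI[of _ "{h}"]) (auto intro: generate.incl)
next
  case (inv h)
  then show ?case by (intro exI[of _ "{h}"]) (auto intro: generate.inv)
next
  case (eng h1 h2)
  then obtain F1 F2 where F: "finite F1" "F1 \<subseteq> B" "h1 \<in> generate G F1"
    "finite F2" "F2 \<subseteq> B" "h2 \<in> generate G F2" by blast
  have "h1 \<in> generate G (F1 \<union> F2)" "h2 \<in> generate G (F1 \<union> F2)"
    using F mono_generate[of F1 "F1 \<union> F2"] mono_generate[of F2 "F1 \<union> F2"] by blast+
  then show ?case using F by (intro exI[of _ "F1 \<union> F2"]) (auto intro: generate.eng)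
qed

lemma generate_Union_finite_support:
  assumes "x \<in> generate G (\<Union>\<N>)"
  shows "\<exists>\<F>. finite \<F> \<and> \<F> \<subseteq> \<N> \<and> x \<in> generate G (\<Union>\<F>)"
proof -
  obtain F where F: "finite F" "F \<subseteq> \<Union>\<N>" "x \<in> generate G F"
    using generate_finite_support[OF assms] by blast
  then obtain \<F> where "finite \<F>" "\<F> \<subseteq> \<N>" "F \<subseteq> \<Union>\<F>"
    using finite_subset_Union by metis
  then show ?thesis using F(3) mono_generate[of F "\<Union>\<F>"] by blast
qed

lemma generate_commute:
  assumes B: "B \<subseteq> carrier G" and Y: "Y \<subseteq> carrier G"
    and comm: "\<And>x y. \<lbrakk>x \<in> B; y \<in> Y\<rbrakk> \<Longrightarrow> x \<otimes> y = y \<otimes> x"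
    and xy: "x \<in> generate G B" "y \<in> generate G Y"
  shows "x \<otimes> y = y \<otimes> x"
proof -
  have centralizer: "subgroup {g \<in> carrier G. \<forall>s\<in>S. g \<otimes> s = s \<otimes> g} G" if S: "S \<subseteq> carrier G" for S
  proof (rule subgroupI)
    fix a assume a: "a \<in> {g \<in> carrier G. \<forall>s\<in>S. g \<otimes> s = s \<otimes> g}"
    have "inv a \<otimes> s = s \<otimes> inv a" if s: "s \<in> S" for s
    proof -
      have c: "s \<in> carrier G" "a \<in> carrier G" "a \<otimes> s = s \<otimes> a" using s S a by auto
      have "inv a \<otimes> s = inv a \<otimes> (s \<otimes> a) \<otimes> inv a" using c(1,2) by (simp add: m_assoc)
      also have "\<dots> = s \<otimes> inv a"
        unfolding c(3)[symmetric] using c(1,2) by (simp add: m_assoc[symmetric])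
      finally show ?thesis .
    qed
    then show "inv a \<in> {g \<in> carrier G. \<forall>s\<in>S. g \<otimes> s = s \<otimes> g}" using a by auto
    fix b assume b: "b \<in> {g \<in> carrier G. \<forall>s\<in>S. g \<otimes> s = s \<otimes> g}"
    have "a \<otimes> b \<otimes> s = s \<otimes> (a \<otimes> b)" if s: "s \<in> S" for s
    proof -
      have c: "s \<in> carrier G" "a \<in> carrier G" "b \<in> carrier G" "a \<otimes> s = s \<otimes> a" "b \<otimes> s = s \<otimes> b"
        using s S a b by auto
      then show ?thesis by (metis m_assoc)
    qed
    then show "a \<otimes> b \<in> {g \<in> carrier G. \<forall>s\<in>S. g \<otimes> s = s \<otimes> g}" using a b by auto
  qed (use S in \<open>auto intro!: exI[of _ "\<one>"] simp: subset_iff\<close>)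
  have "generate G B \<subseteq> {g \<in> carrier G. \<forall>s\<in>Y. g \<otimes> s = s \<otimes> g}"
    by (rule generate_subgroup_incl[OF _ centralizer[OF Y]]) (use B comm in auto)
  then have "\<And>s. s \<in> Y \<Longrightarrow> x \<otimes> s = s \<otimes> x" and xG: "x \<in> carrier G" using xy(1) by auto
  then have "generate G Y \<subseteq> {g \<in> carrier G. \<forall>s\<in>{x}. g \<otimes> s = s \<otimes> g}"
    by (intro generate_subgroup_incl[OF _ centralizer]) (use Y in auto)
  then show ?thesis using xy(2) by auto
qed

lemma normal_conj: "\<lbrakk>N \<lhd> G; g \<in> carrier G; n \<in> N\<rbrakk> \<Longrightarrow> g \<otimes> n \<otimes> inv g \<in> N"
  by (simp add: normal.inv_op_closed2)

lemma normal_mem_carrier: "\<lbrakk>N \<lhd> G; n \<in> N\<rbrakk> \<Longrightarrow> n \<in> carrier G"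
  using subgroup.mem_carrier[OF normal_imp_subgroup] .

lemma generate_Union_normal:
  assumes "\<And>N. N \<in> \<N> \<Longrightarrow> N \<lhd> G"
  shows "generate G (\<Union>\<N>) \<lhd> G"
proof (rule normal_generateI)
  have "N \<subseteq> carrier G" if "N \<in> \<N>" for N
  proof -
    have "subgroup N G" by (rule normal_imp_subgroup) (rule assms[OF that])
    then show ?thesis by (rule subgroup.subset)
  qed
  then show "\<Union>\<N> \<subseteq> carrier G" by (rule Union_least)
  fix h g assume "h \<in> \<Union>\<N>" and g: "g \<in> carrier G"
  then obtain N where "N \<in> \<N>" "h \<in> N" by blast
  then show "g \<otimes> h \<otimes> inv g \<in> \<Union>\<N>" using normal_conj[OF assms g] by blast
qed

lemma set_mult_normal:
  assumes P: "P \<lhd> G" and N: "N \<lhd> G"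
  shows "P <#> N \<lhd> G"
proof (rule normal_invI)
  have p: "\<And>x. x \<in> P \<Longrightarrow> x \<in> carrier G" "\<And>x. x \<in> N \<Longrightarrow> x \<in> carrier G"
    using normal_mem_carrier P N by blast+
  note sP = normal_imp_subgroup[OF P] and sN = normal_imp_subgroup[OF N]
  show "subgroup (P <#> N) G"
  proof (rule subgroupI)
    show "P <#> N \<subseteq> carrier G" using p by (auto simp: set_mult_def)
    show "P <#> N \<noteq> {}" using subgroup.one_closed[OF sP] subgroup.one_closed[OF sN] by (auto simp: set_mult_def)
    fix a assume "a \<in> P <#> N"
    then obtain x y where xy: "x \<in> P" "y \<in> N" "a = x \<otimes> y" by (auto simp: set_mult_def)
    have "inv a = inv x \<otimes> (x \<otimes> inv y \<otimes> inv x)"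
      using xy p by (simp add: inv_mult_group m_assoc[symmetric])
    moreover have "x \<otimes> inv y \<otimes> inv x \<in> N"
      using normal_conj[OF N] xy p subgroup.m_inv_closed[OF sN] by blast
    ultimately show "inv a \<in> P <#> N"
      using subgroup.m_inv_closed[OF sP xy(1)] by (auto simp: set_mult_def)
    fix b assume "b \<in> P <#> N"
    then obtain x' y' where xy': "x' \<in> P" "y' \<in> N" "b = x' \<otimes> y'" by (auto simp: set_mult_def)
    have "a \<otimes> b = (x \<otimes> x') \<otimes> ((inv x' \<otimes> y \<otimes> inv (inv x')) \<otimes> y')"
    proof -
      have "(x \<otimes> x') \<otimes> ((inv x' \<otimes> y \<otimes> inv (inv x')) \<otimes> y') = x \<otimes> (x' \<otimes> inv x') \<otimes> y \<otimes> x' \<otimes> y'"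
        using xy xy' p by (simp only: m_assoc m_closed inv_closed inv_inv)
      then show ?thesis using xy xy' p by (simp add: m_assoc)
    qed
    moreover have "inv x' \<otimes> y \<otimes> inv (inv x') \<in> N" using normal_conj[OF N] xy xy' p by blast
    ultimately show "a \<otimes> b \<in> P <#> N"
      using subgroup.m_closed[OF sP xy(1) xy'(1)] subgroup.m_closed[OF sN _ xy'(2)]
      by (auto simp: set_mult_def)
  qed
  fix g h assume g: "g \<in> carrier G" and "h \<in> P <#> N"
  then obtain x y where xy: "x \<in> P" "y \<in> N" "h = x \<otimes> y" by (auto simp: set_mult_def)
  have "(g \<otimes> x \<otimes> inv g) \<otimes> (g \<otimes> y \<otimes> inv g) = g \<otimes> x \<otimes> (inv g \<otimes> g) \<otimes> y \<otimes> inv g"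
    using xy p g by (simp only: m_assoc m_closed inv_closed)
  then have "g \<otimes> h \<otimes> inv g = (g \<otimes> x \<otimes> inv g) \<otimes> (g \<otimes> y \<otimes> inv g)"
    using xy p g by (simp add: m_assoc)
  then show "g \<otimes> h \<otimes> inv g \<in> P <#> N"
    using normal_conj[OF P g xy(1)] normal_conj[OF N g xy(2)] by (auto simp: set_mult_def)
qed

lemma generate_Un_subset_set_mult:
  assumes N: "N \<lhd> G" and B: "generate G B \<lhd> G" "B \<subseteq> carrier G"
  shows "generate G (B \<union> N) \<subseteq> generate G B <#> N"
proof (rule generate_subgroup_incl)
  note one = subgroup.one_closed[OF normal_imp_subgroup[OF N]] generate.one[of G B]
  show "B \<union> N \<subseteq> generate G B <#> N"
  proof
    fix x assume x: "x \<in> B \<union> N"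
    then have xG: "x \<in> carrier G" using B(2) normal_mem_carrier[OF N] by blast
    from x show "x \<in> generate G B <#> N"
    proof
      assume "x \<in> B"
      then show ?thesis using generate.incl[of x B G] one(1) xG by (force simp: set_mult_def)
    next
      assume "x \<in> N"
      then show ?thesis using one(2) xG by (force simp: set_mult_def)
    qed
  qed
  show "subgroup (generate G B <#> N) G" by (rule normal_imp_subgroup[OF set_mult_normal[OF B(1) N]])
qed

lemma min_normalD:
  assumes "minimal_normal_subgroup G M"
  shows "M \<lhd> G" "M \<noteq> {\<one>}" "\<And>R. \<lbrakk>R \<lhd> G; R \<subseteq> M\<rbrakk> \<Longrightarrow> R = {\<one>} \<or> R = M" "M \<subseteq> carrier G" "\<one> \<in> M"
proof -
  show M: "M \<lhd> G" using assms by (simp add: minimal_normal_subgroup_def)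
  show "M \<noteq> {\<one>}" "\<And>R. \<lbrakk>R \<lhd> G; R \<subseteq> M\<rbrakk> \<Longrightarrow> R = {\<one>} \<or> R = M"
    using assms by (auto simp: minimal_normal_subgroup_def)
  show "M \<subseteq> carrier G" "\<one> \<in> M"
    using subgroup.subset[OF normal_imp_subgroup[OF M]] subgroup.one_closed[OF normal_imp_subgroup[OF M]]
    by auto
qed

lemma min_normal_inter:
  assumes M: "minimal_normal_subgroup G M" and R: "R \<lhd> G"
  shows "R \<inter> M = {\<one>} \<or> M \<subseteq> R"
  using min_normalD(3)[OF M normal_subgroup_intersect[OF R min_normalD(1)[OF M]]] by blast

lemma min_normal_disjoint:
  assumes "minimal_normal_subgroup G M" "minimal_normal_subgroup G N" "M \<noteq> N"
  shows "M \<inter> N = {\<one>}"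
  using min_normal_inter[OF assms(1) min_normalD(1)[OF assms(2)]]
    min_normal_inter[OF assms(2) min_normalD(1)[OF assms(1)]] assms(3) by blast

text \<open>The subgroup \<open>H \<inter> P N\<close> meets \<open>P\<close> trivially, so it is determined by its projection to \<open>N\<close>. The
  elements \<open>n\<close> of \<open>N\<close> with \<open>p n \<in> R\<close> for some \<open>p \<in> P\<close> form a normal subgroup of \<open>G\<close> for every normal
  subgroup \<open>R\<close> below \<open>H \<inter> P N\<close>. By the minimality of \<open>N\<close> this is all of \<open>N\<close> unless \<open>R\<close> is trivial,
  and so \<open>H \<inter> P N\<close> is minimal.\<close>

lemma contains_min_normal_step:
  assumes H: "H \<lhd> G" and P: "P \<lhd> G" and N: "minimal_normal_subgroup G N"
    and HP: "H \<inter> P = {\<one>}" and x: "x \<in> H" "x \<in> P <#> N" "x \<noteq> \<one>"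
  shows "\<exists>M. minimal_normal_subgroup G M \<and> M \<subseteq> H"
proof -
  note nN = min_normalD[OF N]
  have c: "\<And>x. x \<in> P \<Longrightarrow> x \<in> carrier G" "\<And>x. x \<in> N \<Longrightarrow> x \<in> carrier G" "\<And>x. x \<in> H \<Longrightarrow> x \<in> carrier G"
    using normal_mem_carrier P nN(1) H by blast+
  note sP = normal_imp_subgroup[OF P] and sN = normal_imp_subgroup[OF nN(1)]
  define H' where "H' = H \<inter> (P <#> N)"
  have H': "H' \<lhd> G" unfolding H'_def by (rule normal_subgroup_intersect[OF H set_mult_normal[OF P nN(1)]])
  have proj: "\<exists>p\<in>P. p \<otimes> n \<in> R" if R: "R \<lhd> G" "R \<subseteq> H'" "R \<noteq> {\<one>}" and n: "n \<in> N" for R n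
  proof -
    note sR = normal_imp_subgroup[OF R(1)]
    let ?N = "N \<inter> (P <#> R)"
    have "?N \<lhd> G" by (rule normal_subgroup_intersect[OF nN(1) set_mult_normal[OF P R(1)]])
    moreover have "?N \<noteq> {\<one>}"
    proof -
      obtain r where r: "r \<in> R" "r \<noteq> \<one>" using R(3) subgroup.one_closed[OF sR] by blast
      then obtain p m where pm: "p \<in> P" "m \<in> N" "r = p \<otimes> m" using R(2) by (auto simp: H'_def set_mult_def)
      have "m = inv p \<otimes> r" using pm c by (simp add: m_assoc[symmetric])
      then have "m \<in> ?N" using pm r subgroup.m_inv_closed[OF sP pm(1)] by (auto simp: set_mult_def)
      moreover have "m \<noteq> \<one>"
      proof
        assume "m = \<one>"
        then have "r = p" using pm c by simp
        then have "r \<in> H \<inter> P" using r R(2) pm by (auto simp: H'_def)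
        then show False using HP r by blast
      qed
      ultimately show ?thesis by blast
    qed
    ultimately have "?N = N" using nN(3)[of ?N] by blast
    then have "n \<in> P <#> R" using n by blast
    then obtain p r where pr: "p \<in> P" "r \<in> R" "n = p \<otimes> r" by (auto simp: set_mult_def)
    have "r \<in> carrier G" using pr R(1) normal_mem_carrier by blast
    then have "inv p \<otimes> n = r" using pr c by (simp add: m_assoc[symmetric])
    then show ?thesis using pr subgroup.m_inv_closed[OF sP pr(1)] by (intro bexI[of _ "inv p"]) auto
  qed
  have "minimal_normal_subgroup G H'"
    unfolding minimal_normal_subgroup_def
  proof (intro conjI allI impI H')
    show "H' \<noteq> {\<one>}" using x by (auto simp: H'_def)
    fix R assume R: "R \<lhd> G \<and> R \<subseteq> H'"
    show "R = {\<one>} \<or> R = H'"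
    proof (rule disjCI)
      assume "R \<noteq> H'"
      show "R = {\<one>}"
      proof (rule ccontr)
        assume R1: "R \<noteq> {\<one>}"
        note sR = normal_imp_subgroup[OF conjunct1[OF R]] and sH = normal_imp_subgroup[OF H]
        have "H' \<subseteq> R"
        proof
          fix h assume h: "h \<in> H'"
          then obtain p n where pn: "p \<in> P" "n \<in> N" "h = p \<otimes> n" "h \<in> H" by (auto simp: H'_def set_mult_def)
          obtain q where q: "q \<in> P" "q \<otimes> n \<in> R" using proj[of R n] R R1 pn by blast
          have "q \<otimes> n \<in> H" using q R by (auto simp: H'_def)
          have "h \<otimes> inv (q \<otimes> n) = p \<otimes> (n \<otimes> inv n) \<otimes> inv q"
            using pn q c by (simp only: inv_mult_group m_assoc m_closed inv_closed)
          then have eq: "h \<otimes> inv (q \<otimes> n) = p \<otimes> inv q" using pn q c by simp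
          have "h \<otimes> inv (q \<otimes> n) \<in> H"
            using pn(4) \<open>q \<otimes> n \<in> H\<close> subgroup.m_closed[OF sH] subgroup.m_inv_closed[OF sH] by blast
          moreover have "p \<otimes> inv q \<in> P" using pn q subgroup.m_closed[OF sP] subgroup.m_inv_closed[OF sP] by blast
          ultimately have "h \<otimes> inv (q \<otimes> n) = \<one>" using HP eq by auto
          then have "h = q \<otimes> n" using pn q c by (metis inv_equality inv_inv m_closed inv_closed)
          then show "h \<in> R" using q by simp
        qed
        then show False using R \<open>R \<noteq> H'\<close> by blast
      qed
    qed
  qed
  then show ?thesis by (intro exI[of _ H']) (auto simp: H'_def)
qed

text \<open>Some product of finitely many minimal normal subgroups meets \<open>H\<close> nontrivially. In a shortest one,
  all factors but the last have a product that meets \<open>H\<close> trivially.\<close>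

lemma contains_min_normal:
  assumes H: "H \<lhd> G" and x: "x \<in> H" "x \<in> Soc G" "x \<noteq> \<one>"
  shows "\<exists>M. minimal_normal_subgroup G M \<and> M \<subseteq> H"
proof -
  obtain \<F> where \<F>: "finite \<F>" "\<F> \<subseteq> {N. minimal_normal_subgroup G N}" "x \<in> generate G (\<Union>\<F>)"
    using generate_Union_finite_support x(2) unfolding Soc_def by blast
  then show ?thesis using x(1,3)
  proof (induction \<F> arbitrary: x rule: finite_induct)
    case empty
    then show ?case using generate_empty by auto
  next
    case (insert N \<F>)
    then have N: "minimal_normal_subgroup G N" by simp
    let ?P = "generate G (\<Union>\<F>)"
    have sub: "\<Union>\<F> \<subseteq> carrier G" using insert.prems(1) min_normalD(4) by auto
    have P: "?P \<lhd> G" by (rule generate_Union_normal) (use insert.prems min_normalD(1) in auto)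
    show ?case
    proof (cases "H \<inter> ?P = {\<one>}")
      case True
      have "x \<in> generate G (\<Union>\<F> \<union> N)" using insert.prems(2) by (simp add: Un_commute)
      then have "x \<in> ?P <#> N"
        using generate_Un_subset_set_mult[OF min_normalD(1)[OF N] P sub] by blast
      then show ?thesis by (rule contains_min_normal_step[OF H P N True insert.prems(3) _ insert.prems(4)])
    next
      case False
      then obtain y where "y \<in> H" "y \<in> ?P" "y \<noteq> \<one>"
        using subgroup.one_closed[OF normal_imp_subgroup[OF H]] generate.one by blast
      then show ?thesis using insert by auto
    qed
  qed
qed

lemma comm_subgroup_iff:
  assumes "subgroup N G"
  shows "comm_group (G\<lparr>carrier := N\<rparr>) \<longleftrightarrow> (\<forall>x\<in>N. \<forall>y\<in>N. x \<otimes> y = y \<otimes> x)"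
proof
  assume "comm_group (G\<lparr>carrier := N\<rparr>)"
  then interpret C: comm_group "G\<lparr>carrier := N\<rparr>" .
  show "\<forall>x\<in>N. \<forall>y\<in>N. x \<otimes> y = y \<otimes> x" using C.m_comm by simp
next
  assume "\<forall>x\<in>N. \<forall>y\<in>N. x \<otimes> y = y \<otimes> x"
  then show "comm_group (G\<lparr>carrier := N\<rparr>)"
    by (intro group.group_comm_groupI subgroup_imp_group[OF assms]) simp
qed

lemma ord_subgroup:
  assumes "subgroup N G" "x \<in> N"
  shows "group.ord (G\<lparr>carrier := N\<rparr>) x = ord x"
proof -
  interpret S: group "G\<lparr>carrier := N\<rparr>" by (rule subgroup_imp_group[OF assms(1)])
  show ?thesis
    unfolding S.ord_def ord_def by (simp add: nat_pow_consistent[symmetric])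
qed

definition abelian_min where
  "abelian_min N \<longleftrightarrow> minimal_normal_subgroup G N \<and> (\<forall>x\<in>N. \<forall>y\<in>N. x \<otimes> y = y \<otimes> x)"

text \<open>The kernel and the image of the \<open>q\<close>-th power map of an abelian normal subgroup are normal in
  \<open>G\<close>.\<close>

lemma normal_torsion_and_powers:
  assumes N: "abelian_min N" and q: "q > (0::nat)"
  shows "{x \<in> N. x [^] q = \<one>} = {\<one>} \<and> (\<lambda>x. x [^] q) ` N = N \<or> (\<forall>x\<in>N. x [^] q = \<one>)"
proof -
  have M: "minimal_normal_subgroup G N" and comm: "\<And>x y. \<lbrakk>x \<in> N; y \<in> N\<rbrakk> \<Longrightarrow> x \<otimes> y = y \<otimes> x"
    using N by (auto simp: abelian_min_def)
  note nN = min_normalD[OF M]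
  note sN = normal_imp_subgroup[OF nN(1)]
  have c: "x \<in> carrier G" if "x \<in> N" for x using nN(4) that by blast
  have pw: "(x \<otimes> y) [^] q = x [^] q \<otimes> y [^] q" if "x \<in> N" "y \<in> N" for x y
    using pow_mult_distrib[OF comm[OF that]] c that by blast
  have pN: "x [^] k \<in> N" if "x \<in> N" for x and k :: nat
    using that subgroup.one_closed[OF sN] subgroup.m_closed[OF sN] by (induction k) auto
  have T: "{x \<in> N. x [^] q = \<one>} \<lhd> G"
  proof (rule normal_invI)
    show "subgroup {x \<in> N. x [^] q = \<one>} G"
      by (rule subgroupI)
        (use c pw nN(5) subgroup.m_closed[OF sN] subgroup.m_inv_closed[OF sN] in \<open>auto simp: nat_pow_inv\<close>)
  qed (use normal_conj[OF nN(1)] c in \<open>auto simp: nat_pow_conj\<close>)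
  have I: "(\<lambda>x. x [^] q) ` N \<lhd> G"
  proof (rule normal_invI)
    show "subgroup ((\<lambda>x. x [^] q) ` N) G"
    proof (rule subgroupI)
      fix a assume "a \<in> (\<lambda>x. x [^] q) ` N"
      then obtain x where x: "x \<in> N" "a = x [^] q" by blast
      then have "inv a = inv x [^] q" using c by (simp add: nat_pow_inv)
      then show "inv a \<in> (\<lambda>x. x [^] q) ` N" using x subgroup.m_inv_closed[OF sN] by blast
      fix b assume "b \<in> (\<lambda>x. x [^] q) ` N"
      then obtain y where y: "y \<in> N" "b = y [^] q" by blast
      show "a \<otimes> b \<in> (\<lambda>x. x [^] q) ` N"
        using pw[OF x(1) y(1)] x y subgroup.m_closed[OF sN x(1) y(1)] by (metis imageI)
    qed (use c nN(5) in auto)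
    fix g a assume g: "g \<in> carrier G" and "a \<in> (\<lambda>x. x [^] q) ` N"
    then obtain x where x: "x \<in> N" "a = x [^] q" by blast
    then show "g \<otimes> a \<otimes> inv g \<in> (\<lambda>x. x [^] q) ` N"
      using nat_pow_conj[OF g c[OF x(1)], of q] normal_conj[OF nN(1) g x(1)] by (metis imageI)
  qed
  have Isub: "(\<lambda>x. x [^] q) ` N \<subseteq> N" using pN by blast
  show ?thesis
    using nN(3)[OF T] nN(3)[OF I Isub] by auto
qed

lemma abelian_min_torsion:
  assumes N: "abelian_min N" and tor: "x \<in> N" "x \<noteq> \<one>" "x [^] (k::nat) = \<one>" "k > 0"
  shows "\<exists>p. normalization_semidom_class.prime (p::nat) \<and> (\<forall>y\<in>N. y [^] p = \<one>)"
proof -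
  have xG: "x \<in> carrier G" using N tor(1) min_normalD(4) by (auto simp: abelian_min_def)
  have d: "ord x dvd k" "ord x \<noteq> 1" "ord x > 0"
    using tor xG pow_eq_id[OF xG, of k] ord_eq_1[OF xG] dvd_pos_nat by auto
  then obtain p where p: "normalization_semidom_class.prime p" "p dvd ord x"
    using prime_factor_nat by blast
  let ?y = "x [^] (ord x div p)"
  have "?y [^] p = \<one>" using p xG by (simp add: nat_pow_pow)
  moreover have "?y \<noteq> \<one>"
  proof
    assume "?y = \<one>"
    then have "ord x dvd ord x div p" using pow_eq_id[OF xG] by simp
    then have "ord x \<le> ord x div p" using d p by (intro dvd_imp_le) (auto simp: dvd_div_eq_0_iff)
    moreover have "ord x div p < ord x" using d(3) prime_gt_1_nat[OF p(1)] by simp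
    ultimately show False by simp
  qed
  moreover have "?y \<in> N"
  proof -
    have sN: "subgroup N G" using N min_normalD(1) normal_imp_subgroup by (auto simp: abelian_min_def)
    have "x [^] j \<in> N" for j :: nat
      by (induction j) (use tor sN subgroup.one_closed subgroup.m_closed in auto)
    then show ?thesis .
  qed
  ultimately have "\<forall>y\<in>N. y [^] p = \<one>"
    using normal_torsion_and_powers[OF N prime_gt_0_nat[OF p(1)]] by blast
  then show ?thesis using p by blast
qed

definition torsion_free_min where
  "torsion_free_min N \<longleftrightarrow> abelian_min N \<and> (\<forall>x\<in>N. \<forall>k::nat. 0 < k \<and> x [^] k = \<one> \<longrightarrow> x = \<one>)"

lemma torsion_free_min_divisible:
  assumes N: "torsion_free_min N" and x: "x \<in> N" and q: "q > (0::nat)"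
  shows "\<exists>y\<in>N. y [^] q = x"
proof -
  have ab: "abelian_min N" using N by (simp add: torsion_free_min_def)
  have "N \<noteq> {\<one>}" "\<one> \<in> N" using ab min_normalD by (auto simp: abelian_min_def)
  then have "\<not> (\<forall>x\<in>N. x [^] q = \<one>)" using N q by (auto simp: torsion_free_min_def)
  then have "(\<lambda>x. x [^] q) ` N = N" using normal_torsion_and_powers[OF ab q] by blast
  then show ?thesis using x by (metis imageE)
qed

lemma abelian_min_cases:
  assumes M: "minimal_normal_subgroup G N" and c: "comm_group (G\<lparr>carrier := N\<rparr>)"
  shows "abelian_min N" "torsion_group (G\<lparr>carrier := N\<rparr>) \<or> torsion_free_min N"
    "torsion_group (G\<lparr>carrier := N\<rparr>) \<Longrightarrow>
      \<exists>p. normalization_semidom_class.prime (p::nat) \<and> (\<forall>y\<in>N. y [^] p = \<one>)"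
proof -
  have sN: "subgroup N G" using min_normalD(1)[OF M] by (rule normal_imp_subgroup)
  show ab: "abelian_min N" using M c comm_subgroup_iff[OF sN] by (simp add: abelian_min_def)
  have cG: "x \<in> carrier G" if "x \<in> N" for x using subgroup.mem_carrier[OF sN that] .
  have tor: "torsion_group (G\<lparr>carrier := N\<rparr>) \<longleftrightarrow> (\<forall>x\<in>N. ord x \<noteq> 0)"
    using subgroup_imp_group[OF sN] ord_subgroup[OF sN] by (simp add: torsion_group_def)
  show "torsion_group (G\<lparr>carrier := N\<rparr>) \<or> torsion_free_min N"
  proof (rule disjCI)
    assume "\<not> torsion_free_min N"
    then obtain x k where "x \<in> N" "x \<noteq> \<one>" "x [^] (k::nat) = \<one>" "0 < k"
      using ab by (auto simp: torsion_free_min_def)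
    then obtain p where p: "normalization_semidom_class.prime (p::nat)" "\<forall>y\<in>N. y [^] p = \<one>"
      using abelian_min_torsion[OF ab] by blast
    have "ord x \<noteq> 0" if "x \<in> N" for x
      using p(2) that pow_eq_id[OF cG[OF that], of p] prime_gt_0_nat[OF p(1)] by auto
    then show "torsion_group (G\<lparr>carrier := N\<rparr>)" using tor by blast
  qed
  assume "torsion_group (G\<lparr>carrier := N\<rparr>)"
  then have o: "ord x > 0" if "x \<in> N" for x using tor that by auto
  obtain x where x: "x \<in> N" "x \<noteq> \<one>" using min_normalD(2,5)[OF M] by blast
  then show "\<exists>p. normalization_semidom_class.prime (p::nat) \<and> (\<forall>y\<in>N. y [^] p = \<one>)"
    using abelian_min_torsion[OF ab x, of "ord x"] o cG by simp
qed

lemma abelian_min_commute: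
  assumes "abelian_min N" "abelian_min N'" "x \<in> N" "y \<in> N'"
  shows "x \<otimes> y = y \<otimes> x"
proof (cases "N = N'")
  case False
  then show ?thesis
    using normal_imp_commuting[of N N' x y] assms min_normal_disjoint[of N N'] min_normalD(1)
    by (auto simp: abelian_min_def)
qed (use assms in \<open>auto simp: abelian_min_def\<close>)

lemma generate_abelian_min_commute:
  assumes \<N>: "\<And>N. N \<in> \<N> \<Longrightarrow> abelian_min N"
    and xy: "x \<in> generate G (\<Union>\<N>)" "y \<in> generate G (\<Union>\<N>)"
  shows "x \<otimes> y = y \<otimes> x"
proof (rule generate_commute[OF _ _ _ xy])
  show "\<Union>\<N> \<subseteq> carrier G" using \<N> min_normalD(4) unfolding abelian_min_def by blast
  then show "\<Union>\<N> \<subseteq> carrier G" .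
qed (use \<N> abelian_min_commute in blast)

text \<open>The factors can be added one at a time: a minimal normal subgroup is contained in the product
  of the previous ones or meets it trivially, and a direct product of torsion-free groups is
  torsion-free.\<close>

lemma generate_torsion_free:
  assumes \<N>: "\<And>N. N \<in> \<N> \<Longrightarrow> torsion_free_min N"
    and x: "x \<in> generate G (\<Union>\<N>)" "x [^] (k::nat) = \<one>" "k > 0"
  shows "x = \<one>"
proof -
  obtain \<F> where \<F>: "finite \<F>" "\<F> \<subseteq> \<N>" "x \<in> generate G (\<Union>\<F>)"
    using generate_Union_finite_support[OF x(1)] by blast
  then show ?thesis using x(2)
  proof (induction \<F> arbitrary: x rule: finite_induct)
    case empty
    then show ?case using generate_empty by auto
  next
    case (insert N \<F>)
    let ?P = "generate G (\<Union>\<F>)"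
    have ab: "abelian_min M" if "M \<in> insert N \<F>" for M
      using that insert.prems(1) \<N> by (auto simp: torsion_free_min_def)
    have N: "minimal_normal_subgroup G N" using ab by (simp add: abelian_min_def)
    have sub: "\<Union>\<F> \<subseteq> carrier G" using ab min_normalD(4) unfolding abelian_min_def by blast
    have P: "?P \<lhd> G" by (rule generate_Union_normal) (use ab min_normalD(1) in \<open>auto simp: abelian_min_def\<close>)
    have IH: "z = \<one>" if "z \<in> ?P" "z [^] k = \<one>" for z using insert that by auto
    have "x \<in> generate G (\<Union>\<F> \<union> N)" using insert.prems(2) by (simp add: Un_commute)
    then have "x \<in> ?P <#> N"
      using generate_Un_subset_set_mult[OF min_normalD(1)[OF N] P sub] by blast
    then obtain p n where pn: "p \<in> ?P" "n \<in> N" "x = p \<otimes> n" by (auto simp: set_mult_def)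
    have c: "p \<in> carrier G" "n \<in> carrier G"
      using pn normal_mem_carrier[OF P] min_normalD(4)[OF N] by auto
    show ?case
    proof (cases "N \<subseteq> ?P")
      case True
      then have "x \<in> ?P" using pn subgroup.m_closed[OF normal_imp_subgroup[OF P]] by blast
      then show ?thesis using IH insert.prems(3) by blast
    next
      case False
      then have disj: "?P \<inter> N = {\<one>}" using min_normal_inter[OF N P] by blast
      have com: "p \<otimes> n = n \<otimes> p"
        by (rule generate_abelian_min_commute[of "insert N \<F>"])
          (use ab pn generate.incl[of n "\<Union>(insert N \<F>)" G] mono_generate[of "\<Union>\<F>" "\<Union>(insert N \<F>)"] in auto)
      have eq: "p [^] k \<otimes> n [^] k = \<one>" using insert.prems(3) pn pow_mult_distrib[OF com c] by simp
      have sP: "subgroup ?P G" and sN: "subgroup N G"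
        using normal_imp_subgroup P min_normalD(1)[OF N] by blast+
      have pk: "p [^] j \<in> ?P" "n [^] j \<in> N" for j :: nat
        by (induction j) (use pn sP sN subgroup.one_closed subgroup.m_closed in auto)
      have "p [^] k = inv (n [^] k)" using eq c by (metis inv_equality nat_pow_closed)
      then have "p [^] k \<in> N" using subgroup.m_inv_closed[OF sN pk(2)] by simp
      then have "p [^] k \<in> ?P \<inter> N" using pk(1) by blast
      then have pk1: "p [^] k = \<one>" using disj by blast
      then have "n [^] k = \<one>" using eq c by simp
      then have "n = \<one>" using \<N> insert.prems(1) pn(2) x(3) by (auto simp: torsion_free_min_def)
      moreover have "p = \<one>" using IH pn pk1 by blast
      ultimately show ?thesis using pn by simp
    qed
  qed
qed

end

section \<open>Nonabelian minimal normal subgroups\<close>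

context group_field
begin

lemma nat_pow_mem: "\<lbrakk>subgroup H G; x \<in> H\<rbrakk> \<Longrightarrow> x [^] (k::nat) \<in> H"
  by (induction k) (auto simp: subgroup.one_closed subgroup.m_closed)

lemma prime_nonzero_in_field:
  assumes q: "normalization_semidom_class.prime q" "ring_char K \<noteq> q"
  shows "[q] \<cdot>\<^bsub>K\<^esub> \<one>\<^bsub>K\<^esub> \<noteq> \<zero>\<^bsub>K\<^esub>"
proof
  assume "[q] \<cdot>\<^bsub>K\<^esub> \<one>\<^bsub>K\<^esub> = \<zero>\<^bsub>K\<^esub>"
  then have "ring_char K dvd q"
    unfolding ring_char_def using K.add.pow_eq_id[of "\<one>\<^bsub>K\<^esub>" q] by (simp add: add_pow_def)
  then have "ring_char K = 1" using q by (auto simp: prime_nat_iff)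
  then have "\<one>\<^bsub>K\<^esub> = \<zero>\<^bsub>K\<^esub>"
    unfolding ring_char_def using K.add.ord_eq_1[of "\<one>\<^bsub>K\<^esub>"] by simp
  then show False by simp
qed

text \<open>The indicator function of \<open>\<langle>x\<^sup>l\<rangle>\<close> has period \<open>x\<^sup>l\<close> and vanishes at \<open>x\<inverse>\<close>.\<close>

lemma solvable_geom:
  assumes x: "x \<in> carrier G" "x \<notin> generate G {x [^] l}" and H: "subgroup H G" "x \<in> H"
  shows "solvable_on K G H {geom K G x l}"
proof -
  let ?C = "generate G {x [^] l}"
  have C: "subgroup ?C G" using generate_is_subgroup[of "{x [^] l}"] x(1) by simp
  define \<phi> where "\<phi> g = (if g \<in> ?C then \<one>\<^bsub>K\<^esub> else \<zero>\<^bsub>K\<^esub>)" for g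
  have "solves K G {} \<phi>" by (auto simp: solves_def \<phi>_def)
  moreover have "\<phi> (g \<otimes> x [^] l) = \<phi> g" if "g \<in> carrier G" for g
    using subgroup_mult_mem_iff[OF C generate.incl[of "x [^] l"] that] by (simp add: \<phi>_def)
  ultimately have s: "solves K G (insert (geom K G x l) {}) (\<lambda>g. \<phi> g \<ominus>\<^bsub>K\<^esub> \<phi> (g \<otimes> inv x))"
    by (intro solves_add_geom[of "{}" \<phi> "{}" x l]) (use x in auto)
  show ?thesis
  proof (rule solvable_onI[OF s H(1) _ one_closed])
    show "{geom K G x l} \<subseteq> combs K H" using geom_in_combs[OF H] by simp
    have "inv x \<notin> ?C" using x subgroup.m_inv_closed[OF C, of "inv x"] by auto
    then show "\<phi> \<one> \<ominus>\<^bsub>K\<^esub> \<phi> (\<one> \<otimes> inv x) \<noteq> \<zero>\<^bsub>K\<^esub>"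
      using x subgroup.one_closed[OF C] by (simp add: \<phi>_def K.minus_eq)
  qed
qed

lemma prime_or_infinite_order_not_generated:
  assumes x: "x \<in> carrier G" and l: "normalization_semidom_class.prime (l::nat)" "ord x = 0 \<or> ord x = l"
  shows "x \<notin> generate G {x [^] l}"
proof
  assume "x \<in> generate G {x [^] l}"
  then obtain k :: int where "x = (x [^] l) [^] k" using generate_pow[of "x [^] l"] x by auto
  then have "x [^] (int l * k) = x [^] (1::int)" using x by (simp add: int_pow_pow int_pow_int[symmetric])
  then have "x [^] (int l * k - 1) = \<one>" using x by (simp add: int_pow_diff r_inv)
  then have d: "int (ord x) dvd int l * k - 1" using int_pow_eq_id[OF x] by blast
  have "\<not> int l dvd 1" using prime_gt_1_nat[OF l(1)] by auto
  then have "\<not> int l dvd int l * k - 1" by (metis dvd_diff_right_iff dvd_triv_left)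
  moreover have "int l * k \<noteq> 1" using \<open>\<not> int l dvd 1\<close> by (metis dvd_triv_left)
  ultimately show False using d l(2) by auto
qed

lemma solvable_on_subgroup:
  assumes M: "subgroup M G" and E: "E \<subseteq> combs K M"
    and s: "solvable_on K (G\<lparr>carrier := M\<rparr>) M E"
  shows "solvable_on K G M E"
proof -
  obtain \<phi> where \<phi>: "solves K (G\<lparr>carrier := M\<rparr>) E \<phi>" "\<phi> \<one> = \<one>\<^bsub>K\<^esub>"
    using s by (auto simp: solvable_on_def)
  let ?\<phi> = "\<lambda>g. if g \<in> M then \<phi> g else \<zero>\<^bsub>K\<^esub>"
  have "comb_eval K G e ?\<phi> g = \<zero>\<^bsub>K\<^esub>" if e: "e \<in> E" and g: "g \<in> carrier G" for e g
  proof (cases "g \<in> M")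
    case True
    have "comb_eval K G e ?\<phi> g = comb_eval K G e \<phi> g"
      by (rule comb_eval_cong[OF subsetD[OF E e]]) (use True subgroup.m_closed[OF M] in auto)
    moreover have "comb_eval K (G\<lparr>carrier := M\<rparr>) e \<phi> g = comb_eval K G e \<phi> g"
      by (simp add: comb_eval_def)
    ultimately show ?thesis using \<phi>(1) e True by (simp add: solves_def)
  next
    case False
    then show ?thesis
      by (intro comb_eval_eq_0[OF subsetD[OF E e]]) (use g in \<open>auto simp: subgroup_mult_mem_iff[OF M]\<close>)
  qed
  then have "solves K G E ?\<phi>" using \<phi>(1) by (auto simp: solves_def)
  then show ?thesis
    unfolding solvable_on_def using \<phi>(2) subgroup.one_closed[OF M] by (intro exI[of _ ?\<phi>]) auto
qed

lemma min_normal_perfect: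
  assumes M: "minimal_normal_subgroup G M" and nc: "\<not> comm_group (G\<lparr>carrier := M\<rparr>)"
  shows "derived (G\<lparr>carrier := M\<rparr>) M = M"
proof -
  note nM = min_normalD[OF M]
  have sM: "subgroup M G" by (rule normal_imp_subgroup[OF nM(1)])
  have "derived G M = M"
  proof (rule ccontr)
    assume "derived G M \<noteq> M"
    then have triv: "derived G M = {\<one>}"
      using nM(3)[OF derived_is_normal[OF nM(1)] derived_incl[OF order_refl sM]] by blast
    have "x \<otimes> y = y \<otimes> x" if xy: "x \<in> M" "y \<in> M" for x y
    proof -
      have c: "x \<in> carrier G" "y \<in> carrier G" using xy nM(4) by auto
      have "x \<otimes> y \<otimes> inv x \<otimes> inv y \<in> derived G M"
        unfolding derived_def using xy by (intro generate.incl) blast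
      then have "x \<otimes> y \<otimes> inv x \<otimes> inv y = \<one>" using triv by blast
      then have "x \<otimes> y \<otimes> inv x = y" using c by (metis inv_equality inv_inv inv_closed m_closed)
      then show ?thesis using c by (metis inv_solve_right m_closed)
    qed
    then show False using nc comm_subgroup_iff[OF sM] by blast
  qed
  then show ?thesis using derived_consistent[OF _ sM, of M] by simp
qed

text \<open>If \<open>M\<close> contains an element \<open>x\<close> of infinite order, or of prime order different from the
  characteristic, then \<open>1 + x + \<dots> + x\<^sup>l\<^sup>-\<^sup>1\<close> has nonzero augmentation \<open>l\<close> for a suitable prime \<open>l\<close>. It is a zero
  divisor or, if \<open>x\<close> has infinite order, a nonunit. Otherwise the characteristic is a prime \<open>p\<close> and \<open>M\<close>
  is a \<open>p\<close>-group. If it is finitely generated, it has an irreducible representation that is not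
  trivial because it is perfect; if not, the hypothesis supplies such a representation.\<close>

lemma nonabelian_min_normal_solvable:
  assumes M: "minimal_normal_subgroup G M" and nc: "\<not> comm_group (G\<lparr>carrier := M\<rparr>)"
    and hyp: "\<lbrakk>normalization_semidom_class.prime (ring_char K);
           p_group (ring_char K) (G\<lparr>carrier := M\<rparr>);
           \<not> finitely_generated_group (G\<lparr>carrier := M\<rparr>)\<rbrakk>
         \<Longrightarrow> \<exists>(V :: ('k, 'v) module) \<rho>.
               irreducible_representation K (G\<lparr>carrier := M\<rparr>) V \<rho> \<and>
               nontrivial_representation K (G\<lparr>carrier := M\<rparr>) V \<rho>"
  shows "\<exists>e \<in> combs K M. aug K e \<noteq> \<zero>\<^bsub>K\<^esub> \<and> solvable_on K G M {e}"
proof -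
  let ?M = "G\<lparr>carrier := M\<rparr>"
  note nM = min_normalD[OF M]
  have sM: "subgroup M G" by (rule normal_imp_subgroup[OF nM(1)])
  have gM: "group ?M" by (rule subgroup_imp_group[OF sM])
  interpret M: group_field ?M K by (simp add: group_field_def gM K.field_axioms)
  have cM: "x \<in> carrier G" if "x \<in> M" for x using that nM(4) by blast
  have transfer: ?thesis
    if ex: "\<exists>e \<in> combs K M. aug K e = \<one>\<^bsub>K\<^esub> \<and> solvable_on K ?M M {e}"
  proof -
    obtain e where e: "e \<in> combs K M" "aug K e = \<one>\<^bsub>K\<^esub>" "solvable_on K ?M M {e}" using ex by blast
    then show ?thesis using solvable_on_subgroup[OF sM _ e(3)] by (intro bexI[of _ e]) auto
  qed
  show ?thesis
  proof (cases "\<exists>x\<in>M. \<exists>l. normalization_semidom_class.prime l \<and> ring_char K \<noteq> l \<and> (ord x = 0 \<or> ord x = l)")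
    case True
    then obtain x l where x: "x \<in> M" "normalization_semidom_class.prime l" "ring_char K \<noteq> l"
      "ord x = 0 \<or> ord x = l" by blast
    have "solvable_on K G M {geom K G x l}"
      by (rule solvable_geom[OF _ prime_or_infinite_order_not_generated sM x(1)]) (use x cM in auto)
    then show ?thesis
      using geom_in_combs[OF sM x(1), of l] prime_nonzero_in_field[OF x(2,3)]
      by (intro bexI[of _ "geom K G x l"]) (auto simp: aug_geom)
  next
    case False
    have no: "ord x \<noteq> 0 \<and> ord x \<noteq> l"
      if "x \<in> M" "normalization_semidom_class.prime l" "ring_char K \<noteq> l" for x l
      using False that by (metis (no_types))
    \<comment> \<open>One of the primes \<open>2\<close> and \<open>3\<close> differs from the characteristic.\<close>
    have fin: "ord x \<noteq> 0" if x: "x \<in> M" for x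
    proof -
      have "ring_char K \<noteq> 2 \<or> ring_char K \<noteq> 3" by auto
      moreover have "normalization_semidom_class.prime (2::nat)" "normalization_semidom_class.prime (3::nat)"
        by simp_all
      ultimately show ?thesis using no[OF x] by metis
    qed
    have q: "q = ring_char K"
      if x: "x \<in> M" and q: "normalization_semidom_class.prime q" "q dvd ord x" for x q
    proof (rule ccontr)
      assume neq: "q \<noteq> ring_char K"
      let ?y = "x [^] (ord x div q)"
      have "ord x div q \<noteq> 0" using q fin[OF x] by (simp add: dvd_div_eq_0_iff)
      then have "ord ?y = ord x div (ord x div q)"
        using ord_pow[OF cM[OF x], of "ord x div q"] q by (simp add: div_dvd_iff_mult)
      also have "\<dots> = q"
      proof -
        obtain k where "ord x = q * k" using q by blast
        then show ?thesis using fin[OF x] by simp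
      qed
      finally show False using no[OF nat_pow_mem[OF sM x] q(1)] neq by metis
    qed
    obtain x where x: "x \<in> M" "x \<noteq> \<one>" using nM(2,5) by blast
    then have "ord x \<noteq> 1" using ord_eq_1 cM by blast
    then obtain q0 where "normalization_semidom_class.prime q0" "q0 dvd ord x" using prime_factor_nat by blast
    then have p: "normalization_semidom_class.prime (ring_char K)" using q x by blast
    have "\<exists>k. ord x = ring_char K ^ k" if x: "x \<in> M" for x
    proof -
      have "ord x = (\<Prod>r\<in>prime_factors (ord x). r ^ multiplicity r (ord x))"
        using fin[OF x] by (simp add: prime_factorization_nat)
      moreover have "prime_factors (ord x) \<subseteq> {ring_char K}"
        using q[OF x] fin[OF x] by (auto simp: prime_factors_dvd)
      then have "prime_factors (ord x) = {} \<or> prime_factors (ord x) = {ring_char K}" by blast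
      ultimately show ?thesis
        by (elim disjE) (metis power_0 prod.empty, metis finite.emptyI empty_iff prod.insert prod.empty mult.right_neutral)
    qed
    then have "p_group (ring_char K) ?M" using ord_subgroup[OF sM] gM by (simp add: p_group_def)
    note hyp' = hyp[OF p this]
    show ?thesis
    proof (cases "finitely_generated_group ?M")
      case True
      show ?thesis
        by (rule transfer) (use M.perfect_finitely_generated_imp_solvable[OF True] min_normal_perfect[OF M nc] nM(2) in simp)
    next
      case False
      then obtain V :: "('k, 'v) module" and \<rho> where "irreducible_representation K ?M V \<rho>"
        "nontrivial_representation K ?M V \<rho>" using hyp' by blast
      then show ?thesis by (intro transfer) (use M.nontrivial_irreducible_imp_solvable in simp)
    qed
  qed
qed

end

section \<open>Torsion abelian minimal normal subgroups\<close>

text \<open>The subgroup generated by \<open>x\<close> and \<open>y\<close> is cyclic of order \<open>p\<close>, so it is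
  generated by \<open>x\<close> alone.\<close>

lemma (in comm_group) locally_cyclic_prime_exponent:
  assumes lc: "locally_cyclic_group G" and p: "normalization_semidom_class.prime (p::nat)"
    and xy: "x \<in> carrier G" "y \<in> carrier G" "x [^] p = \<one>" "y [^] p = \<one>" "x \<noteq> \<one>"
  shows "\<exists>j::int. y = x [^] j"
proof -
  let ?D = "generate G {x, y}"
  have D: "subgroup ?D G" by (rule generate_is_subgroup) (use xy in auto)
  interpret D: group "G\<lparr>carrier := ?D\<rparr>" by (rule subgroup_imp_group[OF D])
  have xyD: "x \<in> ?D" "y \<in> ?D" by (auto intro: generate.incl)
  have "finitely_generated_group (G\<lparr>carrier := ?D\<rparr>)"
    unfolding finitely_generated_group_def
    using D.is_group generate_consistent[OF _ D, of "{x, y}"] xyD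
    by (intro conjI exI[of _ "{x, y}"]) auto
  then have "cyclic_group (G\<lparr>carrier := ?D\<rparr>)"
    using lc D by (simp add: locally_cyclic_group_def)
  then obtain d where d: "d \<in> ?D" "?D = range (\<lambda>n::int. d [^]\<^bsub>G\<lparr>carrier := ?D\<rparr>\<^esub> n)"
    using D.cyclic_group by auto
  then have Dr: "?D = range (\<lambda>n::int. d [^] n)" using int_pow_consistent[OF D d(1)] by simp
  have dG: "d \<in> carrier G" using subgroup.mem_carrier[OF D d(1)] .
  have "subgroup {z \<in> carrier G. z [^] p = \<one>} G"
    by (rule subgroupI) (auto simp: nat_pow_inv nat_pow_distrib intro!: exI[of _ \<one>])
  then have "?D \<subseteq> {z \<in> carrier G. z [^] p = \<one>}" by (intro generate_subgroup_incl) (use xy in auto)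
  then have dp: "d [^] p = \<one>" using d by auto
  obtain a b :: int where ab: "x = d [^] b" "y = d [^] a" using xyD Dr by blast
  have "\<not> int p dvd b"
  proof
    assume "int p dvd b"
    then obtain k where "b = int p * k" by blast
    then have "x = (d [^] p) [^] k" using ab dG by (simp add: int_pow_pow int_pow_int[symmetric])
    then show False using dp xy(5) by simp
  qed
  then have "coprime (int p) b" using p by (intro prime_imp_coprime) auto
  then obtain u v where uv: "u * int p + v * b = 1"
    by (metis bezout_int coprime_imp_gcd_eq_1)
  have "d = d [^] (u * int p + v * b)" using uv dG by simp
  also have "\<dots> = (d [^] p) [^] u \<otimes> (d [^] b) [^] v"
    using dG by (simp add: int_pow_mult int_pow_pow int_pow_int[symmetric] mult.commute)
  finally have "d = x [^] v" using dp dG ab by simp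
  then have "y = x [^] (v * a)" using ab(2) xy(1) by (simp add: int_pow_pow)
  then show ?thesis by blast
qed

lemma (in group) locally_cyclic_quotient_power:
  assumes T: "subgroup T G" and comm: "\<And>x y. \<lbrakk>x \<in> T; y \<in> T\<rbrakk> \<Longrightarrow> x \<otimes> y = y \<otimes> x"
    and S: "subgroup S (G\<lparr>carrier := T\<rparr>)"
    and lc: "locally_cyclic_group ((G\<lparr>carrier := T\<rparr>) Mod S)"
    and p: "normalization_semidom_class.prime (p::nat)"
    and n: "n \<in> T" "n [^] p = \<one>" "n \<notin> S" and c: "c \<in> T" "c [^] p = \<one>"
  shows "\<exists>j::int. \<exists>s\<in>S. n [^] j = c \<otimes> s"
proof -
  let ?T = "G\<lparr>carrier := T\<rparr>"
  interpret T: comm_group ?T using comm_subgroup_iff[OF T] comm by blast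
  have nS: "S \<lhd> ?T" using T.normal_iff_subgroup S by blast
  interpret Q: comm_group "?T Mod S" by (rule T.abelian_FactGroup[OF S])
  let ?h = "\<lambda>a. S #>\<^bsub>?T\<^esub> a"
  have h: "?h \<in> hom ?T (?T Mod S)" by (rule normal.r_coset_hom_Mod[OF nS])
  have hc: "?h x \<in> carrier (?T Mod S)" if "x \<in> T" for x using hom_in_carrier[OF h] that by simp
  have hp: "?h x [^]\<^bsub>?T Mod S\<^esub> p = \<one>\<^bsub>?T Mod S\<^esub>" if "x \<in> T" "x [^] p = \<one>" for x
  proof -
    have "x [^]\<^bsub>?T\<^esub> p = \<one>\<^bsub>?T\<^esub>" using that by (simp add: nat_pow_consistent[symmetric])
    then show ?thesis
      using hom_nat_pow[OF h _ T.is_group Q.is_group, of x p] hom_one[OF h T.is_group Q.is_group] that by simp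
  qed
  have self: "x \<in> ?h x" if "x \<in> T" for x using T.rcos_self[OF _ S] that by simp
  have "?h n \<noteq> \<one>\<^bsub>?T Mod S\<^esub>" using self[OF n(1)] n(3) by auto
  then obtain j :: int where "?h c = ?h n [^]\<^bsub>?T Mod S\<^esub> j"
    using Q.locally_cyclic_prime_exponent[OF lc p hc[OF n(1)] hc[OF c(1)] hp[OF n(1,2)] hp[OF c]] by blast
  then have "?h c = ?h (n [^] j)"
    using hom_int_pow[OF h _ T.is_group Q.is_group, of n j] n(1) int_pow_consistent[OF T n(1)] by simp
  moreover have nT: "n [^] j \<in> T" using subgroup_int_pow_closed[OF T n(1)] .
  ultimately have "n [^] j \<in> ?h c" using self by metis
  then obtain s where s: "s \<in> S" "n [^] j = s \<otimes> c" by (auto simp: r_coset_def)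
  have "s \<in> T" using s(1) subgroup.subset[OF S] by auto
  then have "n [^] j = c \<otimes> s" using s comm c by simp
  then show ?thesis using s(1) by blast
qed

context group_field
begin

text \<open>The solution is the product of the indicator function of \<open>S\<close> with the elements \<open>1 - c\<^sub>p\<inverse>\<close>, taken one
  prime at a time. The support stays within the elements whose order modulo \<open>S\<close> divides the product
  of the primes used so far. Hence the function vanishes at the inverse of the next \<open>c\<^sub>p\<close>, whose order
  modulo \<open>S\<close> is the new prime, and the value at \<open>1\<close> does not change.\<close>

lemma solvable_prime_family:
  assumes T: "subgroup T G" and comm: "\<And>x y. \<lbrakk>x \<in> T; y \<in> T\<rbrakk> \<Longrightarrow> x \<otimes> y = y \<otimes> x"
    and S: "subgroup S G" "S \<subseteq> T"
    and c: "\<And>p. p \<in> P \<Longrightarrow> normalization_semidom_class.prime p \<and> c p \<in> T \<and> c p [^] p = \<one> \<and> c p \<notin> S"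
    and Q: "finite Q" "Q \<subseteq> P"
  shows "\<exists>\<phi>. solves K G ((\<lambda>p. geom K G (c p) p) ` Q) \<phi> \<and> \<phi> \<one> = \<one>\<^bsub>K\<^esub> \<and>
    (\<forall>g\<in>carrier G. \<forall>s\<in>S. \<phi> (g \<otimes> s) = \<phi> g) \<and>
    (\<forall>g\<in>carrier G. \<phi> g \<noteq> \<zero>\<^bsub>K\<^esub> \<longrightarrow> g \<in> T \<and> g [^] (\<Prod>Q) \<in> S)"
  using Q
proof (induction Q rule: finite_induct)
  case empty
  show ?case
    by (rule exI[of _ "\<lambda>g. if g \<in> S then \<one>\<^bsub>K\<^esub> else \<zero>\<^bsub>K\<^esub>"])
      (use S subgroup.one_closed[OF S(1)] subgroup_mult_mem_iff[OF S(1)] subgroup.mem_carrier[OF S(1)]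
        in \<open>auto simp: solves_def\<close>)
next
  case (insert p Q)
  then obtain \<phi> where \<phi>: "solves K G ((\<lambda>p. geom K G (c p) p) ` Q) \<phi>" "\<phi> \<one> = \<one>\<^bsub>K\<^esub>"
    "\<And>g s. \<lbrakk>g \<in> carrier G; s \<in> S\<rbrakk> \<Longrightarrow> \<phi> (g \<otimes> s) = \<phi> g"
    "\<And>g. \<lbrakk>g \<in> carrier G; \<phi> g \<noteq> \<zero>\<^bsub>K\<^esub>\<rbrakk> \<Longrightarrow> g \<in> T \<and> g [^] (\<Prod>Q) \<in> S" by auto
  define n where "n = c p"
  have p: "normalization_semidom_class.prime p" "n \<in> T" "n [^] p = \<one>" "n \<notin> S"
    using c insert.prems by (auto simp: n_def)
  have cT: "x \<in> carrier G" if "x \<in> T" for x using that subgroup.mem_carrier[OF T] by blast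
  have nG: "n \<in> carrier G" using p cT by blast
  let ?\<psi> = "\<lambda>g. \<phi> g \<ominus>\<^bsub>K\<^esub> \<phi> (g \<otimes> inv n)"
  have \<phi>c: "\<phi> g \<in> carrier K" if "g \<in> carrier G" for g using \<phi>(1) that by (auto simp: solves_def)
  have "solves K G (insert (geom K G n p) ((\<lambda>p. geom K G (c p) p) ` Q)) ?\<psi>"
  proof (rule solves_add_geom[OF \<phi>(1)])
    show "((\<lambda>p. geom K G (c p) p) ` Q) \<subseteq> combs K T"
      using geom_in_combs[OF T] c insert.prems by blast
  qed (use cT nG p comm in auto)
  moreover have "insert (geom K G n p) ((\<lambda>p. geom K G (c p) p) ` Q) = ((\<lambda>p. geom K G (c p) p) ` insert p Q)"
    by (simp add: n_def)
  ultimately have s: "solves K G ((\<lambda>p. geom K G (c p) p) ` insert p Q) ?\<psi>" by simp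
  have "\<phi> (inv n) = \<zero>\<^bsub>K\<^esub>"
  proof (rule ccontr)
    assume "\<phi> (inv n) \<noteq> \<zero>\<^bsub>K\<^esub>"
    then have "inv n [^] (\<Prod>Q) \<in> S" using \<phi>(4)[of "inv n"] nG by blast
    then have nS: "n [^] (\<Prod>Q) \<in> S"
      using subgroup.m_inv_closed[OF S(1)] nG by (metis inv_closed inv_inv nat_pow_closed nat_pow_inv)
    have "coprime p (\<Prod>Q)"
      using c insert.prems insert.hyps
      by (intro prod_coprime_right primes_coprime) (auto simp: subset_iff)
    then obtain u v where uv: "u * int p + v * int (\<Prod>Q) = 1"
      by (metis bezout_int coprime_imp_gcd_eq_1 coprime_int_iff)
    have "n = n [^] (u * int p + v * int (\<Prod>Q))" using uv nG by simp
    also have "\<dots> = (n [^] p) [^] u \<otimes> (n [^] (\<Prod>Q)) [^] v"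
      using nG by (simp add: int_pow_mult int_pow_pow int_pow_int[symmetric] mult.commute del: int_prod of_nat_prod)
    finally have "n = (n [^] (\<Prod>Q)) [^] v" using p nG by simp
    then show False using p(4) subgroup_int_pow_closed[OF S(1) nS, of v] by simp
  qed
  then have one: "?\<psi> \<one> = \<one>\<^bsub>K\<^esub>" using \<phi>(2) nG by (simp add: K.minus_eq)
  have inv: "?\<psi> (g \<otimes> s) = ?\<psi> g" if g: "g \<in> carrier G" and s: "s \<in> S" for g s
  proof -
    have sT: "s \<in> T" using s S by blast
    have "g \<otimes> s \<otimes> inv n = (g \<otimes> inv n) \<otimes> s"
      using g sT cT nG comm[OF sT subgroup.m_inv_closed[OF T p(2)]] by (simp add: m_assoc)
    then show ?thesis using \<phi>(3)[OF g s] \<phi>(3)[of "g \<otimes> inv n" s] g s nG by simp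
  qed
  have supp: "g \<in> T \<and> g [^] (\<Prod>(insert p Q)) \<in> S" if g: "g \<in> carrier G" and nz: "?\<psi> g \<noteq> \<zero>\<^bsub>K\<^esub>" for g
  proof -
    have pr: "\<Prod>(insert p Q) = \<Prod>Q * p" using insert.hyps by (simp add: mult.commute)
    have "\<phi> g \<noteq> \<zero>\<^bsub>K\<^esub> \<or> \<phi> (g \<otimes> inv n) \<noteq> \<zero>\<^bsub>K\<^esub>" using nz by (auto simp: K.minus_eq)
    then show ?thesis
    proof
      assume "\<phi> g \<noteq> \<zero>\<^bsub>K\<^esub>"
      then have "g \<in> T" "g [^] (\<Prod>Q) \<in> S" using \<phi>(4)[OF g] by auto
      then show ?thesis using nat_pow_mem[OF S(1), of "g [^] (\<Prod>Q)" p] g by (simp add: pr nat_pow_pow)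
    next
      assume "\<phi> (g \<otimes> inv n) \<noteq> \<zero>\<^bsub>K\<^esub>"
      then have gn: "g \<otimes> inv n \<in> T" "(g \<otimes> inv n) [^] (\<Prod>Q) \<in> S" using \<phi>(4)[of "g \<otimes> inv n"] g nG by auto
      have gT: "g \<in> T" using gn(1) subgroup_mult_mem_iff[OF T subgroup.m_inv_closed[OF T p(2)] g] by simp
      have "((g \<otimes> inv n) [^] (\<Prod>Q)) [^] p \<in> S" by (rule nat_pow_mem[OF S(1) gn(2)])
      also have "((g \<otimes> inv n) [^] (\<Prod>Q)) [^] p = (g \<otimes> inv n) [^] (\<Prod>(insert p Q))"
        using g nG by (simp add: pr nat_pow_pow)
      also have "\<dots> = g [^] (\<Prod>(insert p Q)) \<otimes> inv n [^] (\<Prod>(insert p Q))"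
        using pow_mult_distrib[OF comm[OF gT subgroup.m_inv_closed[OF T p(2)]] g] nG by simp
      also have "inv n [^] (\<Prod>(insert p Q)) = \<one>"
      proof -
        have "inv n [^] (\<Prod>(insert p Q)) = inv ((n [^] p) [^] (\<Prod>Q))"
          using nG by (simp add: pr nat_pow_pow nat_pow_inv mult.commute)
        then show ?thesis using p(3) by simp
      qed
      finally show ?thesis using gT g by simp
    qed
  qed
  show ?case using s one inv supp by (intro exI[of _ ?\<psi>]) blast
qed

text \<open>Since the core of \<open>S\<close> is trivial, no minimal normal subgroup \<open>N\<close> lies in \<open>S\<close>. All those of the
  same exponent \<open>p\<close> have the same image in \<open>T(G)/S\<close>, which is locally cyclic, namely the subgroup of
  order \<open>p\<close>. So each \<open>N\<close> contains an element \<open>n \<in> c\<^sub>p S\<close>, for one \<open>c\<^sub>p\<close> that depends only on \<open>p\<close>, and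
  the equations of all these \<open>n\<close> agree on functions that are invariant under \<open>S\<close>. The augmentation \<open>p\<close>
  of \<open>1 + n + \<dots> + n\<^sup>p\<^sup>-\<^sup>1\<close> is not zero in \<open>K\<close> because \<open>p\<close>
  lies in \<open>\<Pi>(G)\<close>, which does not contain the characteristic.\<close>

lemma solvable_torsion_socle:
  defines "\<T> \<equiv> {N. minimal_normal_subgroup G N \<and> comm_group (G\<lparr>carrier := N\<rparr>) \<and>
      torsion_group (G\<lparr>carrier := N\<rparr>)}"
  assumes char: "ring_char K \<notin> tor_Soc_primes G"
    and S: "subgroup S (G\<lparr>carrier := tor_Soc G\<rparr>)"
      "locally_cyclic_group ((G\<lparr>carrier := tor_Soc G\<rparr>) Mod S)" "normal_core G S = {\<one>}"
  shows "\<exists>E \<subseteq> combs K (tor_Soc G). (\<forall>N\<in>\<T>. detects K G E N) \<and>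
     (\<forall>E0. finite E0 \<and> E0 \<subseteq> E \<longrightarrow> solvable_on K G (tor_Soc G) E0)"
proof -
  let ?T = "tor_Soc G"
  have T_def: "?T = generate G (\<Union>\<T>)" by (simp add: tor_Soc_def \<T>_def)
  have ab: "abelian_min N" "\<exists>p. normalization_semidom_class.prime (p::nat) \<and> (\<forall>y\<in>N. y [^] p = \<one>)"
    if "N \<in> \<T>" for N
    using that abelian_min_cases[of N] by (auto simp: \<T>_def)
  then obtain pr where pr: "\<And>N. N \<in> \<T> \<Longrightarrow> normalization_semidom_class.prime (pr N :: nat) \<and> (\<forall>y\<in>N. y [^] pr N = \<one>)"
    by metis
  have nN: "N \<lhd> G" "N \<subseteq> carrier G" "N \<noteq> {\<one>}" "\<one> \<in> N" if "N \<in> \<T>" for N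
    using ab(1)[OF that] min_normalD[of N] by (auto simp: abelian_min_def)
  have T: "subgroup ?T G"
    unfolding T_def by (rule normal_imp_subgroup[OF generate_Union_normal]) (rule nN(1))
  have comm: "x \<otimes> y = y \<otimes> x" if "x \<in> ?T" "y \<in> ?T" for x y
    using that unfolding T_def by (intro generate_abelian_min_commute[of \<T>] ab(1))
  have NT: "x \<in> ?T" if "N \<in> \<T>" "x \<in> N" for N x
    unfolding T_def using that by (intro generate.incl) blast
  have S': "subgroup S G" "S \<subseteq> ?T"
    using incl_subgroup[OF T S(1)] subgroup.subset[OF S(1)] by auto
  have notS: "\<exists>n\<in>N. n \<notin> S" if N: "N \<in> \<T>" for N
  proof (rule ccontr)
    assume "\<not> (\<exists>n\<in>N. n \<notin> S)"
    then have NS: "N \<subseteq> S" by blast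
    have "n \<in> normal_core G S" if n: "n \<in> N" for n
      unfolding normal_core_def
    proof
      fix g assume g: "g \<in> carrier G"
      have nG: "n \<in> carrier G" using nN(2)[OF N] n by blast
      have "inv g \<otimes> n \<otimes> g \<in> S" using normal_conj[OF nN(1)[OF N], of "inv g" n] n g NS by auto
      moreover have "n = (g \<otimes> (inv g \<otimes> n \<otimes> g)) \<otimes> inv g"
      proof -
        have "(g \<otimes> (inv g \<otimes> n \<otimes> g)) \<otimes> inv g = (g \<otimes> inv g) \<otimes> n \<otimes> (g \<otimes> inv g)"
          using g nG by (simp only: m_assoc m_closed inv_closed)
        then show ?thesis using g nG by simp
      qed
      ultimately show "n \<in> g <# S #> inv g" unfolding l_coset_def r_coset_def by blast
    qed
    then show False using S(3) nN(3,4)[OF N] by blast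
  qed
  define P where "P = pr ` \<T>"
  have "\<exists>c. c \<in> ?T \<and> c [^] p = \<one> \<and> c \<notin> S" if pP: "p \<in> P" for p
  proof -
    obtain N where N: "N \<in> \<T>" "p = pr N" using pP by (auto simp: P_def)
    then show ?thesis using notS[OF N(1)] pr[OF N(1)] NT[OF N(1)] by blast
  qed
  then obtain c where c: "\<And>p. p \<in> P \<Longrightarrow> c p \<in> ?T \<and> c p [^] p = \<one> \<and> c p \<notin> S" by metis
  have Pp: "normalization_semidom_class.prime p" if "p \<in> P" for p using that pr by (auto simp: P_def)
  have "\<exists>n\<in>N. \<exists>s\<in>S. n = c (pr N) \<otimes> s" if N: "N \<in> \<T>" for N
  proof -
    obtain n where n: "n \<in> N" "n \<notin> S" using notS[OF N] by blast
    have p: "pr N \<in> P" using N by (simp add: P_def)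
    then obtain j :: int and s where "s \<in> S" "n [^] j = c (pr N) \<otimes> s"
      using locally_cyclic_quotient_power[OF T comm S(1,2) Pp[OF p] NT[OF N n(1)] _ n(2)]
        c[OF p] pr[OF N] n(1) by blast
    moreover have "n [^] j \<in> N" by (rule subgroup_int_pow_closed[OF normal_imp_subgroup[OF nN(1)[OF N]] n(1)])
    ultimately show ?thesis by blast
  qed
  then obtain n s where n: "\<And>N. N \<in> \<T> \<Longrightarrow> n N \<in> N \<and> s N \<in> S \<and> n N = c (pr N) \<otimes> s N" by metis
  define E where "E = (\<lambda>N. geom K G (n N) (pr N)) ` \<T>"
  have "E \<subseteq> combs K ?T" unfolding E_def using geom_in_combs[OF T] NT n by blast
  moreover have "detects K G E N" if N: "N \<in> \<T>" for N
  proof (rule detects_mono)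
    have e: "geom K G (n N) (pr N) \<in> combs K N"
      by (rule geom_in_combs[OF normal_imp_subgroup[OF nN(1)[OF N]]]) (use n N in blast)
    have "pr N \<in> tor_Soc_primes G"
    proof -
      obtain x where x: "x \<in> N" "x \<noteq> \<one>" using nN(3,4)[OF N] by blast
      have xG: "x \<in> carrier G" using x nN(2)[OF N] by blast
      have "ord x dvd pr N" using pow_eq_id[OF xG] pr[OF N] x by blast
      moreover have "ord x \<noteq> 1" using ord_eq_1[OF xG] x by blast
      ultimately have "ord x = pr N ^ 1" using pr[OF N] by (auto simp: prime_nat_iff)
      then have "x \<in> tor_Soc_part G (pr N)" using NT[OF N x(1)] unfolding tor_Soc_part_def by blast
      then show ?thesis using x(2) pr[OF N] unfolding tor_Soc_primes_def by blast
    qed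
    then have "ring_char K \<noteq> pr N" using char by metis
    then have "aug K (geom K G (n N) (pr N)) \<noteq> \<zero>\<^bsub>K\<^esub>"
      unfolding aug_geom using prime_nonzero_in_field pr[OF N] by blast
    then show "detects K G {geom K G (n N) (pr N)} N" by (rule detects_aug[OF e nN(2)[OF N]])
    show "{geom K G (n N) (pr N)} \<subseteq> E" using N by (auto simp: E_def)
  qed
  moreover have "solvable_on K G ?T E0" if E0: "finite E0" "E0 \<subseteq> E" for E0
  proof -
    obtain \<T>0 where T0: "finite \<T>0" "\<T>0 \<subseteq> \<T>" "E0 = (\<lambda>N. geom K G (n N) (pr N)) ` \<T>0"
      using finite_subset_image[OF E0[unfolded E_def]] by blast
    define Q where "Q = pr ` \<T>0"
    have Q: "finite Q" "Q \<subseteq> P" using T0 by (auto simp: Q_def P_def)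
    obtain \<phi> where \<phi>: "solves K G ((\<lambda>p. geom K G (c p) p) ` Q) \<phi>" "\<phi> \<one> = \<one>\<^bsub>K\<^esub>"
      "\<forall>g\<in>carrier G. \<forall>s\<in>S. \<phi> (g \<otimes> s) = \<phi> g"
      "\<forall>g\<in>carrier G. \<phi> g \<noteq> \<zero>\<^bsub>K\<^esub> \<longrightarrow> g \<in> ?T \<and> g [^] (\<Prod>Q) \<in> S"
      using solvable_prime_family[OF T comm S' _ Q, of c] Pp c by blast
    have "comb_eval K G (geom K G (n N) (pr N)) \<phi> g = \<zero>\<^bsub>K\<^esub>" if N: "N \<in> \<T>0" and g: "g \<in> carrier G" for N g
    proof -
      have NT0: "N \<in> \<T>" using N T0 by blast
      let ?c = "c (pr N)"
      have cT: "?c \<in> ?T" "s N \<in> ?T" using c[of "pr N"] n[OF NT0] NT0 S'(2) by (auto simp: P_def)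
      have cG: "?c \<in> carrier G" "s N \<in> carrier G" "n N \<in> carrier G"
        using cT subgroup.mem_carrier[OF T] n[OF NT0] nN(2)[OF NT0] by auto
      have eq: "\<phi> (g \<otimes> n N [^] i) = \<phi> (g \<otimes> ?c [^] i)" for i :: nat
      proof -
        have "n N [^] i = ?c [^] i \<otimes> s N [^] i"
          using n[OF NT0] pow_mult_distrib[OF comm[OF cT] cG(1,2)] by simp
        moreover have "s N [^] i \<in> S" using nat_pow_mem[OF S'(1)] n[OF NT0] by blast
        ultimately show ?thesis using \<phi>(3) g cG by (simp add: m_assoc[symmetric])
      qed
      have "comb_eval K G (geom K G (n N) l) \<phi> g = comb_eval K G (geom K G ?c l) \<phi> g" for l
      proof (induction l)
        case (Suc l)
        then show ?case
          using comb_eval_geom_Suc[of \<phi> _ g l] \<phi>(1) cG g eq by (simp add: solves_def)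
      qed (simp add: geom_def)
      then show ?thesis using \<phi>(1) N g by (auto simp: solves_def Q_def)
    qed
    then have "solves K G E0 \<phi>" using \<phi>(1) T0(3) by (auto simp: solves_def)
    then show ?thesis unfolding solvable_on_def using \<phi>(2,4) by blast
  qed
  ultimately show ?thesis by blast
qed

end

section \<open>Generic characters of free abelian groups\<close>

lemma frag_split:
  fixes x :: "'i \<Rightarrow>\<^sub>0 int"
  shows "i \<notin> Poly_Mapping.keys (x - frag_cmul (Poly_Mapping.lookup x i) (frag_of i))"
    and "Poly_Mapping.keys (x - frag_cmul (Poly_Mapping.lookup x i) (frag_of i)) \<subseteq> Poly_Mapping.keys x"
    and "x = (x - frag_cmul (Poly_Mapping.lookup x i) (frag_of i)) + frag_cmul (Poly_Mapping.lookup x i) (frag_of i)"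
proof -
  have l: "Poly_Mapping.lookup (x - frag_cmul (Poly_Mapping.lookup x i) (frag_of i)) j =
      (if j = i then 0 else Poly_Mapping.lookup x j)" for j
    by (simp add: lookup_minus)
  show "i \<notin> Poly_Mapping.keys (x - frag_cmul (Poly_Mapping.lookup x i) (frag_of i))"
    by (simp add: in_keys_iff l)
  show "Poly_Mapping.keys (x - frag_cmul (Poly_Mapping.lookup x i) (frag_of i)) \<subseteq> Poly_Mapping.keys x"
    by (auto simp: in_keys_iff l split: if_splits)
qed simp

context comm_group
begin

lemma free_hom_add:
  assumes "f \<in> hom (free_Abelian_group I) G" "Poly_Mapping.keys a \<subseteq> I" "Poly_Mapping.keys b \<subseteq> I"
  shows "f (a + b) = f a \<otimes> f b"
  using hom_mult[OF assms(1), of a b] assms by simp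

lemma free_hom_diff:
  assumes f: "f \<in> hom (free_Abelian_group I) G" and k: "Poly_Mapping.keys a \<subseteq> I" "Poly_Mapping.keys b \<subseteq> I"
  shows "f (a - b) = f a \<otimes> inv f b"
proof -
  have kd: "Poly_Mapping.keys (a - b) \<subseteq> I" using keys_diff[of a b] k by blast
  have c: "f a \<in> carrier G" "f b \<in> carrier G" "f (a - b) \<in> carrier G"
    using hom_in_carrier[OF f] k kd by auto
  have "f a = f (a - b) \<otimes> f b" using free_hom_add[OF f kd k(2)] by simp
  then show ?thesis using c by (simp add: inv_solve_right)
qed

lemma free_hom_cong:
  assumes f: "f \<in> hom (free_Abelian_group I) G" and h: "h \<in> hom (free_Abelian_group I) G"
    and v: "Poly_Mapping.keys v \<subseteq> J" "J \<subseteq> I" and eq: "\<And>j. j \<in> J \<Longrightarrow> f (frag_of j) = h (frag_of j)"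
  shows "f v = h v"
proof -
  have "Poly_Mapping.keys v \<subseteq> I \<and> f v = h v"
    using v(1)
  proof (induction v rule: frag_induction)
    case zero
    show ?case
      using hom_one[OF f group_free_Abelian_group is_group] hom_one[OF h group_free_Abelian_group is_group]
      by simp
  next
    case (one j)
    then show ?case using eq v(2) by auto
  next
    case (diff a b)
    then have "Poly_Mapping.keys (a - b) \<subseteq> I" using keys_diff[of a b] by blast
    then show ?case using diff free_hom_diff[OF f, of a b] free_hom_diff[OF h, of a b] by simp
  qed
  then show ?thesis by simp
qed

lemma free_hom_split:
  assumes f: "f \<in> hom (free_Abelian_group I) G" and x: "Poly_Mapping.keys x \<subseteq> I" and i: "i \<in> I"
  shows "f x = f (x - frag_cmul (Poly_Mapping.lookup x i) (frag_of i)) \<otimes> f (frag_of i) [^] Poly_Mapping.lookup x i"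
proof -
  let ?a = "Poly_Mapping.lookup x i"
  interpret F: group "free_Abelian_group I" by simp
  have k: "Poly_Mapping.keys (x - frag_cmul ?a (frag_of i)) \<subseteq> I" "Poly_Mapping.keys (frag_cmul ?a (frag_of i)) \<subseteq> I"
    using frag_split(2)[of x i] x keys_cmul[of ?a "frag_of i"] i by auto
  have "f x = f ((x - frag_cmul ?a (frag_of i)) + frag_cmul ?a (frag_of i))" using frag_split(3) by metis
  also have "\<dots> = f (x - frag_cmul ?a (frag_of i)) \<otimes> f (frag_cmul ?a (frag_of i))"
    by (rule free_hom_add[OF f k])
  also have "f (frag_cmul ?a (frag_of i)) = f (frag_of i) [^] ?a"
    using hom_int_pow[OF f _ F.is_group is_group, of "frag_of i" ?a] i by simp
  finally show ?thesis .
qed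

lemma free_hom_update:
  assumes f: "f \<in> hom (free_Abelian_group I) G" and i: "i \<in> I" and t: "t \<in> carrier G"
  obtains f' where "f' \<in> hom (free_Abelian_group I) G" "f' (frag_of i) = t"
    "\<And>v. \<lbrakk>Poly_Mapping.keys v \<subseteq> I; i \<notin> Poly_Mapping.keys v\<rbrakk> \<Longrightarrow> f' v = f v"
proof -
  let ?u = "\<lambda>j. if j = i then t else f (frag_of j)"
  have "?u ` I \<subseteq> carrier G" using hom_in_carrier[OF f] t by auto
  then obtain f' where f': "f' \<in> hom (free_Abelian_group I) G" "\<And>x. x \<in> I \<Longrightarrow> f' (frag_of x) = ?u x"
    by (rule free_Abelian_group_universal) blast
  have "f' v = f v" if "Poly_Mapping.keys v \<subseteq> I" "i \<notin> Poly_Mapping.keys v" for v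
    by (rule free_hom_cong[OF f'(1) f order_refl that(1)]) (use that f'(2) in auto)
  then show thesis using that f' i by simp
qed

end

context field
begin

text \<open>If a field has only \<open>u\<close> nonzero elements, the polynomial \<open>X\<^sup>u\<^sup>+\<^sup>1 - X + 1\<close> takes the value \<open>1\<close>
  everywhere.\<close>

lemma algebraically_closed_infinite:
  assumes "algebraically_closed R"
  shows "infinite (carrier R)"
proof
  assume fin: "finite (carrier R)"
  interpret U: comm_group "units_of R" by (rule units_comm_group)
  define u where "u = order (units_of R)"
  have finU: "finite (carrier (units_of R))"
    using fin by (simp add: units_of_carrier field_Units)
  have u: "u > 0"
    unfolding u_def order_def using finU U.one_closed by (auto simp: card_gt_0_iff)
  have pw: "x [^] Suc u = x" if x: "x \<in> carrier R" for x
  proof (cases "x = \<zero>")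
    case False
    then have xU: "x \<in> carrier (units_of R)" using x by (simp add: units_of_carrier field_Units)
    have "x [^]\<^bsub>units_of R\<^esub> u = x [^] u" by (simp add: units_of_def nat_pow_def)
    then have "x [^] u = \<one>" using U.pow_order_eq_1[OF xU] by (simp add: u_def units_of_one)
    then show ?thesis using x by simp
  qed simp
  define p where "p = \<one> # replicate (u - 1) \<zero> @ [\<ominus> \<one>, \<one>]"
  have p: "p \<in> carrier (poly_ring R)"
    unfolding univ_poly_carrier[symmetric] polynomial_def p_def by auto
  have ev: "eval p x = \<one>" if x: "x \<in> carrier R" for x
  proof -
    have "eval (replicate (u - 1) \<zero> @ [\<ominus> \<one>, \<one>]) x = \<ominus> x \<oplus> \<one>"
      using eval_replicate[of "[\<ominus> \<one>, \<one>]" x "u - 1"] x by (simp add: l_minus)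
    moreover have "length (replicate (u - 1) \<zero> @ [\<ominus> \<one>, \<one>]) = Suc u" using u by simp
    ultimately show ?thesis using x pw[OF x] by (simp add: p_def a_assoc[symmetric] r_neg del: nat_pow_Suc)
  qed
  have "size (roots p) = degree p"
    using algebraically_closed.roots_over_carrier[OF assms p] by (simp add: splitted_def)
  then have "roots p \<noteq> {#}" using u by (auto simp: p_def)
  then obtain x where "x \<in># roots p" by blast
  then have "is_root p x" using roots_mem_iff_is_root[OF p] by blast
  then show False using ev one_not_zero by (auto simp: is_root_def)
qed

text \<open>After negative powers have been moved to the other side, the exceptional \<open>t\<close> are roots of a
  polynomial. It is not zero, since its value at \<open>0\<close> is not zero if \<open>a \<noteq> 0\<close>, and its value at \<open>c\<close> is
  not zero if \<open>a = 0\<close>.\<close>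

lemma finite_exceptional_parameters:
  fixes a b :: int
  assumes \<alpha>: "\<alpha> \<in> Units R" and c: "c \<in> Units R" and ab: "a \<noteq> 0 \<or> b \<noteq> 0"
  shows "finite {t \<in> carrier R. t \<noteq> \<zero> \<and> t \<noteq> c \<and>
    \<alpha> \<otimes> t [^]\<^bsub>units_of R\<^esub> a \<otimes> (c \<ominus> t) [^]\<^bsub>units_of R\<^esub> b = \<one>}"
proof -
  let ?P = "poly_ring R"
  interpret P: cring ?P by (rule univ_poly_is_cring[OF carrier_is_subring])
  interpret U: comm_group "units_of R" by (rule units_comm_group)
  define m1 m2 k1 k2 where m: "m1 = nat a" "m2 = nat (- a)" "k1 = nat b" "k2 = nat (- b)"
  define C where "C = poly_of_const c \<ominus>\<^bsub>?P\<^esub> X"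
  define p where "p = poly_of_const \<alpha> \<otimes>\<^bsub>?P\<^esub> X [^]\<^bsub>?P\<^esub> m1 \<otimes>\<^bsub>?P\<^esub> C [^]\<^bsub>?P\<^esub> k1 \<ominus>\<^bsub>?P\<^esub> X [^]\<^bsub>?P\<^esub> m2 \<otimes>\<^bsub>?P\<^esub> C [^]\<^bsub>?P\<^esub> k2"
  have X: "X \<in> carrier ?P" by (rule var_closed(1)[OF carrier_is_subring])
  have const: "poly_of_const d \<in> carrier ?P" if "d \<in> carrier R" for d
    using ring_hom_memE(1)[OF canonical_embedding_is_hom[OF carrier_is_subring]] that by simp
  have car: "\<alpha> \<in> carrier R" "c \<in> carrier R" "\<alpha> \<noteq> \<zero>" "c \<noteq> \<zero>" using \<alpha> c by (auto simp: field_Units)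
  have C: "C \<in> carrier ?P" unfolding C_def using X const car by simp
  have p: "p \<in> carrier ?P" unfolding p_def using X const car C by simp
  have ev: "eval p t = \<alpha> \<otimes> t [^] m1 \<otimes> (c \<ominus> t) [^] k1 \<ominus> t [^] m2 \<otimes> (c \<ominus> t) [^] k2"
    if t: "t \<in> carrier R" for t
  proof -
    interpret h: ring_hom_cring ?P R "\<lambda>p. eval p t"
      by (rule eval_cring_hom[OF carrier_is_subring t])
    have ec: "eval (poly_of_const d) t = d" if "d \<in> carrier R" for d
      using that t by (simp add: poly_of_const_def)
    have hminus: "eval (u \<ominus>\<^bsub>?P\<^esub> v) t = eval u t \<ominus> eval v t" if "u \<in> carrier ?P" "v \<in> carrier ?P" for u v
      using that by (simp add: a_minus_def)
    have hpow: "eval (u [^]\<^bsub>?P\<^esub> (k::nat)) t = eval u t [^] k" if "u \<in> carrier ?P" for u k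
      using that by (induction k) auto
    have "eval C t = c \<ominus> t" unfolding C_def using hminus[OF const X] ec car eval_var[OF t] by simp
    then show ?thesis
      unfolding p_def using hminus hpow X C const car ec eval_var[OF t] by simp
  qed
  have "p \<noteq> []"
  proof
    assume "p = []"
    then have z: "\<alpha> \<otimes> t [^] m1 \<otimes> (c \<ominus> t) [^] k1 \<ominus> t [^] m2 \<otimes> (c \<ominus> t) [^] k2 = \<zero>" if "t \<in> carrier R" for t
      using ev[OF that] by simp
    have cp: "c [^] k \<noteq> \<zero>" for k :: nat
      using car by (induction k) (auto simp: integral_iff)
    have c0: "c \<ominus> \<zero> = c" using car by (simp add: a_minus_def)
    have z0: "\<zero> [^] (k::nat) = \<zero>" if "k > 0" for k using that by (cases k) auto
    show False
    proof (cases "a = 0")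
      case False
      then consider "m1 > 0" "m2 = 0" | "m1 = 0" "m2 > 0" using m by linarith
      then show False
      proof cases
        case 1
        then show False using z[of \<zero>] cp[of k2] car by (simp add: c0 z0 a_minus_def)
      next
        case 2
        then show False using z[of \<zero>] cp[of k1] car by (simp add: c0 z0 a_minus_def integral_iff)
      qed
    next
      case True
      then have m0: "m1 = 0" "m2 = 0" and "b \<noteq> 0" using m ab by auto
      have cc: "c \<ominus> c = \<zero>" using car by (simp add: a_minus_def r_neg)
      from \<open>b \<noteq> 0\<close> consider "k1 > 0" "k2 = 0" | "k1 = 0" "k2 > 0" using m by linarith
      then show False
      proof cases
        case 1
        then have "\<zero> \<ominus> \<one> = \<zero>" using z[of c] car by (simp add: m0 cc z0)
        then have "\<ominus> \<one> = \<zero>" by (simp add: a_minus_def)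
        then show False using one_not_zero by (metis minus_minus minus_zero one_closed)
      next
        case 2
        then have "\<alpha> \<ominus> \<zero> = \<zero>" using z[of c] car by (simp add: m0 cc z0)
        then show False using car by (simp add: a_minus_def)
      qed
    qed
  qed
  have "{t \<in> carrier R. t \<noteq> \<zero> \<and> t \<noteq> c \<and>
    \<alpha> \<otimes> t [^]\<^bsub>units_of R\<^esub> a \<otimes> (c \<ominus> t) [^]\<^bsub>units_of R\<^esub> b = \<one>} \<subseteq> {t. is_root p t}"
  proof
    fix t assume "t \<in> {t \<in> carrier R. t \<noteq> \<zero> \<and> t \<noteq> c \<and>
      \<alpha> \<otimes> t [^]\<^bsub>units_of R\<^esub> a \<otimes> (c \<ominus> t) [^]\<^bsub>units_of R\<^esub> b = \<one>}"
    then have t: "t \<in> carrier R" "t \<noteq> \<zero>" "t \<noteq> c"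
      and eq: "\<alpha> \<otimes> t [^]\<^bsub>units_of R\<^esub> a \<otimes> (c \<ominus> t) [^]\<^bsub>units_of R\<^esub> b = \<one>" by auto
    define s where "s = c \<ominus> t"
    have s: "s \<in> carrier R" "s \<noteq> \<zero>" using t car by (auto simp: s_def)
    have tU: "t \<in> carrier (units_of R)" and sU: "s \<in> carrier (units_of R)" and \<alpha>U: "\<alpha> \<in> carrier (units_of R)"
      using t s \<alpha> by (auto simp: units_of_carrier field_Units)
    have split: "x [^]\<^bsub>units_of R\<^esub> d \<otimes>\<^bsub>units_of R\<^esub> x [^]\<^bsub>units_of R\<^esub> nat (- d) = x [^]\<^bsub>units_of R\<^esub> nat d"
      if x: "x \<in> carrier (units_of R)" for x and d :: int
    proof -
      have "x [^]\<^bsub>units_of R\<^esub> d \<otimes>\<^bsub>units_of R\<^esub> x [^]\<^bsub>units_of R\<^esub> int (nat (- d)) = x [^]\<^bsub>units_of R\<^esub> (d + int (nat (- d)))"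
        using U.int_pow_mult[OF x] by simp
      also have "d + int (nat (- d)) = int (nat d)" by simp
      finally show ?thesis by (simp only: int_pow_int)
    qed
    have "\<alpha> \<otimes>\<^bsub>units_of R\<^esub> t [^]\<^bsub>units_of R\<^esub> m1 \<otimes>\<^bsub>units_of R\<^esub> s [^]\<^bsub>units_of R\<^esub> k1 =
      \<alpha> \<otimes>\<^bsub>units_of R\<^esub> (t [^]\<^bsub>units_of R\<^esub> a \<otimes>\<^bsub>units_of R\<^esub> t [^]\<^bsub>units_of R\<^esub> m2) \<otimes>\<^bsub>units_of R\<^esub> (s [^]\<^bsub>units_of R\<^esub> b \<otimes>\<^bsub>units_of R\<^esub> s [^]\<^bsub>units_of R\<^esub> k2)"
      unfolding m split[OF tU] split[OF sU] ..
    also have "\<dots> = (\<alpha> \<otimes>\<^bsub>units_of R\<^esub> t [^]\<^bsub>units_of R\<^esub> a \<otimes>\<^bsub>units_of R\<^esub> s [^]\<^bsub>units_of R\<^esub> b) \<otimes>\<^bsub>units_of R\<^esub> (t [^]\<^bsub>units_of R\<^esub> m2 \<otimes>\<^bsub>units_of R\<^esub> s [^]\<^bsub>units_of R\<^esub> k2)"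
      using tU sU \<alpha>U by (simp add: U.m_ac)
    also have "\<alpha> \<otimes>\<^bsub>units_of R\<^esub> t [^]\<^bsub>units_of R\<^esub> a \<otimes>\<^bsub>units_of R\<^esub> s [^]\<^bsub>units_of R\<^esub> b = \<one>\<^bsub>units_of R\<^esub>"
      using eq by (simp add: s_def units_of_mult units_of_one)
    finally have "\<alpha> \<otimes>\<^bsub>units_of R\<^esub> t [^]\<^bsub>units_of R\<^esub> m1 \<otimes>\<^bsub>units_of R\<^esub> s [^]\<^bsub>units_of R\<^esub> k1 = t [^]\<^bsub>units_of R\<^esub> m2 \<otimes>\<^bsub>units_of R\<^esub> s [^]\<^bsub>units_of R\<^esub> k2"
      using tU sU by simp
    then have "\<alpha> \<otimes> t [^] m1 \<otimes> s [^] k1 = t [^] m2 \<otimes> s [^] k2"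
      by (simp add: units_of_mult units_of_def nat_pow_def)
    then have "eval p t = t [^] m2 \<otimes> s [^] k2 \<ominus> t [^] m2 \<otimes> s [^] k2"
      using ev[OF t(1)] unfolding s_def by simp
    then have "eval p t = \<zero>" using t s by (simp add: a_minus_def r_neg)
    then show "t \<in> {t. is_root p t}" using t \<open>p \<noteq> []\<close> by (simp add: is_root_def)
  qed
  then show ?thesis using finite_number_of_roots[OF p] finite_subset by blast
qed

lemma exists_parameter:
  fixes a b :: "'x \<Rightarrow> int"
  assumes inf: "infinite (carrier R)" and c: "c \<in> Units R" and D: "finite D"
    and \<alpha>: "\<And>x. x \<in> D \<Longrightarrow> \<alpha> x \<in> Units R" and ab: "\<And>x. x \<in> D \<Longrightarrow> a x \<noteq> 0 \<or> b x \<noteq> 0"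
  obtains t where "t \<in> Units R" "c \<ominus> t \<in> Units R"
    "\<And>x. x \<in> D \<Longrightarrow> \<alpha> x \<otimes> t [^]\<^bsub>units_of R\<^esub> a x \<otimes> (c \<ominus> t) [^]\<^bsub>units_of R\<^esub> b x \<noteq> \<one>"
proof -
  let ?B = "\<lambda>x. {t \<in> carrier R. t \<noteq> \<zero> \<and> t \<noteq> c \<and>
    \<alpha> x \<otimes> t [^]\<^bsub>units_of R\<^esub> a x \<otimes> (c \<ominus> t) [^]\<^bsub>units_of R\<^esub> b x = \<one>}"
  have "finite (insert \<zero> (insert c (\<Union>x\<in>D. ?B x)))"
    using D finite_exceptional_parameters[OF \<alpha> c ab] by simp
  then obtain t where t: "t \<in> carrier R" "t \<notin> insert \<zero> (insert c (\<Union>x\<in>D. ?B x))"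
    using inf by (meson finite_subset subsetI)
  have "c \<in> carrier R" using c by (simp add: field_Units)
  then have "t \<in> Units R" "c \<ominus> t \<in> Units R" using t by (auto simp: field_Units)
  then show thesis using that t by blast
qed

text \<open>The values on the free generators are chosen one after the other; each choice has to avoid
  finitely many parameters.\<close>

lemma generic_hom_base:
  assumes inf: "infinite (carrier R)" and B: "finite B" "B \<subseteq> I"
    and D: "finite D" "\<And>x. x \<in> D \<Longrightarrow> Poly_Mapping.keys x \<subseteq> B \<and> x \<noteq> 0"
  shows "\<exists>f \<in> hom (free_Abelian_group I) (units_of R). \<forall>x\<in>D. f x \<noteq> \<one>"
  using B D
proof (induction B arbitrary: D rule: finite_induct)
  case empty
  then have "D = {}" by auto
  interpret U: comm_group "units_of R" by (rule units_comm_group)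
  have "(\<lambda>_. \<one>\<^bsub>units_of R\<^esub>) \<in> hom (free_Abelian_group I) (units_of R)" by (rule homI) auto
  then show ?case using \<open>D = {}\<close> by blast
next
  case (insert i B)
  interpret U: comm_group "units_of R" by (rule units_comm_group)
  let ?D = "{x \<in> D. i \<notin> Poly_Mapping.keys x}"
  have "\<exists>f \<in> hom (free_Abelian_group I) (units_of R). \<forall>x\<in>?D. f x \<noteq> \<one>"
    by (rule insert.IH) (use insert.prems in auto)
  then obtain f where f: "f \<in> hom (free_Abelian_group I) (units_of R)" "\<And>x. x \<in> ?D \<Longrightarrow> f x \<noteq> \<one>" by blast
  have i: "i \<in> I" using insert.prems by simp
  let ?r = "\<lambda>x. x - frag_cmul (Poly_Mapping.lookup x i) (frag_of i)"
  have k: "Poly_Mapping.keys x \<subseteq> I" "Poly_Mapping.keys (?r x) \<subseteq> I" if "x \<in> D" for x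
    using that insert.prems frag_split(2)[of x i] by blast+
  obtain t where t: "t \<in> Units R"
    "\<And>x. x \<in> D - ?D \<Longrightarrow> f (?r x) \<otimes> t [^]\<^bsub>units_of R\<^esub> Poly_Mapping.lookup x i \<otimes> (\<one> \<ominus> t) [^]\<^bsub>units_of R\<^esub> (0::int) \<noteq> \<one>"
  proof (rule exists_parameter[OF inf, of \<one> "D - ?D" "\<lambda>x. f (?r x)" "\<lambda>x. Poly_Mapping.lookup x i" "\<lambda>_. 0"])
    fix x assume "x \<in> D - ?D"
    then show "f (?r x) \<in> Units R"
      using hom_in_carrier[OF f(1), of "?r x"] k by (simp add: units_of_carrier)
    show "Poly_Mapping.lookup x i \<noteq> 0 \<or> (0::int) \<noteq> 0" using \<open>x \<in> D - ?D\<close> by (auto simp: in_keys_iff)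
  qed (use insert.prems in auto)
  have tU: "t \<in> carrier (units_of R)" using t(1) by (simp add: units_of_carrier)
  obtain f' where f': "f' \<in> hom (free_Abelian_group I) (units_of R)" "f' (frag_of i) = t"
    "\<And>v. \<lbrakk>Poly_Mapping.keys v \<subseteq> I; i \<notin> Poly_Mapping.keys v\<rbrakk> \<Longrightarrow> f' v = f v"
    by (rule U.free_hom_update[OF f(1) i tU]) blast
  have "f' x \<noteq> \<one>" if x: "x \<in> D" for x
  proof (cases "x \<in> ?D")
    case True
    then show ?thesis using f(2)[OF True] f'(3)[OF k(1)[OF x]] by simp
  next
    case False
    have "f' x = f (?r x) \<otimes>\<^bsub>units_of R\<^esub> t [^]\<^bsub>units_of R\<^esub> Poly_Mapping.lookup x i"
      using U.free_hom_split[OF f'(1) k(1)[OF x] i] f'(2) f'(3)[OF k(2)[OF x] frag_split(1)] by simp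
    moreover have "f (?r x) \<in> carrier (units_of R)" using hom_in_carrier[OF f(1)] k(2)[OF x] by simp
    moreover have "t [^]\<^bsub>units_of R\<^esub> Poly_Mapping.lookup x i \<in> carrier (units_of R)" using tU by simp
    ultimately show ?thesis
      using t(2)[of x] False x by (simp add: units_of_mult units_of_one units_of_carrier Units_closed)
  qed
  then show ?case using f'(1) by blast
qed

text \<open>The levels order the equations \<open>(1 - f w) (f y\<^sub>w + f z\<^sub>w) = 1\<close> in such a way that \<open>y\<^sub>w\<close> and \<open>z\<^sub>w\<close> do not
  occur in the other equations of the same or a lower level. So the last equation can be solved after
  the others: with \<open>c = (1 - f w)\<inverse>\<close>, the value \<open>f y\<^sub>w = t\<close> is a free parameter and \<open>f z\<^sub>w = c - t\<close>. It is
  chosen generically, so that \<open>f\<close> takes the value \<open>1\<close> at none of finitely many prescribed elements;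
  these have to include \<open>w\<close> when the earlier equations are solved. The sum of two
  generators is what provides this freedom: a single generator in the place of \<open>y\<^sub>w\<close> and \<open>z\<^sub>w\<close> would be
  determined by \<open>f w\<close>.\<close>

lemma generic_hom:
  fixes lev :: "'i \<Rightarrow> nat"
  assumes inf: "infinite (carrier R)"
    and yz: "\<And>w. w \<in> W \<Longrightarrow> Poly_Mapping.keys w \<subseteq> I \<and> w \<noteq> 0 \<and> y w \<in> I \<and> z w \<in> I \<and> lev (z w) = lev (y w)"
    and lev: "\<And>w k. \<lbrakk>w \<in> W; k \<in> Poly_Mapping.keys w\<rbrakk> \<Longrightarrow> lev k < lev (y w)"
    and inj: "inj_on y W" "inj_on z W" "\<And>w w'. \<lbrakk>w \<in> W; w' \<in> W\<rbrakk> \<Longrightarrow> y w \<noteq> z w'"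
    and S: "finite S" "S \<subseteq> W"
    and D: "finite D" "\<And>x. x \<in> D \<Longrightarrow> Poly_Mapping.keys x \<subseteq> I \<and> x \<noteq> 0"
  shows "\<exists>f \<in> hom (free_Abelian_group I) (units_of R). (\<forall>x\<in>D. f x \<noteq> \<one>) \<and>
    (\<forall>w\<in>S. (\<one> \<ominus> f w) \<otimes> (f (frag_of (y w)) \<oplus> f (frag_of (z w))) = \<one>)"
  using S D
proof (induction "card S" arbitrary: S D)
  case 0
  then have "S = {}" by simp
  moreover have "\<exists>f \<in> hom (free_Abelian_group I) (units_of R). \<forall>x\<in>D. f x \<noteq> \<one>"
    by (rule generic_hom_base[OF inf, of "\<Union>(Poly_Mapping.keys ` D)"]) (use 0 in auto)
  ultimately show ?case by auto
next
  case (Suc m)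
  interpret U: comm_group "units_of R" by (rule units_comm_group)
  have "S \<noteq> {}" using Suc(2) by auto
  then have "Max (lev ` y ` S) \<in> lev ` y ` S" using Suc.prems(1) by (intro Max_in) auto
  then obtain w where w: "w \<in> S" "lev (y w) = Max (lev ` y ` S)" by auto
  have max: "lev (y v) \<le> lev (y w)" if "v \<in> S" for v using w(2) Suc.prems(1) that by simp
  let ?S = "S - {w}" and ?y = "y w" and ?z = "z w"
  have wW: "w \<in> W" using w Suc.prems by blast
  have yI: "?y \<in> I" "?z \<in> I" and w0: "Poly_Mapping.keys w \<subseteq> I" "w \<noteq> 0" using yz[OF wW] by auto
  have yz': "?y \<noteq> ?z" using inj(3)[OF wW wW] .
  have wk: "?y \<notin> Poly_Mapping.keys w" "?z \<notin> Poly_Mapping.keys w"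
    using lev[OF wW, of ?y] lev[OF wW, of ?z] yz[OF wW] by auto
  let ?D = "insert w {x \<in> D. ?y \<notin> Poly_Mapping.keys x \<and> ?z \<notin> Poly_Mapping.keys x}"
  have "\<exists>f \<in> hom (free_Abelian_group I) (units_of R). (\<forall>x\<in>?D. f x \<noteq> \<one>) \<and>
    (\<forall>w\<in>?S. (\<one> \<ominus> f w) \<otimes> (f (frag_of (y w)) \<oplus> f (frag_of (z w))) = \<one>)"
    by (rule Suc.hyps(1)) (use Suc.hyps(2) Suc.prems w w0 in auto)
  then obtain f where f: "f \<in> hom (free_Abelian_group I) (units_of R)" "\<And>x. x \<in> ?D \<Longrightarrow> f x \<noteq> \<one>"
    "\<And>w. w \<in> ?S \<Longrightarrow> (\<one> \<ominus> f w) \<otimes> (f (frag_of (y w)) \<oplus> f (frag_of (z w))) = \<one>" by blast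
  have fU: "f x \<in> Units R" if "Poly_Mapping.keys x \<subseteq> I" for x
    using hom_in_carrier[OF f(1), of x] that by (simp add: units_of_carrier)
  have "f w \<in> carrier R" "f w \<noteq> \<one>" using fU[OF w0(1)] f(2)[of w] by (auto simp: Units_closed)
  then have dU: "\<one> \<ominus> f w \<in> Units R" by (auto simp: field_Units)
  define c where "c = inv (\<one> \<ominus> f w)"
  have c: "c \<in> Units R" "(\<one> \<ominus> f w) \<otimes> c = \<one>" unfolding c_def using dU by auto
  let ?r = "\<lambda>x. x - frag_cmul (Poly_Mapping.lookup x ?z) (frag_of ?z)"
  let ?rr = "\<lambda>x. ?r x - frag_cmul (Poly_Mapping.lookup (?r x) ?y) (frag_of ?y)"
  have k: "Poly_Mapping.keys (?r x) \<subseteq> I" "Poly_Mapping.keys (?rr x) \<subseteq> I"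
    "?z \<notin> Poly_Mapping.keys (?r x)" "?y \<notin> Poly_Mapping.keys (?rr x)"
    "?z \<notin> Poly_Mapping.keys (?rr x)" if "Poly_Mapping.keys x \<subseteq> I" for x
    using that frag_split(1)[of ?z x] frag_split(1)[of ?y "?r x"] frag_split(2)[of x ?z]
      frag_split(2)[of "?r x" ?y] by blast+
  have ly: "Poly_Mapping.lookup (?r x) ?y = Poly_Mapping.lookup x ?y" for x
    using yz' by (simp add: lookup_minus)
  obtain t where t: "t \<in> Units R" "c \<ominus> t \<in> Units R"
    "\<And>x. x \<in> D - ?D \<Longrightarrow> f (?rr x) \<otimes> t [^]\<^bsub>units_of R\<^esub> Poly_Mapping.lookup x ?y \<otimes>
       (c \<ominus> t) [^]\<^bsub>units_of R\<^esub> Poly_Mapping.lookup x ?z \<noteq> \<one>"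
  proof (rule exists_parameter[OF inf c(1), of "D - ?D" "\<lambda>x. f (?rr x)" "\<lambda>x. Poly_Mapping.lookup x ?y"
        "\<lambda>x. Poly_Mapping.lookup x ?z"])
    show "f (?rr x) \<in> Units R" if "x \<in> D - ?D" for x
      using fU[OF k(2)] Suc.prems that by blast
    show "Poly_Mapping.lookup x ?y \<noteq> 0 \<or> Poly_Mapping.lookup x ?z \<noteq> 0" if "x \<in> D - ?D" for x
      using that by (auto simp: in_keys_iff)
  qed (use Suc.prems in auto)
  have tU: "t \<in> carrier (units_of R)" "c \<ominus> t \<in> carrier (units_of R)" using t by (auto simp: units_of_carrier)
  obtain f1 where f1: "f1 \<in> hom (free_Abelian_group I) (units_of R)" "f1 (frag_of ?y) = t"
    "\<And>v. \<lbrakk>Poly_Mapping.keys v \<subseteq> I; ?y \<notin> Poly_Mapping.keys v\<rbrakk> \<Longrightarrow> f1 v = f v"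
    by (rule U.free_hom_update[OF f(1) yI(1) tU(1)]) blast
  obtain f2 where f2: "f2 \<in> hom (free_Abelian_group I) (units_of R)" "f2 (frag_of ?z) = c \<ominus> t"
    "\<And>v. \<lbrakk>Poly_Mapping.keys v \<subseteq> I; ?z \<notin> Poly_Mapping.keys v\<rbrakk> \<Longrightarrow> f2 v = f1 v"
    by (rule U.free_hom_update[OF f1(1) yI(2) tU(2)]) blast
  have same: "f2 v = f v" if "Poly_Mapping.keys v \<subseteq> I" "?y \<notin> Poly_Mapping.keys v" "?z \<notin> Poly_Mapping.keys v" for v
    using f1(3) f2(3) that by simp
  have f2y: "f2 (frag_of ?y) = t" using f2(3)[of "frag_of ?y"] f1(2) yz' yI by simp
  have "f2 x \<noteq> \<one>" if x: "x \<in> D" for x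
  proof (cases "x \<in> ?D")
    case True
    then have "f2 x = f x" using same Suc.prems(4)[OF x] wk by blast
    then show ?thesis using f(2)[OF True] by simp
  next
    case False
    have kx: "Poly_Mapping.keys x \<subseteq> I" using Suc.prems(4)[OF x] by blast
    have "f2 x = f2 (?r x) \<otimes>\<^bsub>units_of R\<^esub> (c \<ominus> t) [^]\<^bsub>units_of R\<^esub> Poly_Mapping.lookup x ?z"
      using U.free_hom_split[OF f2(1) kx yI(2)] f2(2) by simp
    also have "f2 (?r x) = f2 (?rr x) \<otimes>\<^bsub>units_of R\<^esub> t [^]\<^bsub>units_of R\<^esub> Poly_Mapping.lookup x ?y"
      using U.free_hom_split[OF f2(1) k(1)[OF kx] yI(1)] f2y unfolding ly by simp
    also have "f2 (?rr x) = f (?rr x)" by (rule same[OF k(2,4,5)[OF kx]])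
    finally show ?thesis using t(3)[of x] False x by (simp add: units_of_mult)
  qed
  moreover have "(\<one> \<ominus> f2 v) \<otimes> (f2 (frag_of (y v)) \<oplus> f2 (frag_of (z v))) = \<one>" if v: "v \<in> S" for v
  proof (cases "v = w")
    case True
    have "t \<in> carrier R" "c \<in> carrier R" using t(1) c(1) by (auto simp: Units_closed)
    then have "t \<oplus> (c \<ominus> t) = c" by (simp add: a_minus_def a_ac r_neg r_neg1 r_neg2)
    moreover have "f2 w = f w" using same[OF w0(1) wk] .
    ultimately show ?thesis using True f2(2) f2y c(2) by simp
  next
    case False
    have vW: "v \<in> W" using v Suc.prems by blast
    note yv = yz[OF vW]
    have "y v \<noteq> ?y" "z v \<noteq> ?z" "y v \<noteq> ?z" "z v \<noteq> ?y"
      using inj vW wW False by (auto simp: inj_on_eq_iff) metis+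
    moreover have "?y \<notin> Poly_Mapping.keys v" "?z \<notin> Poly_Mapping.keys v"
      using lev[OF vW, of ?y] lev[OF vW, of ?z] max[OF v] yz[OF wW] by auto
    ultimately have "f2 v = f v" "f2 (frag_of (y v)) = f (frag_of (y v))" "f2 (frag_of (z v)) = f (frag_of (z v))"
      using same yv by auto
    then show ?thesis using f(3)[of v] v False by simp
  qed
  ultimately show ?case using f2(1) by blast
qed

end

section \<open>Free subgroups of abelian groups\<close>

definition (in group) int_independent :: "'a set \<Rightarrow> bool" where
  "int_independent I \<longleftrightarrow> I \<subseteq> carrier G \<and>
     (\<forall>i\<in>I. \<forall>m::int. m \<noteq> 0 \<longrightarrow> i [^] m \<notin> generate G (I - {i}))"

context comm_group
begin

lemma generate_insert:
  assumes B: "B \<subseteq> carrier G" and a: "a \<in> carrier G" and y: "y \<in> generate G (insert a B)"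
  shows "\<exists>x\<in>generate G B. \<exists>k::int. y = x \<otimes> a [^] k"
  using y
proof (induction y rule: generate.induct)
  case one
  show ?case using a by (intro bexI[of _ \<one>] exI[of _ 0]) (auto intro: generate.one)
next
  case (incl h)
  then show ?case
  proof
    assume "h = a"
    then show ?thesis using a by (intro bexI[of _ \<one>] exI[of _ 1]) (auto intro: generate.one)
  next
    assume "h \<in> B"
    then show ?thesis using B by (intro bexI[of _ h] exI[of _ 0]) (auto intro: generate.incl)
  qed
next
  case (inv h)
  then show ?case
  proof
    assume "h = a"
    then show ?thesis
      using a int_pow_neg[OF a, of 1] by (intro bexI[of _ \<one>] exI[of _ "-1"]) (auto intro: generate.one)
  next
    assume "h \<in> B"
    then show ?thesis using B by (intro bexI[of _ "inv h"] exI[of _ 0]) (auto intro: generate.inv)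
  qed
next
  case (eng h1 h2)
  then obtain x1 k1 x2 k2 where h: "x1 \<in> generate G B" "h1 = x1 \<otimes> a [^] (k1::int)"
    "x2 \<in> generate G B" "h2 = x2 \<otimes> a [^] (k2::int)" by blast
  have "x1 \<in> carrier G" "x2 \<in> carrier G" using h generate_in_carrier[OF B] by auto
  then have "h1 \<otimes> h2 = (x1 \<otimes> x2) \<otimes> a [^] (k1 + k2)"
    using h a by (simp add: int_pow_mult m_ac)
  then show ?case using generate.eng[OF h(1,3)] by blast
qed

lemma exists_maximal_independent:
  obtains I where "int_independent I" "\<And>a. a \<in> carrier G \<Longrightarrow> \<exists>m>0. a [^] (m::nat) \<in> generate G I"
proof -
  let ?S = "{I. int_independent I}"
  have "\<exists>I\<in>?S. \<forall>J\<in>?S. I \<subseteq> J \<longrightarrow> J = I"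
  proof (rule subset_Zorn_nonempty)
    have "int_independent {}" by (simp add: int_independent_def)
    then show "?S \<noteq> {}" by blast
    fix C assume C: "C \<noteq> {}" "subset.chain ?S C"
    have ind: "int_independent W" if "W \<in> C" for W using C(2) that by (auto simp: subset_chain_def)
    have "i [^] m \<notin> generate G (\<Union>C - {i})" if i: "i \<in> \<Union>C" and m: "m \<noteq> 0" for i and m :: int
    proof
      assume "i [^] m \<in> generate G (\<Union>C - {i})"
      from generate_finite_support[OF this]
      obtain F where F: "finite F" "F \<subseteq> \<Union>C - {i}" "i [^] m \<in> generate G F" by blast
      then have "finite (insert i F)" "insert i F \<subseteq> \<Union>C" using i by auto
      then obtain W where W: "W \<in> C" "insert i F \<subseteq> W"
        by (rule finite_subset_Union_chain[OF _ _ C])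
      then have "F \<subseteq> W - {i}" using F(2) by blast
      then have "i [^] m \<in> generate G (W - {i})" using F(3) mono_generate by blast
      then show False using ind[OF W(1)] W(2) m by (simp add: int_independent_def)
    qed
    moreover have "\<Union>C \<subseteq> carrier G" using ind by (auto simp: int_independent_def)
    ultimately show "\<Union>C \<in> ?S" by (simp add: int_independent_def)
  qed
  then obtain I where I: "int_independent I" and max: "\<And>J. \<lbrakk>int_independent J; I \<subseteq> J\<rbrakk> \<Longrightarrow> J = I" by blast
  have Ic: "I \<subseteq> carrier G" using I by (simp add: int_independent_def)
  have sub: "subgroup (generate G I) G" by (rule generate_is_subgroup[OF Ic])
  have "\<exists>m>0. a [^] (m::nat) \<in> generate G I" if a: "a \<in> carrier G" for a
  proof (rule ccontr)
    assume no: "\<not> (\<exists>m>0. a [^] (m::nat) \<in> generate G I)"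
    have noint: "a [^] m \<notin> generate G I" if m: "m \<noteq> 0" for m :: int
    proof
      assume am: "a [^] m \<in> generate G I"
      then have am': "a [^] (- m) \<in> generate G I"
        using subgroup.m_inv_closed[OF sub am] int_pow_neg[OF a, of m] by simp
      have "a [^] nat \<bar>m\<bar> \<in> generate G I"
      proof (cases "m > 0")
        case True
        then have "a [^] nat \<bar>m\<bar> = a [^] m" using int_pow_int[of G a "nat m"] by simp
        then show ?thesis using am by simp
      next
        case False
        then have "a [^] nat \<bar>m\<bar> = a [^] (- m)" using int_pow_int[of G a "nat (- m)"] by simp
        then show ?thesis using am' by simp
      qed
      then show False using no m by (metis zero_less_abs_iff zero_less_nat_eq)
    qed
    have aI: "a \<notin> I" using noint[of 1] a generate.incl[of a I G] by auto
    have "int_independent (insert a I)"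
      unfolding int_independent_def
    proof (intro conjI ballI allI impI)
      show "insert a I \<subseteq> carrier G" using a Ic by simp
      fix i and m :: int assume i: "i \<in> insert a I" and m: "m \<noteq> 0"
      show "i [^] m \<notin> generate G (insert a I - {i})"
      proof (cases "i = a")
        case True
        then show ?thesis using noint[OF m] aI by simp
      next
        case False
        then have iI: "i \<in> I" and ic: "i \<in> carrier G" using i Ic by auto
        have eq: "insert a I - {i} = insert a (I - {i})" using False by auto
        show ?thesis
        proof
          assume "i [^] m \<in> generate G (insert a I - {i})"
          then obtain x and k :: int where x: "x \<in> generate G (I - {i})" "i [^] m = x \<otimes> a [^] k"
            using generate_insert[of "I - {i}" a] Ic a unfolding eq by blast
          have xI: "x \<in> generate G I" using x(1) mono_generate[of "I - {i}" I] by blast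
          then have xc: "x \<in> carrier G" using generate_in_carrier[OF Ic] by blast
          have "a [^] k = inv x \<otimes> i [^] m" using x(2) xc ic a by (simp add: m_assoc[symmetric])
          moreover have "i [^] m \<in> generate G I"
            by (rule subgroup_int_pow_closed[OF sub]) (use iI in \<open>auto intro: generate.incl\<close>)
          ultimately have "a [^] k \<in> generate G I"
            using subgroup.m_closed[OF sub subgroup.m_inv_closed[OF sub xI]] by simp
          then have "k = 0" using noint by blast
          then have "i [^] m \<in> generate G (I - {i})" using x xc by simp
          then show False using I iI m by (simp add: int_independent_def)
        qed
      qed
    qed
    then show False using max[of "insert a I"] aI by blast
  qed
  then show thesis using that I by blast
qed

text \<open>A maximal independent subset generates a free abelian subgroup modulo which the group is
  torsion.\<close>

lemma exists_free_subgroup: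
  obtains I h where "I \<subseteq> carrier G" "h \<in> hom (free_Abelian_group I) G"
    "\<And>w. \<lbrakk>Poly_Mapping.keys w \<subseteq> I; h w = \<one>\<rbrakk> \<Longrightarrow> w = 0"
    "\<And>a. a \<in> carrier G \<Longrightarrow> \<exists>m>0. a [^] (m::nat) \<in> h ` {w. Poly_Mapping.keys w \<subseteq> I}"
proof -
  obtain I where I: "int_independent I" "\<And>a. a \<in> carrier G \<Longrightarrow> \<exists>m>0. a [^] (m::nat) \<in> generate G I"
    by (rule exists_maximal_independent) blast
  have Ic: "I \<subseteq> carrier G" using I by (simp add: int_independent_def)
  obtain h where h: "h \<in> hom (free_Abelian_group I) G" "\<And>x. x \<in> I \<Longrightarrow> h (frag_of x) = x"
    by (rule free_Abelian_group_universal[of "\<lambda>x. x" I]) (use Ic in auto)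
  have gen: "h v \<in> generate G J" if J: "J \<subseteq> I" and v: "Poly_Mapping.keys v \<subseteq> J" for v J
  proof -
    have sub: "subgroup (generate G J) G" by (rule generate_is_subgroup) (use J Ic in auto)
    have "Poly_Mapping.keys v \<subseteq> I \<and> h v \<in> generate G J"
      using v
    proof (induction v rule: frag_induction)
      case zero
      have "h 0 = \<one>" using hom_one[OF h(1) group_free_Abelian_group is_group] by simp
      then show ?case using generate.one[of G J] by simp
    next
      case (one x)
      then show ?case using h(2)[of x] J generate.incl[of x J G] by auto
    next
      case (diff a b)
      then have "Poly_Mapping.keys (a - b) \<subseteq> I" using keys_diff[of a b] by blast
      then show ?case
        using diff free_hom_diff[OF h(1), of a b] subgroup.m_closed[OF sub] subgroup.m_inv_closed[OF sub] by simp
    qed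
    then show ?thesis by simp
  qed
  have inj: "w = 0" if w: "Poly_Mapping.keys w \<subseteq> I" and h1: "h w = \<one>" for w
  proof (rule ccontr)
    assume "w \<noteq> 0"
    then obtain i where i: "i \<in> Poly_Mapping.keys w" by (metis keys_eq_empty equals0I)
    then have iI: "i \<in> I" using w by blast
    let ?m = "Poly_Mapping.lookup w i"
    let ?r = "w - frag_cmul ?m (frag_of i)"
    have rk: "Poly_Mapping.keys ?r \<subseteq> I - {i}" using frag_split(1)[of i w] frag_split(2)[of w i] w by blast
    have rg: "h ?r \<in> generate G (I - {i})" by (rule gen[OF _ rk]) auto
    have sub: "subgroup (generate G (I - {i})) G" by (rule generate_is_subgroup) (use Ic in auto)
    have c: "h ?r \<in> carrier G" "i [^] ?m \<in> carrier G" using subgroup.mem_carrier[OF sub rg] iI Ic by auto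
    have "h ?r \<otimes> i [^] ?m = \<one>" using free_hom_split[OF h(1) w iI] h(2)[OF iI] h1 by simp
    then have "i [^] ?m = inv (h ?r)" using c by (metis inv_equality inv_inv m_comm)
    then have "i [^] ?m \<in> generate G (I - {i})" using subgroup.m_inv_closed[OF sub rg] by simp
    then show False using I(1) iI i by (simp add: int_independent_def in_keys_iff)
  qed
  have img: "generate G I \<subseteq> h ` {w. Poly_Mapping.keys w \<subseteq> I}"
  proof -
    have "group_hom (free_Abelian_group I) G h"
      using h(1) by (simp add: group_hom_def group_hom_axioms_def is_group)
    then have "subgroup (h ` carrier (free_Abelian_group I)) G" by (rule group_hom.img_is_subgroup)
    moreover have "carrier (free_Abelian_group I) = {w. Poly_Mapping.keys w \<subseteq> I}" by auto
    ultimately have "subgroup (h ` {w. Poly_Mapping.keys w \<subseteq> I}) G" by simp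
    moreover have "I \<subseteq> h ` {w. Poly_Mapping.keys w \<subseteq> I}"
    proof
      fix i assume "i \<in> I"
      then show "i \<in> h ` {w. Poly_Mapping.keys w \<subseteq> I}"
        using h(2)[of i] by (intro image_eqI[of _ _ "frag_of i"]) auto
    qed
    ultimately show ?thesis by (intro generate_subgroup_incl)
  qed
  show thesis by (rule that[OF Ic h(1) inj]) (use I(2) img in blast)+
qed

end

lemma countable_free_Abelian_group:
  assumes "finite I"
  shows "countable {w :: 'i \<Rightarrow>\<^sub>0 int. Poly_Mapping.keys w \<subseteq> I}"
proof -
  let ?g = "\<lambda>w :: 'i \<Rightarrow>\<^sub>0 int. (\<lambda>i. (i, Poly_Mapping.lookup w i)) ` I"
  have "inj_on ?g {w. Poly_Mapping.keys w \<subseteq> I}"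
  proof (rule inj_onI)
    fix v w :: "'i \<Rightarrow>\<^sub>0 int"
    assume v: "v \<in> {w. Poly_Mapping.keys w \<subseteq> I}" and w: "w \<in> {w. Poly_Mapping.keys w \<subseteq> I}"
      and eq: "?g v = ?g w"
    show "v = w"
    proof (rule poly_mapping_eqI)
      fix i show "Poly_Mapping.lookup v i = Poly_Mapping.lookup w i"
      proof (cases "i \<in> I")
        case True
        then have "(i, Poly_Mapping.lookup v i) \<in> ?g w" unfolding eq[symmetric] by blast
        then show ?thesis by auto
      next
        case False
        then have "i \<notin> Poly_Mapping.keys v" "i \<notin> Poly_Mapping.keys w" using v w by auto
        then show ?thesis by (simp add: in_keys_iff)
      qed
    qed
  qed
  moreover have "countable (?g ` {w. Poly_Mapping.keys w \<subseteq> I})"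
    by (rule countable_subset[OF _ countable_Collect_finite_subset[of "I \<times> (UNIV :: int set)"]])
      (use assms in \<open>auto intro: countable_finite\<close>)
  ultimately show ?thesis using countable_image_inj_on by blast
qed

section \<open>Torsion-free abelian minimal normal subgroups: finite rank\<close>

text \<open>The intended \<open>A\<close> is the subgroup generated by the members of \<open>\<A>\<close>, and \<open>h\<close>
  embeds the free abelian group on \<open>I\<close> with torsion cokernel.\<close>

locale torsion_free_part = group_field G K
  for G :: "('g, 'b) monoid_scheme" (structure) and K :: "('k, 'c) ring_scheme" +
  fixes A :: "'g set" and \<A> :: "'g set set" and I :: "'g set" and h :: "('g \<Rightarrow>\<^sub>0 int) \<Rightarrow> 'g"
  assumes A: "subgroup A G" and comm: "\<And>x y. \<lbrakk>x \<in> A; y \<in> A\<rbrakk> \<Longrightarrow> x \<otimes> y = y \<otimes> x"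
    and tf: "\<And>x k. \<lbrakk>x \<in> A; x [^] (k::nat) = \<one>; k > 0\<rbrakk> \<Longrightarrow> x = \<one>"
    and \<A>: "\<And>N. N \<in> \<A> \<Longrightarrow> torsion_free_min N" "\<And>N. N \<in> \<A> \<Longrightarrow> N \<subseteq> A"
    and h: "h \<in> hom (free_Abelian_group I) (G\<lparr>carrier := A\<rparr>)"
    and h_inj: "\<And>w. \<lbrakk>Poly_Mapping.keys w \<subseteq> I; h w = \<one>\<rbrakk> \<Longrightarrow> w = 0"
    and full: "\<And>a. a \<in> A \<Longrightarrow> \<exists>m>0. a [^] (m::nat) \<in> h ` {w. Poly_Mapping.keys w \<subseteq> I}"
begin

sublocale C: comm_group "G\<lparr>carrier := A\<rparr>"
  using comm_subgroup_iff[OF A] comm by blast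

definition F where "F = h ` {w. Poly_Mapping.keys w \<subseteq> I}"

lemma A_carrier: "x \<in> A \<Longrightarrow> x \<in> carrier G"
  using subgroup.mem_carrier[OF A] .

lemma h_mem: "Poly_Mapping.keys w \<subseteq> I \<Longrightarrow> h w \<in> A"
  using hom_in_carrier[OF h, of w] by simp

lemma h_add: "\<lbrakk>Poly_Mapping.keys v \<subseteq> I; Poly_Mapping.keys w \<subseteq> I\<rbrakk> \<Longrightarrow> h (v + w) = h v \<otimes> h w"
  using C.free_hom_add[OF h] by simp

lemma h_zero: "h 0 = \<one>"
  using hom_one[OF h group_free_Abelian_group C.is_group] by simp

lemma h_eq_iff:
  assumes "Poly_Mapping.keys v \<subseteq> I" "Poly_Mapping.keys w \<subseteq> I"
  shows "h v = h w \<longleftrightarrow> v = w"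
proof
  assume eq: "h v = h w"
  have k: "Poly_Mapping.keys (v - w) \<subseteq> I" using keys_diff[of v w] assms by blast
  have "h ((v - w) + w) = h (v - w) \<otimes> h w" by (rule h_add[OF k assms(2)])
  then have "h (v - w) \<otimes> h w = h w" using eq by simp
  then have "h (v - w) = \<one>" using A_carrier[OF h_mem[OF k]] A_carrier[OF h_mem[OF assms(2)]] by simp
  then have "v - w = 0" by (rule h_inj[OF k])
  then show "v = w" by simp
qed simp

lemma h_pow: "Poly_Mapping.keys v \<subseteq> I \<Longrightarrow> h (frag_cmul (int k) v) = h v [^] k"
proof -
  assume v: "Poly_Mapping.keys v \<subseteq> I"
  interpret FG: group "free_Abelian_group I" by simp
  have "h (v [^]\<^bsub>free_Abelian_group I\<^esub> int k) = h v [^]\<^bsub>G\<lparr>carrier := A\<rparr>\<^esub> int k"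
    by (rule hom_int_pow[OF h _ FG.is_group C.is_group]) (use v in simp)
  then show ?thesis using v by (simp add: int_pow_int nat_pow_consistent[symmetric])
qed

lemma F_subgroup: "subgroup F G" and F_sub: "F \<subseteq> A"
proof -
  have "group_hom (free_Abelian_group I) (G\<lparr>carrier := A\<rparr>) h"
    using h by (simp add: group_hom_def group_hom_axioms_def C.is_group)
  then have "subgroup (h ` carrier (free_Abelian_group I)) (G\<lparr>carrier := A\<rparr>)"
    by (rule group_hom.img_is_subgroup)
  moreover have "carrier (free_Abelian_group I) = {w. Poly_Mapping.keys w \<subseteq> I}" by auto
  ultimately show "subgroup F G" using incl_subgroup[OF A] by (simp add: F_def)
  show "F \<subseteq> A" using h_mem by (auto simp: F_def)
qed

lemma N_facts:
  assumes "N \<in> \<A>"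
  shows "minimal_normal_subgroup G N" "subgroup N G" "N \<subseteq> carrier G" "N \<noteq> {\<one>}" "\<one> \<in> N"
proof -
  show m: "minimal_normal_subgroup G N"
    using \<A>(1)[OF assms] by (simp add: torsion_free_min_def abelian_min_def)
  show "subgroup N G" by (rule normal_imp_subgroup[OF min_normalD(1)[OF m]])
  show "N \<subseteq> carrier G" "N \<noteq> {\<one>}" "\<one> \<in> N" using min_normalD[OF m] by auto
qed

lemma meets_F:
  assumes "N \<in> \<A>"
  shows "\<exists>w. Poly_Mapping.keys w \<subseteq> I \<and> w \<noteq> 0 \<and> h w \<in> N"
proof -
  obtain x where x: "x \<in> N" "x \<noteq> \<one>" using N_facts[OF assms] by blast
  then have xA: "x \<in> A" using \<A>(2)[OF assms] by blast
  then obtain m :: nat and w where w: "m > 0" "x [^] m = h w" "Poly_Mapping.keys w \<subseteq> I" using full by blast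
  have "x [^] m \<noteq> \<one>" using tf[OF xA] x w by blast
  then have "w \<noteq> 0" using w h_zero by auto
  moreover have "h w \<in> N" using nat_pow_mem[OF N_facts(2)[OF assms] x(1), of m] w by simp
  ultimately show ?thesis using w by blast
qed

text \<open>A choice of a nontrivial element in the intersection of \<open>N\<close> with the free subgroup \<open>F\<close>. Distinct
  minimal normal subgroups meet trivially, so it determines \<open>N\<close>.\<close>

definition wt where "wt N = (SOME w. Poly_Mapping.keys w \<subseteq> I \<and> w \<noteq> 0 \<and> h w \<in> N)"

lemma wt: "N \<in> \<A> \<Longrightarrow> Poly_Mapping.keys (wt N) \<subseteq> I" "N \<in> \<A> \<Longrightarrow> wt N \<noteq> 0" "N \<in> \<A> \<Longrightarrow> h (wt N) \<in> N"
  unfolding wt_def using someI_ex[OF meets_F, of N] by auto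

lemma wt_inj: "inj_on wt \<A>"
proof (rule inj_onI, rule ccontr)
  fix N N' assume N: "N \<in> \<A>" "N' \<in> \<A>" "wt N = wt N'" "N \<noteq> N'"
  then have "h (wt N) \<in> N \<inter> N'" using wt(3)[OF N(1)] wt(3)[OF N(2)] by simp
  then have "h (wt N) = \<one>" using min_normal_disjoint[OF N_facts(1)[OF N(1)] N_facts(1)[OF N(2)] N(4)] by blast
  then show False using h_inj[OF wt(1)[OF N(1)]] wt(2)[OF N(1)] by blast
qed

text \<open>Otherwise all iterated \<open>l\<close>-th roots in the divisible group \<open>N\<close> of an element of \<open>F\<close> would lie in
  \<open>H\<close>, and that element would be infinitely divisible by \<open>l\<close> in the free abelian group \<open>F\<close>.\<close>

lemma root_outside:
  assumes N: "N \<in> \<A>" and l: "l > (1::nat)" and H: "\<And>x. x \<in> H \<Longrightarrow> x [^] (l ^ k) \<in> F"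
    and FH: "F \<subseteq> H"
  shows "\<exists>n\<in>N. n \<notin> H \<and> n [^] l \<in> H"
proof (rule ccontr)
  assume no: "\<not> (\<exists>n\<in>N. n \<notin> H \<and> n [^] l \<in> H)"
  let ?x = "h (wt N)"
  have NG: "x \<in> carrier G" if "x \<in> N" for x using N_facts(3)[OF N] that by blast
  have xF: "?x \<in> F" using wt(1)[OF N] by (auto simp: F_def)
  have root: "\<exists>m\<in>N. m \<in> H \<and> m [^] (l ^ j) = ?x" for j
  proof (induction j)
    case 0
    then show ?case using wt(3)[OF N] xF FH NG by (intro bexI[of _ ?x]) auto
  next
    case (Suc j)
    then obtain m where m: "m \<in> N" "m \<in> H" "m [^] (l ^ j) = ?x" by blast
    obtain m' where m': "m' \<in> N" "m' [^] l = m"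
      using torsion_free_min_divisible[OF \<A>(1)[OF N] m(1), of l] l by auto
    have "m' \<in> H" using no m' m by blast
    moreover have "m' [^] (l ^ Suc j) = ?x" using m m' NG[OF m'(1)] by (simp add: nat_pow_pow[symmetric])
    ultimately show ?case using m' by blast
  qed
  obtain p where p: "p \<in> Poly_Mapping.keys (wt N)" using wt(2)[OF N] by (metis keys_eq_empty equals0I)
  define c where "c = Poly_Mapping.lookup (wt N) p"
  have c0: "c \<noteq> 0" using p by (simp add: c_def in_keys_iff)
  have "int l ^ i dvd c" for i
  proof -
    obtain m where m: "m \<in> N" "m \<in> H" "m [^] (l ^ (k + i)) = ?x" using root by blast
    obtain v where v: "Poly_Mapping.keys v \<subseteq> I" "m [^] (l ^ k) = h v" using H[OF m(2)] by (auto simp: F_def)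
    have "h (frag_cmul (int (l ^ i)) v) = (m [^] (l ^ k)) [^] (l ^ i)" using h_pow[OF v(1), of "l ^ i"] v(2) by (simp del: of_nat_power)
    also have "\<dots> = ?x" using m NG[OF m(1)] by (simp add: nat_pow_pow power_add)
    finally have eq: "frag_cmul (int (l ^ i)) v = wt N"
      using h_eq_iff[OF _ wt(1)[OF N]] keys_cmul[of "int (l ^ i)" v] v(1) by blast
    have "c = int (l ^ i) * Poly_Mapping.lookup v p" unfolding c_def eq[symmetric] by simp
    then show ?thesis by simp
  qed
  then have "int l ^ nat \<bar>c\<bar> \<le> \<bar>c\<bar>" using dvd_imp_le_int[OF c0, of "int l ^ nat \<bar>c\<bar>"] by simp
  then have "int (l ^ nat \<bar>c\<bar>) \<le> int (nat \<bar>c\<bar>)" by simp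
  then have "l ^ nat \<bar>c\<bar> \<le> nat \<bar>c\<bar>" by (simp only: of_nat_le_iff)
  moreover have "nat \<bar>c\<bar> < l ^ nat \<bar>c\<bar>" using l by (intro power_gt_expt) simp
  ultimately show False by simp
qed

text \<open>Take \<open>n \<in> N\<close> outside \<open>H\<close> with \<open>n\<^sup>l \<in> H\<close>. If \<open>E\<close> has a nonzero solution that is invariant under
  \<open>n\<^sup>l\<close>, then \<open>1 + n + \<dots> + n\<^sup>l\<^sup>-\<^sup>1\<close> can be added to \<open>E\<close>. If not, \<open>E\<close> already detects \<open>N\<close>, since \<open>n\<^sup>l\<close> lies
  in \<open>N\<close>.\<close>

lemma extend_step:
  assumes N: "N \<in> \<A>" and l: "l > (1::nat)" "[l] \<cdot>\<^bsub>K\<^esub> \<one>\<^bsub>K\<^esub> \<noteq> \<zero>\<^bsub>K\<^esub>"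
    and H: "subgroup H G" "F \<subseteq> H" "H \<subseteq> A" "\<And>x. x \<in> H \<Longrightarrow> x [^] (l ^ k) \<in> F"
    and E: "E \<subseteq> combs K H" "solvable_on K G H E"
  shows "\<exists>H' E' k'. subgroup H' G \<and> H \<subseteq> H' \<and> H' \<subseteq> A \<and> (\<forall>x\<in>H'. x [^] (l ^ k') \<in> F) \<and>
    E \<subseteq> E' \<and> E' \<subseteq> combs K H' \<and> solvable_on K G H' E' \<and> detects K G E' N"
proof -
  obtain n where n: "n \<in> N" "n \<notin> H" "n [^] l \<in> H" using root_outside[OF N l(1) H(4,2)] by blast
  have nA: "n \<in> A" and nG: "n \<in> carrier G" using n \<A>(2)[OF N] A_carrier by auto
  have Ec: "E \<subseteq> combs K (carrier G)" using E(1) combs_mono[OF subgroup.subset[OF H(1)]] by blast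
  show ?thesis
  proof (cases "\<exists>\<phi> a. solves K G E \<phi> \<and> (\<forall>g\<in>carrier G. \<phi> (g \<otimes> n [^] l) = \<phi> g) \<and> a \<in> carrier G \<and> \<phi> a \<noteq> \<zero>\<^bsub>K\<^esub>")
    case False
    have "detects K G E N"
      unfolding detects_def
    proof (intro allI impI ballI)
      fix \<phi> g assume *: "solves K G E \<phi> \<and> (\<forall>g\<in>carrier G. \<forall>n\<in>N. \<phi> (g \<otimes> n) = \<phi> g)" and g: "g \<in> carrier G"
      moreover have "n [^] l \<in> N" by (rule nat_pow_mem[OF N_facts(2)[OF N] n(1)])
      ultimately show "\<phi> g = \<zero>\<^bsub>K\<^esub>" using False by blast
    qed
    then show ?thesis using H E by blast
  next
    case True
    then obtain \<phi> a where \<phi>: "solves K G E \<phi>" "\<And>g. g \<in> carrier G \<Longrightarrow> \<phi> (g \<otimes> n [^] l) = \<phi> g"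
      "a \<in> carrier G" "\<phi> a \<noteq> \<zero>\<^bsub>K\<^esub>" by blast
    define \<phi>1 where "\<phi>1 g = (if g \<in> H then \<phi> (a \<otimes> g) else \<zero>\<^bsub>K\<^esub>)" for g
    have s1: "solves K G E \<phi>1"
      unfolding \<phi>1_def by (rule solves_restrict[OF solves_translate[OF \<phi>(1) Ec \<phi>(3)] H(1) E(1)])
    have per: "\<phi>1 (g \<otimes> n [^] l) = \<phi>1 g" if g: "g \<in> carrier G" for g
      using subgroup_mult_mem_iff[OF H(1) n(3) g] \<phi>(2)[of "a \<otimes> g"] \<phi>(3) g nG
      by (simp add: \<phi>1_def m_assoc)
    have HG: "H \<subseteq> carrier G" using subgroup.subset[OF H(1)] .
    have cm: "x \<otimes> n = n \<otimes> x" if "x \<in> H" for x using comm that H(3) nA by blast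
    let ?\<psi> = "\<lambda>g. \<phi>1 g \<ominus>\<^bsub>K\<^esub> \<phi>1 (g \<otimes> inv n)"
    have s2: "solves K G (insert (geom K G n l) E) ?\<psi>"
      by (rule solves_add_geom[OF s1 E(1) HG nG cm per])
    define H' where "H' = H <#> generate G {n}"
    have gn: "subgroup (generate G {n}) G" by (rule generate_is_subgroup) (use nG in simp)
    have gnA: "generate G {n} \<subseteq> A" by (rule generate_subgroup_incl[OF _ A]) (use nA in simp)
    have cm': "x \<otimes> y = y \<otimes> x" if "x \<in> H" "y \<in> generate G {n}" for x y
      using comm that H(3) gnA by blast
    have H': "subgroup H' G" unfolding H'_def by (rule commuting_set_mult_subgroup[OF H(1) gn cm'])
    have HH': "H \<subseteq> H'"
    proof
      fix x assume "x \<in> H"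
      then show "x \<in> H'" using HG generate.one[of G "{n}"] unfolding H'_def set_mult_def by force
    qed
    have nH': "n \<in> H'"
      using subgroup.one_closed[OF H(1)] generate.incl[of n "{n}" G] nG unfolding H'_def set_mult_def by force
    have H'A: "H' \<subseteq> A" unfolding H'_def set_mult_def using H(3) gnA subgroup.m_closed[OF A] by blast
    have pw: "x [^] (l ^ Suc k) \<in> F" if x: "x \<in> H'" for x
    proof -
      obtain y z where yz: "y \<in> H" "z \<in> generate G {n}" "x = y \<otimes> z" using x by (auto simp: H'_def set_mult_def)
      obtain i :: int where i: "z = n [^] i" using yz(2) generate_pow[OF nG] by auto
      have c: "y \<in> carrier G" "z \<in> carrier G" using yz(1) HG i nG by auto
      have "z [^] l = (n [^] l) [^] i"
        using i nG by (simp add: int_pow_int[symmetric] int_pow_pow mult.commute)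
      then have "z [^] l \<in> H" using subgroup_int_pow_closed[OF H(1) n(3)] by simp
      moreover have "x [^] l = y [^] l \<otimes> z [^] l" using yz pow_mult_distrib[OF cm'[OF yz(1,2)] c] by simp
      ultimately have "x [^] l \<in> H" using nat_pow_mem[OF H(1) yz(1)] subgroup.m_closed[OF H(1)] by simp
      then have "(x [^] l) [^] (l ^ k) \<in> F" by (rule H(4))
      then show ?thesis using c yz by (simp add: nat_pow_pow)
    qed
    let ?E' = "insert (geom K G n l) E"
    have E': "?E' \<subseteq> combs K H'" using E(1) combs_mono[OF HH'] geom_in_combs[OF H' nH'] by blast
    have "solvable_on K G H' ?E'"
    proof (rule solvable_onI[OF s2 H' E' one_closed])
      have "inv n \<notin> H" using n(2) subgroup.m_inv_closed[OF H(1), of "inv n"] nG by auto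
      then have "?\<psi> \<one> = \<phi> a \<ominus>\<^bsub>K\<^esub> \<zero>\<^bsub>K\<^esub>"
        using subgroup.one_closed[OF H(1)] nG \<phi>(3) by (simp add: \<phi>1_def)
      moreover have "\<phi> a \<in> carrier K" using \<phi>(1,3) by (auto simp: solves_def)
      ultimately show "?\<psi> \<one> \<noteq> \<zero>\<^bsub>K\<^esub>" using \<phi>(4) by (simp add: K.minus_eq)
    qed
    moreover have "detects K G ?E' N"
      by (rule detects_mono[OF detects_aug[OF geom_in_combs[OF N_facts(2)[OF N] n(1), of l] N_facts(3)[OF N]]])
        (use l(2) in \<open>auto simp: aug_geom\<close>)
    ultimately show ?thesis using H' HH' H'A pw E' by blast
  qed
qed

text \<open>There are only countably many minimal normal subgroups to treat, because each is determined by
  an element of a free abelian group of finite rank. So they can be treated one after the other.\<close>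

lemma solvable_finite_rank:
  assumes fin: "finite I"
  shows "\<exists>E \<subseteq> combs K A. (\<forall>N\<in>\<A>. detects K G E N) \<and>
     (\<forall>E0. finite E0 \<and> E0 \<subseteq> E \<longrightarrow> solvable_on K G A E0)"
proof (cases "\<A> = {}")
  case True
  then show ?thesis using solvable_on_empty[OF A] by (intro exI[of _ "{}"]) auto
next
  case False
  have "countable \<A>"
  proof (rule countable_image_inj_on[OF _ wt_inj])
    show "countable (wt ` \<A>)"
      by (rule countable_subset[OF _ countable_free_Abelian_group[OF fin]]) (use wt(1) in blast)
  qed
  then have enum: "range (from_nat_into \<A>) = \<A>" by (rule range_from_nat_into[OF False])
  have "ring_char K \<noteq> 2 \<or> ring_char K \<noteq> 3" by auto
  moreover have "normalization_semidom_class.prime (2::nat)" "normalization_semidom_class.prime (3::nat)" by simp_all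
  ultimately obtain l where l: "normalization_semidom_class.prime (l::nat)" "ring_char K \<noteq> l" by metis
  have l1: "l > 1" using prime_gt_1_nat[OF l(1)] .
  have l2: "[l] \<cdot>\<^bsub>K\<^esub> \<one>\<^bsub>K\<^esub> \<noteq> \<zero>\<^bsub>K\<^esub>" by (rule prime_nonzero_in_field[OF l])
  define ok where "ok s \<longleftrightarrow> (case s of (H, E) \<Rightarrow> subgroup H G \<and> F \<subseteq> H \<and> H \<subseteq> A \<and>
     (\<exists>k. \<forall>x\<in>H. x [^] (l ^ k) \<in> F) \<and> E \<subseteq> combs K H \<and> solvable_on K G H E)" for s
  define ext where "ext n s s' \<longleftrightarrow> fst s \<subseteq> fst s' \<and> snd s \<subseteq> snd s' \<and> detects K G (snd s') (from_nat_into \<A> n)"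
    for n :: nat and s s' :: "'g set \<times> ('k \<times> 'g) list set"
  have "\<exists>s. \<forall>n. ok (s n) \<and> ext n (s n) (s (Suc n))"
  proof (rule dependent_nat_choice)
    have "\<forall>x\<in>F. x [^] (l ^ 0) \<in> F" using F_sub A_carrier by auto
    then show "\<exists>s. ok s"
      using F_subgroup F_sub solvable_on_empty[OF F_subgroup] unfolding ok_def
      by (intro exI[of _ "(F, {})"]) blast
    fix s n assume "ok s"
    moreover obtain H E where "s = (H, E)" by (cases s)
    ultimately obtain k where s: "s = (H, E)" "subgroup H G" "F \<subseteq> H" "H \<subseteq> A"
      "\<And>x. x \<in> H \<Longrightarrow> x [^] (l ^ k) \<in> F" "E \<subseteq> combs K H" "solvable_on K G H E"
      unfolding ok_def by auto
    have N: "from_nat_into \<A> n \<in> \<A>" by (rule from_nat_into[OF False])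
    obtain H' E' k' where s': "subgroup H' G" "H \<subseteq> H'" "H' \<subseteq> A" "\<forall>x\<in>H'. x [^] (l ^ k') \<in> F"
      "E \<subseteq> E'" "E' \<subseteq> combs K H'" "solvable_on K G H' E'" "detects K G E' (from_nat_into \<A> n)"
      using extend_step[OF N l1 l2 s(2-7)] by blast
    then show "\<exists>s'. ok s' \<and> ext n s s'"
      using s(1,3) unfolding ok_def ext_def by (intro exI[of _ "(H', E')"]) auto
  qed
  then obtain s where s: "\<And>n. ok (s n)" "\<And>n. ext n (s n) (s (Suc n))" by blast
  have mono: "snd (s m) \<subseteq> snd (s n)" if "m \<le> n" for m n
    using that by (induction rule: dec_induct) (use s(2) in \<open>auto simp: ext_def\<close>)
  let ?E = "\<Union>n. snd (s n)"
  have okn: "snd (s n) \<subseteq> combs K A" "solvable_on K G A (snd (s n))" for n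
  proof -
    obtain H E where HE: "s n = (H, E)" by (cases "s n")
    then have H: "H \<subseteq> A" "E \<subseteq> combs K H" "solvable_on K G H E" using s(1)[of n] by (auto simp: ok_def)
    then show "snd (s n) \<subseteq> combs K A" using HE combs_mono[OF H(1)] by auto
    show "solvable_on K G A (snd (s n))" using HE solvable_on_superset[OF H(3,1)] by simp
  qed
  have "detects K G ?E N" if "N \<in> \<A>" for N
  proof -
    have "N \<in> range (from_nat_into \<A>)" using enum that by simp
    then obtain n where "N = from_nat_into \<A> n" by (elim rangeE)
    then have "detects K G (snd (s (Suc n))) N" using s(2)[of n] by (simp add: ext_def)
    then show ?thesis by (rule detects_mono) blast
  qed
  moreover have "solvable_on K G A E0" if E0: "finite E0" "E0 \<subseteq> ?E" for E0
  proof -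
    have "\<exists>n. E0 \<subseteq> snd (s n)"
      using E0
    proof (induction E0 rule: finite_induct)
      case (insert e E0)
      then obtain n m where "E0 \<subseteq> snd (s n)" "e \<in> snd (s m)" by auto
      then have "insert e E0 \<subseteq> snd (s (max n m))" using mono[of n "max n m"] mono[of m "max n m"] by auto
      then show ?case by blast
    qed simp
    then show ?thesis using okn(2) solvable_on_mono by blast
  qed
  ultimately show ?thesis using okn(1) by (intro exI[of _ ?E]) blast
qed

end

section \<open>Torsion-free abelian minimal normal subgroups: infinite rank\<close>

definition extension_space :: "('l, 'd) ring_scheme \<Rightarrow> ('k \<Rightarrow> 'l) \<Rightarrow> ('k, 'l) module" where
  "extension_space L \<sigma> = \<lparr>carrier = carrier L, mult = monoid.mult L, one = one L, ring.zero = \<zero>\<^bsub>L\<^esub>, add = ring.add L,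
     smult = (\<lambda>a x. \<sigma> a \<otimes>\<^bsub>L\<^esub> x)\<rparr>"

lemma extension_space_simps [simp]:
  "carrier (extension_space L \<sigma>) = carrier L" "\<zero>\<^bsub>extension_space L \<sigma>\<^esub> = \<zero>\<^bsub>L\<^esub>"
  "x \<oplus>\<^bsub>extension_space L \<sigma>\<^esub> y = x \<oplus>\<^bsub>L\<^esub> y" "a \<odot>\<^bsub>extension_space L \<sigma>\<^esub> x = \<sigma> a \<otimes>\<^bsub>L\<^esub> x"
  by (simp_all add: extension_space_def)

context group_field
begin

lemma extension_space_module:
  assumes L: "field L" and \<sigma>: "\<sigma> \<in> ring_hom K L"
  shows "module K (extension_space L \<sigma>)"
proof -
  interpret L: field L by fact
  have c: "\<sigma> a \<in> carrier L" if "a \<in> carrier K" for a using ring_hom_memE(1)[OF \<sigma> that] .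
  show ?thesis
  proof (rule moduleI)
    show "cring K" ..
    show "abelian_group (extension_space L \<sigma>)"
    proof (rule abelian_groupI)
      fix x assume "x \<in> carrier (extension_space L \<sigma>)"
      then show "\<exists>y\<in>carrier (extension_space L \<sigma>). y \<oplus>\<^bsub>extension_space L \<sigma>\<^esub> x = \<zero>\<^bsub>extension_space L \<sigma>\<^esub>"
        by (intro bexI[of _ "\<ominus>\<^bsub>L\<^esub> x"]) (auto simp: L.l_neg)
    qed (auto simp: L.a_ac)
  qed (use c ring_hom_memE[OF \<sigma>] in \<open>auto simp: L.l_distr L.r_distr L.m_assoc\<close>)
qed

text \<open>The group \<open>F\<close> acts on the vector space \<open>L\<close> over \<open>K\<close> through the character \<open>f\<close>.\<close>

lemma solvable_of_character:
  assumes F: "subgroup F G" and L: "field L" and \<sigma>: "\<sigma> \<in> ring_hom K L"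
    and f: "\<And>x. x \<in> F \<Longrightarrow> f x \<in> carrier L" "f \<one> = \<one>\<^bsub>L\<^esub>"
      "\<And>x y. \<lbrakk>x \<in> F; y \<in> F\<rbrakk> \<Longrightarrow> f (x \<otimes> y) = f x \<otimes>\<^bsub>L\<^esub> f y"
    and E: "E \<subseteq> combs K F"
      "\<And>e. e \<in> E \<Longrightarrow> comb_act (extension_space L \<sigma>) (\<lambda>x v. f x \<otimes>\<^bsub>L\<^esub> v) e \<one>\<^bsub>L\<^esub> = \<zero>\<^bsub>L\<^esub>"
  shows "solvable_on K G F E"
proof -
  interpret L: field L by fact
  let ?V = "extension_space L \<sigma>" and ?\<rho> = "\<lambda>x v. f x \<otimes>\<^bsub>L\<^esub> v"
  have c: "\<sigma> a \<in> carrier L" if "a \<in> carrier K" for a using ring_hom_memE(1)[OF \<sigma> that] .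
  have "lin_action K (G\<lparr>carrier := F\<rparr>) ?V ?\<rho>"
    using f c by (auto simp: lin_action_def L.r_distr L.m_assoc L.m_lcomm)
  then interpret linear_rep "G\<lparr>carrier := F\<rparr>" K ?V ?\<rho>
    using subgroup_imp_group[OF F] extension_space_module[OF L \<sigma>]
    by (simp add: linear_rep_def linear_rep_axioms_def vector_space_on_def K.field_axioms)
  have "solvable_on K (G\<lparr>carrier := F\<rparr>) (carrier (G\<lparr>carrier := F\<rparr>)) E"
    by (rule solvable_of_annihilated_vector[of "\<one>\<^bsub>L\<^esub>"]) (use E in auto)
  then show ?thesis using solvable_on_subgroup[OF F E(1)] by simp
qed

text \<open>The element \<open>1 - (1 - n) (y + z)\<close> of \<open>K[G]\<close>, for commuting arguments. It makes \<open>1 - n\<close>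
  invertible, with inverse \<open>y + z\<close>.\<close>

definition inverse_comb where
  "inverse_comb n y z = [(\<one>\<^bsub>K\<^esub>, \<one>), (\<ominus>\<^bsub>K\<^esub> \<one>\<^bsub>K\<^esub>, y), (\<ominus>\<^bsub>K\<^esub> \<one>\<^bsub>K\<^esub>, z), (\<one>\<^bsub>K\<^esub>, y \<otimes> n), (\<one>\<^bsub>K\<^esub>, z \<otimes> n)]"

lemma inverse_comb_in: "\<lbrakk>subgroup H G; n \<in> H; y \<in> H; z \<in> H\<rbrakk> \<Longrightarrow> inverse_comb n y z \<in> combs K H"
  by (auto simp: inverse_comb_def subgroup.one_closed subgroup.m_closed)

lemma detects_inverse_comb:
  assumes "n \<in> N" "N \<subseteq> carrier G" "y \<in> carrier G" "z \<in> carrier G"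
  shows "detects K G {inverse_comb n y z} N"
  unfolding detects_def
proof (intro allI impI ballI)
  fix \<phi> g assume *: "solves K G {inverse_comb n y z} \<phi> \<and> (\<forall>g\<in>carrier G. \<forall>n\<in>N. \<phi> (g \<otimes> n) = \<phi> g)"
    and g: "g \<in> carrier G"
  have nG: "n \<in> carrier G" using assms by blast
  have c: "\<phi> x \<in> carrier K" if "x \<in> carrier G" for x using * that by (auto simp: solves_def)
  have inv: "\<phi> (g \<otimes> (x \<otimes> n)) = \<phi> (g \<otimes> x)" if "x \<in> carrier G" for x
    using * assms(1) that g nG by (simp add: m_assoc[symmetric])
  have "comb_eval K G (inverse_comb n y z) \<phi> g = \<zero>\<^bsub>K\<^esub>" using * g by (simp add: solves_def)
  then have "\<phi> g \<oplus>\<^bsub>K\<^esub> (\<ominus>\<^bsub>K\<^esub> \<phi> (g \<otimes> y) \<oplus>\<^bsub>K\<^esub> (\<ominus>\<^bsub>K\<^esub> \<phi> (g \<otimes> z) \<oplus>\<^bsub>K\<^esub> (\<phi> (g \<otimes> y) \<oplus>\<^bsub>K\<^esub> \<phi> (g \<otimes> z)))) = \<zero>\<^bsub>K\<^esub>"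
    using g assms c inv by (simp add: inverse_comb_def K.l_minus)
  moreover have "\<ominus>\<^bsub>K\<^esub> b \<oplus>\<^bsub>K\<^esub> (\<ominus>\<^bsub>K\<^esub> a \<oplus>\<^bsub>K\<^esub> (b \<oplus>\<^bsub>K\<^esub> a)) = \<zero>\<^bsub>K\<^esub>" if "a \<in> carrier K" "b \<in> carrier K" for a b
    using that by (simp add: K.a_comm[of b] K.r_neg1 K.l_neg)
  ultimately show "\<phi> g = \<zero>\<^bsub>K\<^esub>" using c g assms by simp
qed

end

context torsion_free_part
begin

text \<open>For infinite \<open>I\<close> there are at least as many free generators as members of \<open>\<A>\<close>, and each \<open>N\<close> can
  be given its own pair of generators \<open>y\<close>, \<open>z\<close> for the equation \<open>(1 - n) (y + z) = 1\<close>, where \<open>n \<in> N\<close>. Any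
  finite number of these equations can be solved by a character of the free group with values in an
  infinite field that contains \<open>K\<close>, such as the algebraic closure of \<open>K\<close>.\<close>

lemma solvable_infinite_rank:
  assumes inf: "infinite I"
  shows "\<exists>E \<subseteq> combs K A. (\<forall>N\<in>\<A>. detects K G E N) \<and>
     (\<forall>E0. finite E0 \<and> E0 \<subseteq> E \<longrightarrow> solvable_on K G A E0)"
proof -
  define W where "W = wt ` \<A>"
  have W: "Poly_Mapping.keys w \<subseteq> I \<and> w \<noteq> 0" if "w \<in> W" for w using that wt by (auto simp: W_def)
  have "infinite (UNIV :: (nat \<times> bool) set)" by (simp add: finite_prod)
  then have "|I \<times> (UNIV :: (nat \<times> bool) set)| \<le>o |I|"
    using inf by (simp add: card_of_Times_ordLeq_infinite flip: infinite_iff_card_of_countable)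
  \<comment> \<open>The generators are indexed by \<open>I\<close>, a level and a bit, and the pair of an
    element \<open>w\<close> of the free group lives one level above all generators that occur in \<open>w\<close>.\<close>
  then obtain b where b: "inj_on b (I \<times> (UNIV :: (nat \<times> bool) set))" "b ` (I \<times> UNIV) \<subseteq> I"
    using card_of_ordLeq[of "I \<times> (UNIV :: (nat \<times> bool) set)" I] by blast
  obtain \<iota> where \<iota>: "bij_betw \<iota> (carrier (free_Abelian_group I)) I"
    using eqpoll_free_Abelian_group_infinite[OF inf] unfolding eqpoll_def by blast
  have \<iota>I: "\<iota> w \<in> I" if "w \<in> W" for w using W[OF that] \<iota> by (auto simp: bij_betw_def)
  have \<iota>_inj: "w = w'" if "w \<in> W" "w' \<in> W" "\<iota> w = \<iota> w'" for w w'
    using W that \<iota> by (auto simp: bij_betw_def inj_on_def)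
  define lev where "lev i = fst (snd (inv_into (I \<times> (UNIV :: (nat \<times> bool) set)) b i))" for i
  define lv where "lv w = Suc (Max (lev ` Poly_Mapping.keys w))" for w :: "'g \<Rightarrow>\<^sub>0 int"
  define y where "y w = b (\<iota> w, lv w, True)" for w
  define z where "z w = b (\<iota> w, lv w, False)" for w
  have levb: "lev (b (i, k, t)) = k" if "i \<in> I" for i k t
    using inv_into_f_f[OF b(1), of "(i, k, t)"] that by (simp add: lev_def)
  have yzI: "y w \<in> I" "z w \<in> I" if "w \<in> W" for w using b(2) \<iota>I[OF that] by (auto simp: y_def z_def)
  have binj: "(i, k, t) = (i', k', t')" if "b (i, k, t) = b (i', k', t')" "i \<in> I" "i' \<in> I" for i k t i' k' t'
    by (rule inj_onD[OF b(1)]) (use that in auto)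
  have yinj: "inj_on y W" "inj_on z W"
    unfolding inj_on_def y_def z_def using binj \<iota>I \<iota>_inj by (metis prod.inject)+
  have yz: "y w \<noteq> z w'" if "w \<in> W" "w' \<in> W" for w w'
    unfolding y_def z_def using binj \<iota>I that by (metis prod.inject)
  have levk: "lev k < lev (y w)" if w: "w \<in> W" and k: "k \<in> Poly_Mapping.keys w" for w k
  proof -
    have "lev k \<le> Max (lev ` Poly_Mapping.keys w)" using k by (intro Max_ge) auto
    then show ?thesis using levb[OF \<iota>I[OF w]] by (simp add: y_def lv_def)
  qed
  have levz: "lev (z w) = lev (y w)" if "w \<in> W" for w using levb[OF \<iota>I[OF that]] by (simp add: y_def z_def)
  define e where "e w = inverse_comb (h w) (h (frag_of (y w))) (h (frag_of (z w)))" for w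
  have kyz: "Poly_Mapping.keys (frag_of (y w) :: 'g \<Rightarrow>\<^sub>0 int) \<subseteq> I"
    "Poly_Mapping.keys (frag_of (z w) :: 'g \<Rightarrow>\<^sub>0 int) \<subseteq> I" if "w \<in> W" for w
    using yzI[OF that] by auto
  have eF: "e w \<in> combs K F" if "w \<in> W" for w
    unfolding e_def by (rule inverse_comb_in[OF F_subgroup]) (use W[OF that] kyz[OF that] in \<open>auto simp: F_def\<close>)
  obtain L :: "((('k list \<times> nat) multiset) \<Rightarrow> 'k) ring" where L: "algebraic_closure L (K.indexed_const ` (carrier K))"
    and \<sigma>: "K.indexed_const \<in> ring_hom K L" by (rule K.exists_closure)
  interpret L: algebraic_closure L "K.indexed_const ` (carrier K)" by (rule L)
  have Linf: "infinite (carrier L)"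
    by (rule L.algebraically_closed_infinite) (rule L.algebraically_closed_axioms)
  have "e ` W \<subseteq> combs K A"
  proof
    fix d assume "d \<in> e ` W"
    then obtain w where "w \<in> W" "d = e w" by (elim imageE)
    then show "d \<in> combs K A" using subsetD[OF combs_mono[OF F_sub] eF] by simp
  qed
  moreover have "detects K G (e ` W) N" if N: "N \<in> \<A>" for N
  proof (rule detects_mono)
    have w: "wt N \<in> W" using N by (simp add: W_def)
    show "detects K G {e (wt N)} N"
      unfolding e_def by (rule detects_inverse_comb[OF wt(3)[OF N] N_facts(3)[OF N]])
        (use kyz[OF w] h_mem A_carrier in auto)
    show "{e (wt N)} \<subseteq> e ` W" using w by blast
  qed
  moreover have "solvable_on K G A E0" if E0: "finite E0" "E0 \<subseteq> e ` W" for E0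
  proof -
    obtain S where S: "finite S" "S \<subseteq> W" "E0 = e ` S" using finite_subset_image[OF E0] by blast
    have "\<exists>f \<in> hom (free_Abelian_group I) (units_of L). (\<forall>x\<in>{}. f x \<noteq> \<one>\<^bsub>L\<^esub>) \<and>
      (\<forall>w\<in>S. (\<one>\<^bsub>L\<^esub> \<ominus>\<^bsub>L\<^esub> f w) \<otimes>\<^bsub>L\<^esub> (f (frag_of (y w)) \<oplus>\<^bsub>L\<^esub> f (frag_of (z w))) = \<one>\<^bsub>L\<^esub>)"
    proof (rule L.generic_hom[OF Linf, of W I y z lev])
      show "Poly_Mapping.keys w \<subseteq> I \<and> w \<noteq> 0 \<and> y w \<in> I \<and> z w \<in> I \<and> lev (z w) = lev (y w)" if "w \<in> W" for w
        using W yzI levz that by blast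
    qed (use levk yinj yz S in auto)
    then obtain f where f: "f \<in> hom (free_Abelian_group I) (units_of L)"
      "\<And>w. w \<in> S \<Longrightarrow> (\<one>\<^bsub>L\<^esub> \<ominus>\<^bsub>L\<^esub> f w) \<otimes>\<^bsub>L\<^esub> (f (frag_of (y w)) \<oplus>\<^bsub>L\<^esub> f (frag_of (z w))) = \<one>\<^bsub>L\<^esub>" by blast
    interpret LU: comm_group "units_of L" by (rule L.units_comm_group)
    define \<chi> where "\<chi> x = f (inv_into {w. Poly_Mapping.keys w \<subseteq> I} h x)" for x
    have hinj: "inj_on h {w. Poly_Mapping.keys w \<subseteq> I}" using h_eq_iff by (auto simp: inj_on_def)
    have \<chi>: "\<chi> (h w) = f w" if "Poly_Mapping.keys w \<subseteq> I" for w
      unfolding \<chi>_def using inv_into_f_f[OF hinj] that by simp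
    have fL: "f w \<in> carrier L" if "Poly_Mapping.keys w \<subseteq> I" for w
      using hom_in_carrier[OF f(1), of w] that by (simp add: units_of_carrier L.Units_closed)
    have "solvable_on K G F E0"
    proof (rule solvable_of_character[OF F_subgroup L.field_axioms \<sigma>, of \<chi>])
      show "\<chi> x \<in> carrier L" if "x \<in> F" for x using that \<chi> fL by (auto simp: F_def)
      have "f 0 = \<one>\<^bsub>L\<^esub>" using hom_one[OF f(1) group_free_Abelian_group LU.is_group] by (simp add: units_of_one)
      then show one: "\<chi> \<one> = \<one>\<^bsub>L\<^esub>" using \<chi>[of 0] h_zero by simp
      show mult: "\<chi> (x \<otimes> x') = \<chi> x \<otimes>\<^bsub>L\<^esub> \<chi> x'" if xx: "x \<in> F" "x' \<in> F" for x x'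
      proof -
        obtain v v' where v: "Poly_Mapping.keys v \<subseteq> I" "x = h v" "Poly_Mapping.keys v' \<subseteq> I" "x' = h v'"
          using xx by (auto simp: F_def)
        have "Poly_Mapping.keys (v + v') \<subseteq> I" using keys_add[of v v'] v by blast
        then show ?thesis using \<chi> v h_add[OF v(1,3)] LU.free_hom_add[OF f(1) v(1,3)] by (metis units_of_mult)
      qed
      show "E0 \<subseteq> combs K F" using eF S by auto
      fix d assume "d \<in> E0"
      then obtain w where w: "w \<in> S" "d = e w" using S(3) by blast
      have wW: "w \<in> W" using w S by blast
      let ?a = "f w" and ?y = "f (frag_of (y w))" and ?z = "f (frag_of (z w))"
      have c: "?a \<in> carrier L" "?y \<in> carrier L" "?z \<in> carrier L" using fL W[OF wW] kyz[OF wW] by auto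
      have hF: "h w \<in> F" "h (frag_of (y w)) \<in> F" "h (frag_of (z w)) \<in> F"
        using W[OF wW] kyz[OF wW] by (auto simp: F_def)
      have \<sigma>1: "K.indexed_const \<one>\<^bsub>K\<^esub> = \<one>\<^bsub>L\<^esub>" using ring_hom_one[OF \<sigma>] .
      have \<sigma>m: "K.indexed_const (\<ominus>\<^bsub>K\<^esub> \<one>\<^bsub>K\<^esub>) = \<ominus>\<^bsub>L\<^esub> \<one>\<^bsub>L\<^esub>"
      proof -
        interpret s: ring_hom_ring K L K.indexed_const
          by (rule ring_hom_ringI2[OF K.ring_axioms L.ring_axioms \<sigma>])
        show ?thesis using s.hom_a_inv[OF K.one_closed] \<sigma>1 by simp
      qed
      have "comb_act (extension_space L K.indexed_const) (\<lambda>x v. \<chi> x \<otimes>\<^bsub>L\<^esub> v) d \<one>\<^bsub>L\<^esub> =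
        \<one>\<^bsub>L\<^esub> \<oplus>\<^bsub>L\<^esub> (\<ominus>\<^bsub>L\<^esub> ?y \<oplus>\<^bsub>L\<^esub> (\<ominus>\<^bsub>L\<^esub> ?z \<oplus>\<^bsub>L\<^esub> (?y \<otimes>\<^bsub>L\<^esub> ?a \<oplus>\<^bsub>L\<^esub> ?z \<otimes>\<^bsub>L\<^esub> ?a)))"
        using c \<chi> W[OF wW] kyz[OF wW] mult[OF hF(2,1)] mult[OF hF(3,1)] one \<sigma>1 \<sigma>m
        by (simp add: w(2) e_def inverse_comb_def L.l_minus)
      also have "\<dots> = \<one>\<^bsub>L\<^esub> \<ominus>\<^bsub>L\<^esub> (\<one>\<^bsub>L\<^esub> \<ominus>\<^bsub>L\<^esub> ?a) \<otimes>\<^bsub>L\<^esub> (?y \<oplus>\<^bsub>L\<^esub> ?z)"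
        using c by (simp add: L.minus_eq L.l_distr L.r_distr L.l_minus L.minus_add L.m_comm L.a_ac)
      also have "\<dots> = \<zero>\<^bsub>L\<^esub>" unfolding f(2)[OF w(1)] by (simp add: L.minus_eq L.r_neg)
      finally show "comb_act (extension_space L K.indexed_const) (\<lambda>x v. \<chi> x \<otimes>\<^bsub>L\<^esub> v) d \<one>\<^bsub>L\<^esub> = \<zero>\<^bsub>L\<^esub>" .
    qed
    then show ?thesis by (rule solvable_on_superset[OF _ F_sub])
  qed
  ultimately show ?thesis by blast
qed

end

lemma (in group_field) solvable_torsion_free_socle:
  assumes \<A>: "\<And>N. N \<in> \<A> \<Longrightarrow> torsion_free_min N"
  shows "\<exists>E \<subseteq> combs K (generate G (\<Union>\<A>)). (\<forall>N\<in>\<A>. detects K G E N) \<and>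
     (\<forall>E0. finite E0 \<and> E0 \<subseteq> E \<longrightarrow> solvable_on K G (generate G (\<Union>\<A>)) E0)"
proof -
  let ?A = "generate G (\<Union>\<A>)"
  have ab: "abelian_min N" if "N \<in> \<A>" for N using \<A>[OF that] by (simp add: torsion_free_min_def)
  have A: "subgroup ?A G"
    by (rule normal_imp_subgroup[OF generate_Union_normal]) (use ab min_normalD(1) in \<open>auto simp: abelian_min_def\<close>)
  have comm: "x \<otimes> y = y \<otimes> x" if "x \<in> ?A" "y \<in> ?A" for x y
    by (rule generate_abelian_min_commute[OF ab that])
  interpret C: comm_group "G\<lparr>carrier := ?A\<rparr>" using comm_subgroup_iff[OF A] comm by blast
  obtain I h where Ih: "I \<subseteq> ?A" "h \<in> hom (free_Abelian_group I) (G\<lparr>carrier := ?A\<rparr>)"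
    "\<And>w. \<lbrakk>Poly_Mapping.keys w \<subseteq> I; h w = \<one>\<rbrakk> \<Longrightarrow> w = 0"
    "\<And>a. a \<in> ?A \<Longrightarrow> \<exists>m>0. a [^] (m::nat) \<in> h ` {w. Poly_Mapping.keys w \<subseteq> I}"
    by (rule C.exists_free_subgroup) (simp add: nat_pow_consistent[symmetric])
  interpret torsion_free_part G K ?A \<A> I h
  proof (rule torsion_free_part.intro[OF group_field_axioms torsion_free_part_axioms.intro])
    show "subgroup ?A G" by (rule A)
    show "x \<otimes> y = y \<otimes> x" if "x \<in> ?A" "y \<in> ?A" for x y by (rule comm[OF that])
    show "x = \<one>" if "x \<in> ?A" "x [^] (k::nat) = \<one>" "k > 0" for x k
      by (rule generate_torsion_free[OF \<A> that])
    show "N \<subseteq> ?A" if "N \<in> \<A>" for N using that generate.incl[of _ "\<Union>\<A>" G] by blast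
  qed (use \<A> Ih in auto)
  show ?thesis using solvable_finite_rank solvable_infinite_rank by blast
qed

section \<open>Faithful irreducible representations\<close>

text \<open>A nonabelian minimal normal subgroup \<open>M\<close> commutes with the product of the others and with \<open>B\<close>,
  and it meets that product trivially: an \<open>M\<close> inside it would commute with itself. The induction
  carries along that the remaining minimal normal subgroups commute with the product.\<close>

lemma (in group_field) solvable_add_nonabelian:
  assumes B: "B \<lhd> G" "E \<subseteq> combs K B" "solvable_on K G B E"
    and \<M>: "finite \<M>" "\<And>M. M \<in> \<M> \<Longrightarrow> minimal_normal_subgroup G M \<and> \<not> comm_group (G\<lparr>carrier := M\<rparr>) \<and>
        e M \<in> combs K M \<and> solvable_on K G M {e M}"
    and comm: "\<And>M x y. \<lbrakk>M \<in> \<M>; x \<in> B; y \<in> M\<rbrakk> \<Longrightarrow> x \<otimes> y = y \<otimes> x"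
  shows "solvable_on K G (carrier G) (E \<union> e ` \<M>)"
proof -
  have "\<exists>H. H \<lhd> G \<and> B \<subseteq> H \<and> E \<union> e ` \<M> \<subseteq> combs K H \<and> solvable_on K G H (E \<union> e ` \<M>) \<and>
      (\<forall>M. minimal_normal_subgroup G M \<and> M \<notin> \<M> \<and> (\<forall>x\<in>B. \<forall>y\<in>M. x \<otimes> y = y \<otimes> x) \<longrightarrow>
        (\<forall>x\<in>H. \<forall>y\<in>M. x \<otimes> y = y \<otimes> x))" (is "\<exists>H. ?P \<M> H")
    using \<M> comm
  proof (induction \<M> rule: finite_induct)
    case empty
    then show ?case using B by (intro exI[of _ B]) auto
  next
    case (insert M \<M>)
    have "\<exists>H. ?P \<M> H"
    proof (rule insert.IH)
      show "minimal_normal_subgroup G M' \<and> \<not> comm_group (G\<lparr>carrier := M'\<rparr>) \<and>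
          e M' \<in> combs K M' \<and> solvable_on K G M' {e M'}" if "M' \<in> \<M>" for M'
        using insert.prems(1)[of M'] that by simp
      show "x \<otimes> y = y \<otimes> x" if "M' \<in> \<M>" "x \<in> B" "y \<in> M'" for M' x y
        using insert.prems(2)[of M' x y] that by simp
    qed
    then obtain H where PH: "?P \<M> H" by (elim exE)
    then have H: "H \<lhd> G" "B \<subseteq> H" "E \<union> e ` \<M> \<subseteq> combs K H" "solvable_on K G H (E \<union> e ` \<M>)"
      by auto
    have cent0: "\<forall>M. minimal_normal_subgroup G M \<and> M \<notin> \<M> \<and> (\<forall>x\<in>B. \<forall>y\<in>M. x \<otimes> y = y \<otimes> x) \<longrightarrow>
        (\<forall>x\<in>H. \<forall>y\<in>M. x \<otimes> y = y \<otimes> x)"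
      using PH by (elim conjE)
    have cent: "x \<otimes> y = y \<otimes> x"
      if "minimal_normal_subgroup G M" "M \<notin> \<M>" "\<forall>x\<in>B. \<forall>y\<in>M. x \<otimes> y = y \<otimes> x" "x \<in> H" "y \<in> M" for M x y
    proof -
      have "\<forall>x\<in>H. \<forall>y\<in>M. x \<otimes> y = y \<otimes> x"
        by (rule cent0[THEN spec, THEN mp]) (intro conjI that)
      then show ?thesis using that(4,5) by blast
    qed
    have M: "minimal_normal_subgroup G M" "\<not> comm_group (G\<lparr>carrier := M\<rparr>)" "e M \<in> combs K M"
      "solvable_on K G M {e M}" using insert.prems by auto
    have sH: "subgroup H G" and sM: "subgroup M G" using H(1) min_normalD(1)[OF M(1)] normal_imp_subgroup by blast+
    have HM: "x \<otimes> y = y \<otimes> x" if "x \<in> H" "y \<in> M" for x y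
      using cent[OF M(1) insert.hyps(2) _ that] insert.prems(2)[of M] by blast
    have disj: "H \<inter> M = {\<one>}"
    proof (rule ccontr)
      assume "H \<inter> M \<noteq> {\<one>}"
      then have "M \<subseteq> H" using min_normal_inter[OF M(1) H(1)] by blast
      then show False using HM M(2) comm_subgroup_iff[OF sM] by blast
    qed
    have n: "H <#> M \<lhd> G" by (rule set_mult_normal[OF H(1) min_normalD(1)[OF M(1)]])
    have c: "x \<in> carrier G" if "x \<in> H \<or> x \<in> M" for x
      using that subgroup.mem_carrier[OF sH] subgroup.mem_carrier[OF sM] by blast
    have sub: "H \<subseteq> H <#> M" "M \<subseteq> H <#> M"
      using subgroup.one_closed[OF sH] subgroup.one_closed[OF sM] c unfolding set_mult_def by force+
    have "solvable_on K G (H <#> M) ((E \<union> e ` \<M>) \<union> {e M})"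
      by (rule solvable_on_combine[OF sH sM HM disj H(4,3) M(4)]) (use M(3) in auto)
    moreover have "(E \<union> e ` \<M>) \<union> {e M} = E \<union> e ` insert M \<M>" by auto
    ultimately have s: "solvable_on K G (H <#> M) (E \<union> e ` insert M \<M>)" by simp
    have comb: "E \<union> e ` insert M \<M> \<subseteq> combs K (H <#> M)"
      using H(3) M(3) combs_mono[OF sub(1)] combs_mono[OF sub(2)] by blast
    have cent': "x \<otimes> y = y \<otimes> x"
      if M': "minimal_normal_subgroup G M'" "M' \<notin> insert M \<M>" "\<forall>x\<in>B. \<forall>y\<in>M'. x \<otimes> y = y \<otimes> x"
        and xy: "x \<in> H <#> M" "y \<in> M'" for M' x y
    proof -
      obtain u v where uv: "u \<in> H" "v \<in> M" "x = u \<otimes> v" using xy(1) by (auto simp: set_mult_def)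
      have "u \<otimes> y = y \<otimes> u" using cent[OF M'(1) _ M'(3) uv(1) xy(2)] M'(2) by blast
      moreover have "v \<otimes> y = y \<otimes> v"
        using normal_imp_commuting[OF min_normalD(1)[OF M(1)] min_normalD(1)[OF M'(1)] _ uv(2) xy(2)]
          min_normal_disjoint[OF M(1) M'(1)] M'(2) by blast
      moreover have "u \<in> carrier G" "v \<in> carrier G" "y \<in> carrier G"
        using uv c xy(2) min_normalD(4)[OF M'(1)] by auto
      ultimately show ?thesis using uv(3) by (metis m_assoc)
    qed
    have "?P (insert M \<M>) (H <#> M)"
    proof (intro conjI allI impI ballI n s comb)
      show "B \<subseteq> H <#> M" using H(2) sub(1) by (rule subset_trans)
      fix M' x y
      assume M': "minimal_normal_subgroup G M' \<and> M' \<notin> insert M \<M> \<and> (\<forall>x\<in>B. \<forall>y\<in>M'. x \<otimes> y = y \<otimes> x)"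
        and xy: "x \<in> H <#> M" "y \<in> M'"
      show "x \<otimes> y = y \<otimes> x"
        by (rule cent'[OF conjunct1[OF M'] conjunct1[OF conjunct2[OF M']] conjunct2[OF conjunct2[OF M']] xy])
    qed
    then show ?case by (rule exI)
  qed
  then obtain H where "H \<lhd> G" and s: "solvable_on K G H (E \<union> e ` \<M>)" by blast
  then have "H \<subseteq> carrier G" using subgroup.subset[OF normal_imp_subgroup] by blast
  then show ?thesis by (rule solvable_on_superset[OF s])
qed


text \<open>The equations for the three kinds of minimal normal subgroups are put together on the internal
  direct product of \<open>T(G)\<close>, of the subgroup generated by the torsion-free abelian minimal normal
  subgroups, and of finitely many nonabelian ones. A nontrivial kernel would meet the socle and hence
  contain a minimal normal subgroup, which the equations detect.\<close>

lemma (in group_field) exists_faithful_irreducible: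
  assumes ess: "essential_normal_subgroup G (Soc G)"
    and hyp: "\<And>M. \<lbrakk>normalization_semidom_class.prime (ring_char K);
           minimal_normal_subgroup G M;
           \<not> comm_group (G\<lparr>carrier := M\<rparr>);
           p_group (ring_char K) (G\<lparr>carrier := M\<rparr>);
           \<not> finitely_generated_group (G\<lparr>carrier := M\<rparr>)\<rbrakk>
         \<Longrightarrow> \<exists>(V :: ('k, 'v) module) \<rho>.
               irreducible_representation K (G\<lparr>carrier := M\<rparr>) V \<rho> \<and>
               nontrivial_representation K (G\<lparr>carrier := M\<rparr>) V \<rho>"
    and char: "ring_char K \<notin> tor_Soc_primes G"
    and S_ex: "\<exists>S. subgroup S (G\<lparr>carrier := tor_Soc G\<rparr>) \<and>
             locally_cyclic_group ((G\<lparr>carrier := tor_Soc G\<rparr>) Mod S) \<and>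
             normal_core G S = {\<one>}"
  shows "\<exists>(V :: ('k, ('g \<Rightarrow> 'k) set) module) \<rho>.
           irreducible_representation K G V \<rho> \<and> faithful_representation K G V \<rho>"
proof -
  define \<T> where "\<T> = {N. minimal_normal_subgroup G N \<and> comm_group (G\<lparr>carrier := N\<rparr>) \<and>
      torsion_group (G\<lparr>carrier := N\<rparr>)}"
  define \<A> where "\<A> = {N. torsion_free_min N}"
  define \<M> where "\<M> = {M. minimal_normal_subgroup G M \<and> \<not> comm_group (G\<lparr>carrier := M\<rparr>)}"
  let ?T = "tor_Soc G" and ?A = "generate G (\<Union>\<A>)"
  have T_def: "?T = generate G (\<Union>\<T>)" by (simp add: tor_Soc_def \<T>_def)
  have abT: "abelian_min N" if "N \<in> \<T>" for N using that abelian_min_cases(1) by (auto simp: \<T>_def)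
  have abA: "abelian_min N" if "N \<in> \<A>" for N using that by (simp add: \<A>_def torsion_free_min_def)
  have nab: "N \<lhd> G" "N \<subseteq> carrier G" if "abelian_min N" for N
    using that min_normalD(1,4) by (auto simp: abelian_min_def)
  have nT: "?T \<lhd> G" unfolding T_def by (rule generate_Union_normal) (use abT nab in blast)
  have nA: "?A \<lhd> G" by (rule generate_Union_normal) (use abA nab in blast)
  note sT = normal_imp_subgroup[OF nT] and sA = normal_imp_subgroup[OF nA]
  have Tsub: "\<Union>\<T> \<subseteq> carrier G" and Asub: "\<Union>\<A> \<subseteq> carrier G" using abT abA nab by blast+

  obtain S where S: "subgroup S (G\<lparr>carrier := ?T\<rparr>)"
    "locally_cyclic_group ((G\<lparr>carrier := ?T\<rparr>) Mod S)" "normal_core G S = {\<one>}"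
    using S_ex by blast
  obtain E1 where "E1 \<subseteq> combs K ?T \<and> (\<forall>N\<in>\<T>. detects K G E1 N) \<and>
      (\<forall>E0. finite E0 \<and> E0 \<subseteq> E1 \<longrightarrow> solvable_on K G ?T E0)"
    using solvable_torsion_socle[OF char S, folded \<T>_def] by (elim exE)
  then have E1: "E1 \<subseteq> combs K ?T" "\<And>N. N \<in> \<T> \<Longrightarrow> detects K G E1 N"
    "\<And>E0. \<lbrakk>finite E0; E0 \<subseteq> E1\<rbrakk> \<Longrightarrow> solvable_on K G ?T E0"
    by simp_all
  have tfA: "torsion_free_min N" if "N \<in> \<A>" for N using that by (simp add: \<A>_def)
  have "\<exists>E \<subseteq> combs K ?A. (\<forall>N\<in>\<A>. detects K G E N) \<and>
     (\<forall>E0. finite E0 \<and> E0 \<subseteq> E \<longrightarrow> solvable_on K G ?A E0)"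
    by (rule solvable_torsion_free_socle) (rule tfA)
  then obtain E2 where "E2 \<subseteq> combs K ?A \<and> (\<forall>N\<in>\<A>. detects K G E2 N) \<and>
      (\<forall>E0. finite E0 \<and> E0 \<subseteq> E2 \<longrightarrow> solvable_on K G ?A E0)"
    by (elim exE)
  then have E2: "E2 \<subseteq> combs K ?A" "\<And>N. N \<in> \<A> \<Longrightarrow> detects K G E2 N"
    "\<And>E0. \<lbrakk>finite E0; E0 \<subseteq> E2\<rbrakk> \<Longrightarrow> solvable_on K G ?A E0"
    by simp_all
  have "\<exists>e\<in>combs K M. aug K e \<noteq> \<zero>\<^bsub>K\<^esub> \<and> solvable_on K G M {e}" if "M \<in> \<M>" for M
  proof (rule nonabelian_min_normal_solvable)
    show M: "minimal_normal_subgroup G M" "\<not> comm_group (G\<lparr>carrier := M\<rparr>)" using that by (auto simp: \<M>_def)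
    show "\<exists>(V :: ('k, 'v) module) \<rho>. irreducible_representation K (G\<lparr>carrier := M\<rparr>) V \<rho> \<and>
               nontrivial_representation K (G\<lparr>carrier := M\<rparr>) V \<rho>"
      if "normalization_semidom_class.prime (ring_char K)" "p_group (ring_char K) (G\<lparr>carrier := M\<rparr>)"
        "\<not> finitely_generated_group (G\<lparr>carrier := M\<rparr>)"
      by (rule hyp[OF that(1) M that(2,3)])
  qed
  then obtain e where e: "\<And>M. M \<in> \<M> \<Longrightarrow> e M \<in> combs K M \<and> aug K (e M) \<noteq> \<zero>\<^bsub>K\<^esub> \<and> solvable_on K G M {e M}"
    by metis
  define E where "E = E1 \<union> E2 \<union> e ` \<M>"

  have commTA: "x \<otimes> y = y \<otimes> x" if "x \<in> ?T" "y \<in> ?A" for x y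
    by (rule generate_commute[OF Tsub Asub _ that[unfolded T_def]]) (use abT abA abelian_min_commute in blast)
  have tors: "\<exists>k>0. x [^] (k::nat) = \<one>" if "x \<in> ?T" for x
    using that unfolding T_def
  proof (induction x rule: generate.induct)
    case one
    show ?case by (intro exI[of _ 1]) simp
  next
    case (incl x)
    then obtain N where N: "N \<in> \<T>" "x \<in> N" by blast
    have "ord x > 0" using N ord_subgroup[OF normal_imp_subgroup[OF nab(1)[OF abT[OF N(1)]]] N(2)]
      by (auto simp: torsion_group_def \<T>_def)
    moreover have "x \<in> carrier G" using N nab(2)[OF abT[OF N(1)]] by blast
    ultimately show ?case by (intro exI[of _ "ord x"]) simp
  next
    case (inv x)
    then obtain N where N: "N \<in> \<T>" "x \<in> N" by blast
    have "ord x > 0" using N ord_subgroup[OF normal_imp_subgroup[OF nab(1)[OF abT[OF N(1)]]] N(2)]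
      by (auto simp: torsion_group_def \<T>_def)
    moreover have "x \<in> carrier G" using N nab(2)[OF abT[OF N(1)]] by blast
    ultimately show ?case by (intro exI[of _ "ord x"]) (simp add: nat_pow_inv)
  next
    case (eng x y)
    then obtain k l where kl: "k > 0" "x [^] (k::nat) = \<one>" "l > 0" "y [^] (l::nat) = \<one>" by blast
    have c: "x \<in> carrier G" "y \<in> carrier G" using eng(1,2) generate_in_carrier[OF Tsub] by auto
    have xy: "x \<otimes> y = y \<otimes> x" by (rule generate_abelian_min_commute[OF abT eng(1,2)])
    have "(x \<otimes> y) [^] (k * l) = x [^] (k * l) \<otimes> y [^] (l * k)"
      using pow_mult_distrib[OF xy c, of "k * l"] by (simp add: mult.commute)
    also have "\<dots> = (x [^] k) [^] l \<otimes> (y [^] l) [^] k" using c by (simp add: nat_pow_pow)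
    finally have "(x \<otimes> y) [^] (k * l) = (x [^] k) [^] l \<otimes> (y [^] l) [^] k" .
    then show ?case using kl by (intro exI[of _ "k * l"]) simp
  qed
  have disj: "?T \<inter> ?A = {\<one>}"
  proof
    show "?T \<inter> ?A \<subseteq> {\<one>}"
    proof
      fix x assume x: "x \<in> ?T \<inter> ?A"
      then obtain k where "k > 0" "x [^] (k::nat) = \<one>" using tors by blast
      then have "x = \<one>" using generate_torsion_free[of \<A> x k] x by (simp add: \<A>_def)
      then show "x \<in> {\<one>}" by simp
    qed
    show "{\<one>} \<subseteq> ?T \<inter> ?A" using subgroup.one_closed[OF sT] subgroup.one_closed[OF sA] by simp
  qed
  let ?B = "?T <#> ?A"
  have nB: "?B \<lhd> G" by (rule set_mult_normal[OF nT nA])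
  have TB: "?T \<subseteq> ?B" and AB: "?A \<subseteq> ?B"
    using subgroup.one_closed[OF sT] subgroup.one_closed[OF sA] subgroup.mem_carrier[OF sT]
      subgroup.mem_carrier[OF sA] unfolding set_mult_def by force+
  have commM: "x \<otimes> y = y \<otimes> x" if M: "M \<in> \<M>" and xy: "x \<in> ?B" "y \<in> M" for M x y
  proof -
    have mM: "minimal_normal_subgroup G M" "\<not> comm_group (G\<lparr>carrier := M\<rparr>)" using M by (auto simp: \<M>_def)
    have cM: "u \<otimes> v = v \<otimes> u" if N: "abelian_min N" and uv: "u \<in> N" "v \<in> M" for N u v
    proof (rule normal_imp_commuting[OF nab(1)[OF N] min_normalD(1)[OF mM(1)] _ uv])
      have "N \<noteq> M"
        using N mM(2) comm_subgroup_iff[OF normal_imp_subgroup[OF min_normalD(1)[OF mM(1)]]]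
        by (auto simp: abelian_min_def)
      then show "N \<inter> M \<subseteq> {\<one>}" using min_normal_disjoint[OF _ mM(1)] N by (simp add: abelian_min_def)
    qed
    obtain u v where uv: "u \<in> ?T" "v \<in> ?A" "x = u \<otimes> v" using xy(1) by (auto simp: set_mult_def)
    have yM: "y \<in> generate G M" using xy(2) by (rule generate.incl)
    have MG: "M \<subseteq> carrier G" by (rule min_normalD(4)[OF mM(1)])
    have "u \<otimes> y = y \<otimes> u"
      by (rule generate_commute[OF Tsub MG _ uv(1)[unfolded T_def] yM]) (use cM abT in blast)
    moreover have "v \<otimes> y = y \<otimes> v"
      by (rule generate_commute[OF Asub MG _ uv(2) yM]) (use cM abA in blast)
    moreover have "u \<in> carrier G" "v \<in> carrier G" "y \<in> carrier G"
      using uv subgroup.mem_carrier[OF sT] subgroup.mem_carrier[OF sA] xy(2) MG by auto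
    ultimately show ?thesis using uv(3) by (metis m_assoc)
  qed

  have E: "E \<subseteq> combs K (carrier G)"
  proof
    fix d assume "d \<in> E"
    then consider "d \<in> E1" | "d \<in> E2" | M where "M \<in> \<M>" "d = e M" unfolding E_def by blast
    then show "d \<in> combs K (carrier G)"
    proof cases
      case 1
      then show ?thesis using subsetD[OF combs_mono[OF subgroup.subset[OF sT]]] E1(1) by blast
    next
      case 2
      then show ?thesis using subsetD[OF combs_mono[OF subgroup.subset[OF sA]]] E2(1) by blast
    next
      case 3
      then have "M \<subseteq> carrier G" using min_normalD(4) by (simp add: \<M>_def)
      then show ?thesis using subsetD[OF combs_mono] e[OF 3(1)] 3(2) by metis
    qed
  qed
  have solv: "solvable_on K G (carrier G) E0" if E0: "finite E0" "E0 \<subseteq> E" for E0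
  proof -
    obtain \<M>0 where M0: "finite \<M>0" "\<M>0 \<subseteq> \<M>" "E0 \<inter> e ` \<M> = e ` \<M>0"
      using finite_subset_image[of "E0 \<inter> e ` \<M>" e \<M>] E0(1) by blast
    have sb: "solvable_on K G ?B ((E0 \<inter> E1) \<union> (E0 \<inter> E2))"
    proof (rule solvable_on_combine[OF sT sA commTA disj])
      show "solvable_on K G ?T (E0 \<inter> E1)" by (rule E1(3)) (use E0 in auto)
      show "solvable_on K G ?A (E0 \<inter> E2)" by (rule E2(3)) (use E0 in auto)
    qed (use E1(1) E2(1) in blast)+
    have "solvable_on K G (carrier G) (((E0 \<inter> E1) \<union> (E0 \<inter> E2)) \<union> e ` \<M>0)"
    proof (rule solvable_add_nonabelian[OF nB _ sb M0(1)])
      show "E0 \<inter> E1 \<union> E0 \<inter> E2 \<subseteq> combs K ?B"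
        using E1(1) E2(1) combs_mono[OF TB] combs_mono[OF AB] by blast
      show "minimal_normal_subgroup G M \<and> \<not> comm_group (G\<lparr>carrier := M\<rparr>) \<and> e M \<in> combs K M \<and> solvable_on K G M {e M}"
        if "M \<in> \<M>0" for M using that M0(2) e[of M] by (auto simp: \<M>_def)
      show "x \<otimes> y = y \<otimes> x" if "M \<in> \<M>0" "x \<in> ?B" "y \<in> M" for M x y
        using commM[of M x y] that M0(2) by blast
    qed
    moreover have "E0 \<subseteq> ((E0 \<inter> E1) \<union> (E0 \<inter> E2)) \<union> e ` \<M>0" using E0(2) M0(3) by (auto simp: E_def)
    ultimately show ?thesis by (rule solvable_on_mono)
  qed
  have det: "detects K G E N" if N: "minimal_normal_subgroup G N" for N
  proof (cases "comm_group (G\<lparr>carrier := N\<rparr>)")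
    case True
    show ?thesis
    proof (cases "torsion_group (G\<lparr>carrier := N\<rparr>)")
      case tor: True
      then have "detects K G E1 N" using E1(2) N True by (simp add: \<T>_def)
      then show ?thesis by (rule detects_mono) (auto simp: E_def)
    next
      case False
      then have "detects K G E2 N" using E2(2) abelian_min_cases(2)[OF N True] by (simp add: \<A>_def)
      then show ?thesis by (rule detects_mono) (auto simp: E_def)
    qed
  next
    case False
    then have M: "N \<in> \<M>" using N by (simp add: \<M>_def)
    have "detects K G {e N} N" by (rule detects_aug) (use e[OF M] min_normalD(4)[OF N] in auto)
    then show ?thesis by (rule detects_mono) (use M in \<open>auto simp: E_def\<close>)
  qed

  obtain V :: "('k, ('g \<Rightarrow> 'k) set) module" and \<rho> where V: "irreducible_representation K G V \<rho>"
    "\<And>N. \<lbrakk>N \<subseteq> carrier G; \<And>n. n \<in> N \<Longrightarrow> \<rho> n = \<one>\<^bsub>GL K V\<^esub>\<rbrakk> \<Longrightarrow> \<not> detects K G E N"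
    using irreducible_of_solvable[OF E solv] by blast
  have rep: "representation K G V \<rho>" using V(1) by (simp add: irreducible_representation_def)
  then have mV: "module K V" and \<rho>: "\<rho> \<in> hom G (GL K V)" by (auto simp: representation_def)
  interpret \<rho>: group_hom G "GL K V" \<rho>
    using module.group_GL[OF mV] \<rho> by (simp add: group_hom_def group_hom_axioms_def is_group)
  have ker: "kernel G (GL K V) \<rho> = {\<one>}"
  proof (rule ccontr)
    assume nt: "kernel G (GL K V) \<rho> \<noteq> {\<one>}"
    have nK: "kernel G (GL K V) \<rho> \<lhd> G" by (rule \<rho>.normal_kernel)
    then have "kernel G (GL K V) \<rho> \<inter> Soc G \<noteq> {\<one>}"
      using ess nt by (simp add: essential_normal_subgroup_def)
    moreover have "\<one> \<in> kernel G (GL K V) \<rho> \<inter> Soc G"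
      using subgroup.one_closed[OF normal_imp_subgroup[OF nK]] generate.one by (simp add: Soc_def)
    ultimately obtain x where "x \<in> kernel G (GL K V) \<rho>" "x \<in> Soc G" "x \<noteq> \<one>" by blast
    then obtain N where N: "minimal_normal_subgroup G N" "N \<subseteq> kernel G (GL K V) \<rho>"
      using contains_min_normal[OF nK] by blast
    have "\<not> detects K G E N" by (rule V(2)) (use N min_normalD(4)[OF N(1)] in \<open>auto simp: kernel_def\<close>)
    then show False using det[OF N(1)] by blast
  qed
  then have "inj_on \<rho> (carrier G)" by (rule \<rho>.trivial_ker_imp_inj)
  then have "faithful_representation K G V \<rho>" using rep by (simp add: faithful_representation_def)
  then show ?thesis using V(1) by blast
qed

theorem theorem1p1:
  fixes G :: "('g, 'b) monoid_scheme"
    and K :: "('k, 'c) ring_scheme"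
  assumes "group G"
    and "field K"
    and "essential_normal_subgroup G (Soc G)"
    and "\<And>p M. \<lbrakk>normalization_semidom_class.prime p; ring_char K = p;
           minimal_normal_subgroup G M;
           \<not> comm_group (G\<lparr>carrier := M\<rparr>);
           p_group p (G\<lparr>carrier := M\<rparr>);
           \<not> finitely_generated_group (G\<lparr>carrier := M\<rparr>)\<rbrakk>
         \<Longrightarrow> \<exists>(V :: ('k, 'v) module) \<rho>.
               irreducible_representation K (G\<lparr>carrier := M\<rparr>) V \<rho> \<and>
               nontrivial_representation K (G\<lparr>carrier := M\<rparr>) V \<rho>"
    and "ring_char K \<notin> tor_Soc_primes G"
    and "\<exists>S. subgroup S (G\<lparr>carrier := tor_Soc G\<rparr>) \<and>
             locally_cyclic_group ((G\<lparr>carrier := tor_Soc G\<rparr>) Mod S) \<and>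
             normal_core G S = {\<one>\<^bsub>G\<^esub>}"
  shows "\<exists>(V :: ('k, ('g \<Rightarrow> 'k) set) module) \<rho>.
           irreducible_representation K G V \<rho> \<and> faithful_representation K G V \<rho>"
proof -
  interpret group_field G K by (simp add: group_field_def assms(1,2))
  show ?thesis
    by (rule exists_faithful_irreducible[OF assms(3) assms(4)[OF _ refl] assms(5,6)])
qed

end
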